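(* Let $Q_{\widetilde XY}$ be a joint law of $(\widetilde X,Y)$ that synthesizes $(\epsilon,\delta)$-LDP. Assume that a given rate $R$ satisfies $R>I(\widetilde X;Y)>0$ (mutual information under $Q_{\widetilde XY}$) and that the moment generating function of the information density $\imath_{\widetilde X;Y}(\widetilde X,Y)$ (under $Q_{\widetilde XY}$) is finite in a neighborhood of the origin. Let $\rho^\star=\arg\max_{0<\rho\le 1/2}\rho\bigl(R-I_{\frac{1}{1-\rho}}(\widetilde X;Y)\bigr)$. Then for every $n\ge1$ there exists an RDFC encoder-decoder pair of blocklength $n$ and communication rate $R$ such that, for any $a>1$, $$\Bigl\|P_{\widetilde X^nY^n}-\prod_{i=1}^n Q_{\widetilde XY}\Bigr\|_{\mathrm{TV}}\le a\Delta_n,$$ where, for some constant $K>0$, $$\Delta_n=K\begin{cases} e^{-\frac n2\,(R-I_2(\widetilde X;Y))}, & \text{if } \rho^\star=\tfrac12,\\ n^{-\frac{1-\rho^\star}{2}}\,e^{-n\rho^\star(R-I_{\frac{1}{1-\rho^\star}}(\widetilde X;Y))}, & \text{if } \rho^\star<\tfrac12.\end{cases}$$ Consequently, the induced joint law $P_{\widetilde X^nY^n}$ synthesizes $(\epsilon,\delta_n)$-LDP with $\delta_n=\delta+2(e^\epsilon+1)a\Delta_n$.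
   Context: RDFC encoder-decoder pair of blocklength $n$, communication rate $R$ and common-randomness rate $R_0\ge0$: the input $\widetilde X^n$ is i.i.d. according to the $\widetilde X$-marginal of $Q_{\widetilde XY}$; a common randomness $C$, uniform on $\{1,\dots,2^{nR_0}\}$ and independent of $\widetilde X^n$, is available to both encoder and decoder; the (possibly randomized) encoder maps $(\widetilde X^n,C)$ to an index $S\in\{1,\dots,2^{nR}\}$ sent over a noiseless link; the (possibly randomized) decoder maps $(S,C)$ to $Y^n$. $P_{\widetilde X^nY^n}$ is the joint law of $(\widetilde X^n,Y^n)$ induced by the pair. $\|P-Q\|_{\mathrm{TV}}=\sup_{A}|P(A)-Q(A)|$ is the total variation distance. A mechanism $\mathcal M$ mapping each $\widetilde x$ to a probability distribution $\mathcal M(\cdot\mid\widetilde x)$ on $\mathcal Y$ is $(\epsilon,\delta)$-LDP ($\epsilon\ge0$, $\delta\in[0,1]$) if $\sup_{\widetilde x,\widetilde x'}\sup_{S\subseteq\mathcal Y}\bigl(\mathcal M(S\mid\widetilde x)-e^\epsilon\mathcal M(S\mid\widetilde x')\bigr)\le\delta$. A joint law synthesizes $(\epsilon,\delta)$-LDP if its conditional law of $Y$ given $\widetilde X$ is an $(\epsilon,\delta)$-LDP mechanism (for the induced $n$-letter law, this refers to the conditional law of a single output letter given the corresponding input letter). Information density: $\imath_{\widetilde X;Y}(\widetilde x,y)=\log\frac{dQ_{\widetilde XY}}{d(Q_{\widetilde X}Q_Y)}(\widetilde x,y)$. For $\alpha>1$, the $\alpha$-mutual information is $I_\alpha(\widetilde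 X;Y)=\frac{\alpha}{\alpha-1}\log\mathbb E\bigl[\mathbb E^{1/\alpha}[e^{\alpha\,\imath_{\widetilde X;Y}(\bar X,\bar Y)}\mid\bar Y]\bigr]$ where $(\bar X,\bar Y)\sim Q_{\widetilde X}Q_Y$ (product of the marginals).
   Formalization: Rates are measured in nats: the index and common-randomness sets have ⌊e^{nR}⌋ and ⌊e^{nR_0}⌋ elements instead of 2^{nR} and 2^{nR_0}, since with natural logarithms the claim with 2^{nR} indices fails for I<R<I/ln 2 (e.g. X=Y a uniform bit, δ=1). *)

theory Defs
  imports "HOL-Probability.Probability"
begin

text \<open>Conventions: all logarithms are natural (base e), consistent with the
exponentials e^{alpha i} and e^epsilon in the paper.  Rates are measured in nats,
so a rate R corresponds to floor(e^{nR}) indices.\<close>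

definition tv_dist :: "'a measure \<Rightarrow> 'a measure \<Rightarrow> real" where
  "tv_dist P Q = (SUP A \<in> sets P. \<bar>measure P A - measure Q A\<bar>)"

definition ldp_mechanism :: "'a measure \<Rightarrow> 'b measure \<Rightarrow> ('a \<Rightarrow> 'b measure) \<Rightarrow> real \<Rightarrow> real \<Rightarrow> bool" where
  "ldp_mechanism MX MY W \<epsilon> \<delta> \<longleftrightarrow>
     (\<forall>x\<in>space MX. \<forall>x'\<in>space MX. \<forall>S\<in>sets MY.
        measure (W x) S - exp \<epsilon> * measure (W x') S \<le> \<delta>)"

text \<open>A joint law J on MX x MY synthesizes (epsilon,delta)-LDP if (a version of) its
conditional law of Y given X is an (epsilon,delta)-LDP mechanism, i.e. J is the
composition of its X-marginal with an LDP kernel.\<close>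
definition synthesizes_ldp :: "'a measure \<Rightarrow> 'b measure \<Rightarrow> ('a \<times> 'b) measure \<Rightarrow> real \<Rightarrow> real \<Rightarrow> bool" where
  "synthesizes_ldp MX MY J \<epsilon> \<delta> \<longleftrightarrow>
     (\<exists>W. W \<in> MX \<rightarrow>\<^sub>M prob_algebra MY \<and>
          J = distr J MX fst \<bind> (\<lambda>x. W x \<bind> (\<lambda>y. return (MX \<Otimes>\<^sub>M MY) (x, y))) \<and>
          ldp_mechanism MX MY W \<epsilon> \<delta>)"

definition synthesizes_ldp_n :: "nat \<Rightarrow> 'a measure \<Rightarrow> 'b measure \<Rightarrow> ((nat \<Rightarrow> 'a) \<times> (nat \<Rightarrow> 'b)) measure \<Rightarrow> real \<Rightarrow> real \<Rightarrow> bool" where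
  "synthesizes_ldp_n n MX MY P \<epsilon> \<delta> \<longleftrightarrow>
     (\<forall>i<n. synthesizes_ldp MX MY (distr P (MX \<Otimes>\<^sub>M MY) (\<lambda>(xs, ys). (xs i, ys i))) \<epsilon> \<delta>)"

definition info_density :: "'a measure \<Rightarrow> 'b measure \<Rightarrow> ('a \<times> 'b) measure \<Rightarrow> ('a \<times> 'b \<Rightarrow> real)" where
  "info_density MX MY Q = entropy_density (exp 1) (distr Q MX fst \<Otimes>\<^sub>M distr Q MY snd) Q"

definition mutual_info :: "'a measure \<Rightarrow> 'b measure \<Rightarrow> ('a \<times> 'b) measure \<Rightarrow> real" where
  "mutual_info MX MY Q = prob_space.mutual_information Q (exp 1) MX MY fst snd"

text \<open>alpha-mutual information (Sibson), with values in the extended reals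
(it may be +infinity).  Here e^{alpha i} is written as (dQ/d(QX QY))^alpha, which
is the correct reading also where the density vanishes (e^{-infinity} = 0).\<close>
definition renyi_mi :: "real \<Rightarrow> 'a measure \<Rightarrow> 'b measure \<Rightarrow> ('a \<times> 'b) measure \<Rightarrow> ereal" where
  "renyi_mi \<alpha> MX MY Q =
     (let QX = distr Q MX fst; QY = distr Q MY snd;
          r = (\<lambda>x y. enn2real (RN_deriv (QX \<Otimes>\<^sub>M QY) Q (x, y)));
          inner = (\<lambda>y. \<integral>\<^sup>+ x. ennreal (r x y powr \<alpha>) \<partial>QX);
          outer = (\<integral>\<^sup>+ y. (if inner y = \<top> then \<top> else ennreal (enn2real (inner y) powr (1 / \<alpha>))) \<partial>QY)
      in if outer = \<top> then \<infinity> else ereal (\<alpha> / (\<alpha> - 1) * ln (enn2real outer)))"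

definition nidx :: "nat \<Rightarrow> real \<Rightarrow> nat" where
  "nidx n R = nat \<lfloor>exp (real n * R)\<rfloor>"

text \<open>RDFC encoder-decoder pair of blocklength n, rate R, common-randomness rate R0.
enc c : randomized encoder, kernel from X^n to indices {1..nidx n R} given C = c;
dec s c : randomized decoder output law on Y^n given S = s and C = c.\<close>
definition rdfc_pair :: "nat \<Rightarrow> real \<Rightarrow> real \<Rightarrow> 'a measure \<Rightarrow> 'b measure
    \<Rightarrow> (nat \<Rightarrow> (nat \<Rightarrow> 'a) \<Rightarrow> nat measure) \<Rightarrow> (nat \<Rightarrow> nat \<Rightarrow> (nat \<Rightarrow> 'b) measure) \<Rightarrow> bool" where
  "rdfc_pair n R R0 MX MY enc dec \<longleftrightarrow>
     R0 \<ge> 0 \<and>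
     (\<forall>c\<in>{1..nidx n R0}. enc c \<in> PiM {..<n} (\<lambda>_. MX) \<rightarrow>\<^sub>M prob_algebra (count_space {1..nidx n R})) \<and>
     (\<forall>s\<in>{1..nidx n R}. \<forall>c\<in>{1..nidx n R0}. dec s c \<in> space (prob_algebra (PiM {..<n} (\<lambda>_. MY))))"

definition rdfc_joint :: "nat \<Rightarrow> real \<Rightarrow> 'a measure \<Rightarrow> 'b measure \<Rightarrow> 'a measure
    \<Rightarrow> (nat \<Rightarrow> (nat \<Rightarrow> 'a) \<Rightarrow> nat measure) \<Rightarrow> (nat \<Rightarrow> nat \<Rightarrow> (nat \<Rightarrow> 'b) measure)
    \<Rightarrow> ((nat \<Rightarrow> 'a) \<times> (nat \<Rightarrow> 'b)) measure" where
  "rdfc_joint n R0 MX MY QX enc dec =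
     PiM {..<n} (\<lambda>_. QX) \<bind> (\<lambda>x.
       uniform_count_measure {1..nidx n R0} \<bind> (\<lambda>c.
         enc c x \<bind> (\<lambda>s.
           dec s c \<bind> (\<lambda>y. return (PiM {..<n} (\<lambda>_. MX) \<Otimes>\<^sub>M PiM {..<n} (\<lambda>_. MY)) (x, y)))))"

definition iid_joint :: "nat \<Rightarrow> 'a measure \<Rightarrow> 'b measure \<Rightarrow> ('a \<times> 'b) measure
    \<Rightarrow> ((nat \<Rightarrow> 'a) \<times> (nat \<Rightarrow> 'b)) measure" where
  "iid_joint n MX MY Q =
     distr (PiM {..<n} (\<lambda>_. Q)) (PiM {..<n} (\<lambda>_. MX) \<Otimes>\<^sub>M PiM {..<n} (\<lambda>_. MY))
       (\<lambda>z. (\<lambda>i\<in>{..<n}. fst (z i), \<lambda>i\<in>{..<n}. snd (z i)))"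

end

theory Submission
  imports Defs
begin

text \<open>A random codebook with a likelihood encoder controls the induced law only on average over the
  inputs, which says nothing about the privacy of an individual letter.  The block channel is instead
  simulated by rejection sampling from shared codewords.  This is accurate for every single input
  as soon as the kernel has a density of order at most \<open>e\<^sup>n\<^sup>R / n\<close> with respect to a product law \<open>q\<^sup>n\<close>.

  Let \<open>p = 1 / (1 - \<rho>)\<close>, let \<open>q\<close> be Sibson's minimiser and \<open>g\<close> the density of the letter kernel
  with respect to it, so that \<open>g\<close> has \<open>p\<close>-th moment \<open>e\<^bsup>(p-1)I\<^esup>\<close>.  If \<open>\<parallel>g(x,\<cdot>)\<parallel>\<^sub>p\<close> does not depend on
  \<open>x\<close>, then cutting the block density off at a level \<open>L\<close> loses at most \<open>L\<^bsup>1-p\<^esup> e\<^bsup>n(p-1)I\<^esup>\<close> for every input,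
  and the exponent \<open>p - 1\<close> exceeds \<open>\<rho>\<close>.  Otherwise \<open>E \<parallel>g(x,\<cdot>)\<parallel>\<^sub>p < e\<^bsup>\<rho>I\<^esup>\<close> by strict Jensen; then the block
  density is truncated by an operator that is monotone, homogeneous and mass preserving.  Such an operator
  contracts hockey-stick divergences, hence preserves LDP exactly, and its cost is at most
  \<open>2 L\<^bsup>-\<rho>\<^esup> (E \<parallel>g(x,\<cdot>)\<parallel>\<^sub>p)\<^sup>n\<close>.  Both cases leave an exponential gain over the claimed bound, and this
  absorbs all polynomial factors.\<close>

section \<open>Approximation by functions of finitely many output cells\<close>

text \<open>The common randomness takes finitely many values while the output space is arbitrary, so
  shared proposals cannot be drawn from \<open>q\<close> itself. The density is therefore
  approximated in mean by a function that sees the output only through a finite partition; the input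
  is left untouched, because the encoder may use any measurable function of it. Such an
  approximation holds only on average over inputs and would ruin privacy. The simulated channel is
  hence compared with a resampled channel in which each cell keeps its exact probability: resampling
  is post-processing, so privacy never meets the approximation error.

  A second obstacle is that the joint law fixes the letter kernel only almost everywhere, whereas
  LDP is a supremum over all inputs; the kernel has to be modified on a null set of inputs.

  The truncation level is \<open>exp (n R) / (4 b n)\<close> with
  \<open>b = \<rho> (R - I) + 1\<close>: then all of about \<open>exp (n R)\<close> proposals fail
  with probability of order \<open>exp (- b n)\<close>, a factor \<open>exp (- n)\<close> below the
  claimed exponential.\<close>

definition cell_fun :: "'a measure \<Rightarrow> 'b measure \<Rightarrow> ('a \<times> 'b \<Rightarrow> 'c) \<Rightarrow> 'c measure \<Rightarrow> bool" where
  "cell_fun A B f N \<longleftrightarrow> (\<exists>(m::nat) \<kappa> h. \<kappa> \<in> B \<rightarrow>\<^sub>M count_space UNIV \<and> (\<forall>y\<in>space B. \<kappa> y < m) \<and>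
     (\<forall>k. h k \<in> A \<rightarrow>\<^sub>M N) \<and> (\<forall>x\<in>space A. \<forall>y\<in>space B. f (x, y) = h (\<kappa> y) x))"

lemma cell_fun_const: "c \<in> space N \<Longrightarrow> cell_fun A B (\<lambda>_. c) N"
  unfolding cell_fun_def by (intro exI[of _ 1] exI[of _ "\<lambda>_. 0"] exI[of _ "\<lambda>_ _. c"]) auto

lemma cell_fun_comp:
  assumes "cell_fun A B f N" "\<phi> \<in> N \<rightarrow>\<^sub>M L"
  shows "cell_fun A B (\<lambda>z. \<phi> (f z)) L"
proof -
  from assms(1) obtain m \<kappa> h where *: "\<kappa> \<in> B \<rightarrow>\<^sub>M count_space UNIV" "\<forall>y\<in>space B. \<kappa> y < (m::nat)"
    "\<forall>k. h k \<in> A \<rightarrow>\<^sub>M N" "\<forall>x\<in>space A. \<forall>y\<in>space B. f (x, y) = h (\<kappa> y) x"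
    unfolding cell_fun_def by blast
  show ?thesis unfolding cell_fun_def
    by (rule exI[of _ m], rule exI[of _ \<kappa>], rule exI[of _ "\<lambda>k x. \<phi> (h k x)"])
       (use * assms(2) in \<open>auto intro: measurable_compose\<close>)
qed

text \<open>Two partitions are merged into their common refinement, with cells numbered by
  \<^term>\<open>i * m + j\<close>.\<close>
lemma cell_fun_Pair:
  assumes "cell_fun A B f N" "cell_fun A B g L"
  shows "cell_fun A B (\<lambda>z. (f z, g z)) (N \<Otimes>\<^sub>M L)"
proof -
  from assms(1) obtain m1 \<kappa>1 h1 where 1: "\<kappa>1 \<in> B \<rightarrow>\<^sub>M count_space UNIV" "\<forall>y\<in>space B. \<kappa>1 y < (m1::nat)"
    "\<forall>k. h1 k \<in> A \<rightarrow>\<^sub>M N" "\<forall>x\<in>space A. \<forall>y\<in>space B. f (x, y) = h1 (\<kappa>1 y) x"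
    unfolding cell_fun_def by blast
  from assms(2) obtain m2 \<kappa>2 h2 where 2: "\<kappa>2 \<in> B \<rightarrow>\<^sub>M count_space UNIV" "\<forall>y\<in>space B. \<kappa>2 y < (m2::nat)"
    "\<forall>k. h2 k \<in> A \<rightarrow>\<^sub>M L" "\<forall>x\<in>space A. \<forall>y\<in>space B. g (x, y) = h2 (\<kappa>2 y) x"
    unfolding cell_fun_def by blast
  define \<kappa> where "\<kappa> y = \<kappa>1 y * m2 + \<kappa>2 y" for y
  define h where "h k x = (h1 (k div m2) x, h2 (k mod m2) x)" for k x
  have [measurable]: "\<kappa>1 \<in> B \<rightarrow>\<^sub>M count_space UNIV" "\<kappa>2 \<in> B \<rightarrow>\<^sub>M count_space UNIV" using 1 2 by auto
  have [measurable]: "h1 k \<in> A \<rightarrow>\<^sub>M N" "h2 k \<in> A \<rightarrow>\<^sub>M L" for k using 1 2 by auto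
  have "\<kappa> \<in> B \<rightarrow>\<^sub>M count_space UNIV" unfolding \<kappa>_def by measurable
  moreover have "\<kappa> y < m1 * m2" if "y \<in> space B" for y
  proof -
    have "\<kappa> y < (\<kappa>1 y + 1) * m2" using 2(2) that by (auto simp: \<kappa>_def)
    also have "\<dots> \<le> m1 * m2" using 1(2) that by (intro mult_right_mono) (auto simp: Suc_le_eq)
    finally show ?thesis .
  qed
  moreover have "h k \<in> A \<rightarrow>\<^sub>M N \<Otimes>\<^sub>M L" for k unfolding h_def by measurable
  moreover have "(f (x, y), g (x, y)) = h (\<kappa> y) x" if "x \<in> space A" "y \<in> space B" for x y
    using 1(4) 2(4) 2(2) that by (auto simp: h_def \<kappa>_def)
  ultimately show ?thesis unfolding cell_fun_def by blast
qed

lemma cell_fun_measurable: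
  assumes "cell_fun A B f N" shows "f \<in> A \<Otimes>\<^sub>M B \<rightarrow>\<^sub>M N"
proof -
  from assms obtain m \<kappa> h where *: "\<kappa> \<in> B \<rightarrow>\<^sub>M count_space UNIV" "\<forall>y\<in>space B. \<kappa> y < (m::nat)"
    "\<forall>k. h k \<in> A \<rightarrow>\<^sub>M N" "\<forall>x\<in>space A. \<forall>y\<in>space B. f (x, y) = h (\<kappa> y) x"
    unfolding cell_fun_def by blast
  note [measurable] = *(1)
  have [measurable]: "h k \<in> A \<rightarrow>\<^sub>M N" for k using * by blast
  have "(\<lambda>z. h (\<kappa> (snd z)) (fst z)) \<in> A \<Otimes>\<^sub>M B \<rightarrow>\<^sub>M N"
    by (rule measurable_compose_countable) auto
  then show ?thesis
    by (rule measurable_cong[THEN iffD1, rotated]) (use *(4) in \<open>auto simp: space_pair_measure\<close>)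
qed

lemma cell_fun_rectangle:
  assumes [measurable]: "a \<in> sets A" "b \<in> sets B"
  shows "cell_fun A B (\<lambda>z. z \<in> a \<times> b) (count_space UNIV)"
  unfolding cell_fun_def
proof (intro exI[of _ 2] exI[of _ "\<lambda>y. if y \<in> b then 1 else 0"]
    exI[of _ "\<lambda>k x. k = (1::nat) \<and> x \<in> a"] conjI)
qed (auto simp: measurable_If)

text \<open>Rectangles are cell sets and form an intersection-stable generator, so it suffices that
  the approximable sets are closed under complements and disjoint countable unions. A countable
  union is within half of the error of a finite partial union, and finitely many partitions still
  have a finite common refinement.\<close>

lemma cell_set_dense:
  assumes "finite_measure N" and N[measurable_cong]: "sets N = sets (A \<Otimes>\<^sub>M B)" and "E \<in> sets N" "0 < \<epsilon>"
  shows "\<exists>F. cell_fun A B (\<lambda>z. z \<in> F) (count_space UNIV) \<and> F \<in> sets N \<and>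
     measure N (sym_diff E F) < \<epsilon>"
proof -
  interpret finite_measure N by fact
  define P where "P E \<longleftrightarrow> (\<forall>\<epsilon>>0. \<exists>F. cell_fun A B (\<lambda>z. z \<in> F) (count_space UNIV) \<and> F \<in> sets N \<and>
     measure N (sym_diff E F) < \<epsilon>)" for E
  have setsN: "sets N = sigma_sets (space A \<times> space B) {a \<times> b | a b. a \<in> sets A \<and> b \<in> sets B}"
    by (simp add: N sets_pair_measure)
  have spN: "space N = space A \<times> space B" using sets_eq_imp_space_eq[OF N] by (simp add: space_pair_measure)
  \<comment> \<open>\<open>cell_fun\<close> constrains a function on the product space only, so a
    complement may be taken relative to \<open>space N\<close> instead of as a negation.\<close>
  have cong: "cell_fun A B f L" if fg: "cell_fun A B g L" "\<And>z. z \<in> space N \<Longrightarrow> f z = g z" for f g :: "'a \<times> 'b \<Rightarrow> 'd" and L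
  proof -
    obtain m \<kappa> h where *: "\<kappa> \<in> B \<rightarrow>\<^sub>M count_space UNIV" "\<forall>y\<in>space B. \<kappa> y < (m::nat)"
      "\<forall>k. h k \<in> A \<rightarrow>\<^sub>M L" "\<forall>x\<in>space A. \<forall>y\<in>space B. g (x, y) = h (\<kappa> y) x"
      using fg(1) unfolding cell_fun_def by blast
    have "\<forall>x\<in>space A. \<forall>y\<in>space B. f (x, y) = h (\<kappa> y) x" using *(4) fg(2) spN by simp
    with *(1-3) show ?thesis unfolding cell_fun_def by blast
  qed
  have Un: "P (E1 \<union> E2)" if P: "P E1" "P E2" and [measurable]: "E1 \<in> sets N" "E2 \<in> sets N" for E1 E2
    unfolding P_def
  proof (intro allI impI)
    fix \<epsilon> :: real assume "\<epsilon> > 0"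
    then have "\<epsilon> / 2 > 0" by simp
    obtain F1 where F1: "cell_fun A B (\<lambda>z. z \<in> F1) (count_space UNIV)" and [measurable]: "F1 \<in> sets N" and 1: "measure N (sym_diff E1 F1) < \<epsilon>/2"
      using P(1) \<open>\<epsilon>/2 > 0\<close> unfolding P_def by blast
    obtain F2 where F2: "cell_fun A B (\<lambda>z. z \<in> F2) (count_space UNIV)" and [measurable]: "F2 \<in> sets N" and 2: "measure N (sym_diff E2 F2) < \<epsilon>/2"
      using P(2) \<open>\<epsilon>/2 > 0\<close> unfolding P_def by blast
    have "cell_fun A B (\<lambda>z. (\<lambda>(p, q). p \<or> q) (z \<in> F1, z \<in> F2)) (count_space UNIV)"
      by (rule cell_fun_comp[OF cell_fun_Pair[OF F1 F2]]) simp
    then have "cell_fun A B (\<lambda>z. z \<in> F1 \<union> F2) (count_space UNIV)" by simp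
    moreover have "measure N (sym_diff (E1 \<union> E2) (F1 \<union> F2)) \<le> measure N (sym_diff E1 F1 \<union> sym_diff E2 F2)"
      by (intro finite_measure_mono) auto
    moreover have "\<dots> \<le> measure N (sym_diff E1 F1) + measure N (sym_diff E2 F2)"
      by (intro measure_Un_le) auto
    ultimately show "\<exists>F. cell_fun A B (\<lambda>z. z \<in> F) (count_space UNIV) \<and> F \<in> sets N \<and> measure N (sym_diff (E1 \<union> E2) F) < \<epsilon>"
      using 1 2 by (intro exI[of _ "F1 \<union> F2"]) auto
  qed
  have exact: "P E" if "cell_fun A B (\<lambda>z. z \<in> E) (count_space UNIV)" "E \<in> sets N" for E
    unfolding P_def using that by (auto intro!: exI[of _ E])
  have empty: "P {}" by (rule exact) (auto intro: cell_fun_const)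
  have "P E"
    using Int_stable_pair_measure_generator[of A B] pair_measure_closed[of A B]
      \<open>E \<in> sets N\<close>[unfolded setsN]
  proof (induction rule: sigma_sets_induct_disjoint)
    case (basic E) then show ?case using cell_fun_rectangle[of _ A _ B]
      by (intro exact) (auto simp: N)
  next
    case empty show ?case by fact
  next
    case (compl E)
    show ?case unfolding P_def
    proof (intro allI impI)
      fix \<epsilon> :: real assume "\<epsilon> > 0"
      then obtain F where F: "cell_fun A B (\<lambda>z. z \<in> F) (count_space UNIV)" "F \<in> sets N" "measure N (sym_diff E F) < \<epsilon>"
        using compl unfolding P_def by blast
      have "cell_fun A B (\<lambda>z. \<not> z \<in> F) (count_space UNIV)" by (rule cell_fun_comp[OF F(1)]) simp
      then have "cell_fun A B (\<lambda>z. z \<in> space N - F) (count_space UNIV)" by (rule cong) auto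
      moreover have "sym_diff (space A \<times> space B - E) (space N - F) = sym_diff E F"
        using sets.sets_into_space[OF F(2)] sets.sets_into_space[of E N] compl(1) setsN unfolding spN by auto
      ultimately show "\<exists>F. cell_fun A B (\<lambda>z. z \<in> F) (count_space UNIV) \<and> F \<in> sets N \<and> measure N (sym_diff (space A \<times> space B - E) F) < \<epsilon>"
        using F by (intro exI[of _ "space N - F"]) auto
    qed
  next
    case (union E)
    then have E[measurable]: "E i \<in> sets N" for i using setsN by auto
    have fin: "P (\<Union>i<n. E i)" for n :: nat
      by (induction n) (auto simp: lessThan_Suc intro!: empty Un union)
    show ?case unfolding P_def
    proof (intro allI impI)
      fix \<epsilon> :: real assume "\<epsilon> > 0"
      have "(\<lambda>n. measure N (\<Union>i<n. E i)) \<longlonglongrightarrow> measure N (\<Union>n. (\<Union>i<n. E i))"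
        by (intro finite_Lim_measure_incseq) (auto simp: incseq_def intro: less_le_trans)
      also have "(\<Union>n. (\<Union>i<n. E i)) = \<Union>(range E)" by auto
      finally obtain n where n: "\<bar>measure N (\<Union>i<n. E i) - measure N (\<Union>(range E))\<bar> < \<epsilon>/2"
        using \<open>\<epsilon> > 0\<close> by (auto dest!: LIMSEQ_D[of _ _ "\<epsilon>/2"])
      obtain F where F: "cell_fun A B (\<lambda>z. z \<in> F) (count_space UNIV)" "measure N (sym_diff (\<Union>i<n. E i) F) < \<epsilon>/2"
        and [measurable]: "F \<in> sets N"
        using fin[of n] \<open>\<epsilon> > 0\<close> unfolding P_def by (meson half_gt_zero)
      have "measure N (sym_diff (\<Union>(range E)) F) \<le> measure N ((\<Union>(range E) - (\<Union>i<n. E i)) \<union> sym_diff (\<Union>i<n. E i) F)"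
        by (intro finite_measure_mono) auto
      also have "\<dots> \<le> measure N (\<Union>(range E) - (\<Union>i<n. E i)) + measure N (sym_diff (\<Union>i<n. E i) F)"
        by (intro measure_Un_le) auto
      also have "measure N (\<Union>(range E) - (\<Union>i<n. E i)) = measure N (\<Union>(range E)) - measure N (\<Union>i<n. E i)"
        by (intro finite_measure_Diff) auto
      finally have "measure N (sym_diff (\<Union>(range E)) F) < \<epsilon>"
        using n F(2) by linarith
      then show "\<exists>F. cell_fun A B (\<lambda>z. z \<in> F) (count_space UNIV) \<and> F \<in> sets N \<and> measure N (sym_diff (\<Union>(range E)) F) < \<epsilon>"
        using F(1) by (intro exI[of _ F]) auto
    qed
  qed
  then show ?thesis using \<open>0 < \<epsilon>\<close> unfolding P_def by blast
qed

text \<open>Induction along simple functions and dominated limits; for a sum the tolerance is halved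
  and the two partitions are refined to a common one.\<close>

lemma cell_fun_dense:
  fixes f :: "'a \<times> 'b \<Rightarrow> real"
  assumes "finite_measure N" and N[measurable_cong]: "sets N = sets (A \<Otimes>\<^sub>M B)" and "integrable N f" "0 < \<epsilon>"
  shows "\<exists>g. cell_fun A B g borel \<and> (\<integral>\<^sup>+z. ennreal \<bar>f z - g z\<bar> \<partial>N) < ennreal \<epsilon>"
  using assms(3,4)
proof (induction arbitrary: \<epsilon> rule: integrable_induct)
  case (base E c)
  interpret finite_measure N by fact
  \<comment> \<open>The shift by one avoids a division by zero when \<open>c = 0\<close>.\<close>
  have "0 < \<epsilon> / (\<bar>c\<bar> + 1)" using base by simp
  then obtain F where F: "cell_fun A B (\<lambda>z. z \<in> F) (count_space UNIV)" "measure N (sym_diff E F) < \<epsilon> / (\<bar>c\<bar> + 1)"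
    and [measurable]: "F \<in> sets N"
    using cell_set_dense[OF assms(1) N base(1)] by blast
  note [measurable] = base(1)
  have "cell_fun A B (\<lambda>z. (\<lambda>p. if p then c else 0) (z \<in> F)) borel"
    by (rule cell_fun_comp[OF F(1)]) simp
  moreover have "(\<integral>\<^sup>+z. ennreal \<bar>indicator E z *\<^sub>R c - (if z \<in> F then c else 0)\<bar> \<partial>N)
     = (\<integral>\<^sup>+z. ennreal \<bar>c\<bar> * indicator (sym_diff E F) z \<partial>N)"
    by (intro nn_integral_cong) (auto simp: indicator_def)
  moreover have "\<dots> = ennreal (\<bar>c\<bar> * measure N (sym_diff E F))"
    by (subst nn_integral_cmult_indicator) (auto simp: emeasure_eq_measure ennreal_mult)
  moreover have "\<bar>c\<bar> * measure N (sym_diff E F) < \<epsilon>"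
  proof -
    have "\<bar>c\<bar> * measure N (sym_diff E F) \<le> \<bar>c\<bar> * (\<epsilon> / (\<bar>c\<bar> + 1))" using F(2) by (intro mult_left_mono) auto
    also have "\<dots> < \<epsilon>" using base by (auto simp: field_simps)
    finally show ?thesis .
  qed
  ultimately show ?case using base by (intro exI conjI) (auto simp: ennreal_less_iff)
next
  case (add f g)
  have "0 < \<epsilon>/2" using add by simp
  then obtain f' g' where f': "cell_fun A B f' borel" "(\<integral>\<^sup>+z. ennreal \<bar>f z - f' z\<bar> \<partial>N) < ennreal (\<epsilon>/2)"
    and g': "cell_fun A B g' borel" "(\<integral>\<^sup>+z. ennreal \<bar>g z - g' z\<bar> \<partial>N) < ennreal (\<epsilon>/2)"
    using add.IH by blast
  have [measurable]: "f' \<in> borel_measurable N" "g' \<in> borel_measurable N" "f \<in> borel_measurable N" "g \<in> borel_measurable N"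
    using cell_fun_measurable[OF f'(1)] cell_fun_measurable[OF g'(1)] add.hyps by (auto simp: measurable_cong_sets[OF N refl])
  have "cell_fun A B (\<lambda>z. (\<lambda>(a, b). a + b) (f' z, g' z)) borel"
    by (rule cell_fun_comp[OF cell_fun_Pair[OF f'(1) g'(1)]]) measurable
  moreover have "(\<integral>\<^sup>+z. ennreal \<bar>(f z + g z) - (f' z + g' z)\<bar> \<partial>N) \<le> (\<integral>\<^sup>+z. ennreal \<bar>f z - f' z\<bar> + ennreal \<bar>g z - g' z\<bar> \<partial>N)"
    by (intro nn_integral_mono) (auto simp flip: ennreal_plus)
  moreover have "\<dots> = (\<integral>\<^sup>+z. ennreal \<bar>f z - f' z\<bar> \<partial>N) + (\<integral>\<^sup>+z. ennreal \<bar>g z - g' z\<bar> \<partial>N)"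
    by (intro nn_integral_add) auto
  moreover have "\<dots> < ennreal (\<epsilon>/2) + ennreal (\<epsilon>/2)" using f' g' by (intro add_strict_mono) auto
  moreover have "\<dots> = ennreal \<epsilon>" using add.prems by (simp flip: ennreal_plus)
  ultimately show ?case by (intro exI[of _ "\<lambda>z. (\<lambda>(a, b). a + b) (f' z, g' z)"]) auto
next
  case (lim f s)
  note [measurable] = borel_measurable_integrable[OF lim.hyps(1)] borel_measurable_integrable[OF lim.hyps(4)]
  have "(\<lambda>i. \<integral>\<^sup>+z. ennreal (norm (f z - s i z)) \<partial>N) \<longlonglongrightarrow> 0"
  proof (rule nn_integral_dominated_convergence_norm)
    show "AE z in N. norm (s i z) \<le> 2 * norm (f z)" for i using lim by auto
    show "AE z in N. (\<lambda>i. s i z) \<longlonglongrightarrow> f z" using lim by auto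
    show "(\<integral>\<^sup>+ x. ennreal (2 * norm (f x)) \<partial>N) < \<infinity>"
      using lim(4) by (simp add: integrable_iff_bounded ennreal_mult nn_integral_cmult ennreal_mult_less_top)
  qed auto
  then have "\<forall>\<^sub>F i in sequentially. (\<integral>\<^sup>+z. ennreal (norm (f z - s i z)) \<partial>N) < ennreal (\<epsilon>/2)"
    using lim.prems by (intro order_tendstoD) auto
  then obtain i where i: "(\<integral>\<^sup>+z. ennreal (norm (f z - s i z)) \<partial>N) < ennreal (\<epsilon>/2)"
    by (auto simp: eventually_sequentially)
  obtain g where g: "cell_fun A B g borel" "(\<integral>\<^sup>+z. ennreal \<bar>s i z - g z\<bar> \<partial>N) < ennreal (\<epsilon>/2)"
    using lim.IH[of "\<epsilon>/2" i] lim.prems by auto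
  have [measurable]: "g \<in> borel_measurable N" using cell_fun_measurable[OF g(1)] by (simp add: measurable_cong_sets[OF N refl])
  have "(\<integral>\<^sup>+z. ennreal \<bar>f z - g z\<bar> \<partial>N) \<le> (\<integral>\<^sup>+z. ennreal (norm (f z - s i z)) + ennreal \<bar>s i z - g z\<bar> \<partial>N)"
    by (intro nn_integral_mono) (auto simp flip: ennreal_plus)
  also have "\<dots> = (\<integral>\<^sup>+z. ennreal (norm (f z - s i z)) \<partial>N) + (\<integral>\<^sup>+z. ennreal \<bar>s i z - g z\<bar> \<partial>N)"
    by (intro nn_integral_add) auto
  also have "\<dots> < ennreal (\<epsilon>/2) + ennreal (\<epsilon>/2)" using i g by (intro add_strict_mono) auto
  also have "\<dots> = ennreal \<epsilon>" using lim.prems by (simp flip: ennreal_plus)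
  finally show ?case using g by blast
qed

section \<open>Rejection sampling with common randomness\<close>

text \<open>Summand \<open>s\<close> is the probability that the first acceptance occurs at position
  \<open>s\<close>, and the last product is the probability of none, so the cases are
  exhaustive.\<close>

lemma sum_first_success:
  fixes \<alpha> :: "nat \<Rightarrow> real"
  shows "(\<Sum>s=1..M. (\<Prod>t=1..<s. 1 - \<alpha> t) * \<alpha> s) + (\<Prod>t=1..M. 1 - \<alpha> t) = 1"
proof (induction M)
  case (Suc M)
  have "(\<Prod>t=1..<Suc M. 1 - \<alpha> t) = (\<Prod>t=1..M. 1 - \<alpha> t)" by (simp add: atLeastLessThanSuc_atLeastAtMost)
  then show ?case using Suc by (simp add: algebra_simps)
qed simp

text \<open>The letters of a uniformly random codebook are independent and uniform, so the average
  factors over positions: each of the first \<open>s - 1\<close> gives a mean rejection probability,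
  position \<open>s\<close> gives the accepted payoff \<open>r\<close>, and the later ones sum
  out.\<close>

lemma average_first_success:
  fixes \<alpha> r :: "nat \<Rightarrow> real"
  assumes s: "s \<in> {1..M}" and N0: "N0 \<ge> 1"
  shows "(\<Sum>b\<in>{1..M} \<rightarrow>\<^sub>E {..<N0}. (\<Prod>t=1..<s. 1 - \<alpha> (b t)) * (\<alpha> (b s) * r (b s))) / real (N0 ^ M)
    = (1 - (\<Sum>j<N0. \<alpha> j) / N0) ^ (s - 1) * ((\<Sum>j<N0. \<alpha> j * r j) / N0)"
proof -
  \<comment> \<open>\<open>F t\<close> is the factor contributed by the letter at position
    \<open>t\<close>; with it the sum over codebooks becomes a product of sums.\<close>
  define F where "F t j = (if t < s then 1 - \<alpha> j else if t = s then \<alpha> j * r j else 1)" for t j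
  have split: "{1..M} = {1..<s} \<union> {s} \<union> {s<..M}" using s by auto
  have prod_split: "(\<Prod>t=1..M. f t) = (\<Prod>t=1..<s. f t) * f s * (\<Prod>t\<in>{s<..M}. f t)" for f :: "nat \<Rightarrow> real"
    unfolding split by (subst prod.union_disjoint, simp, simp, force, subst prod.union_disjoint) auto
  have "(\<Sum>b\<in>{1..M} \<rightarrow>\<^sub>E {..<N0}. (\<Prod>t=1..<s. 1 - \<alpha> (b t)) * (\<alpha> (b s) * r (b s)))
     = (\<Sum>b\<in>{1..M} \<rightarrow>\<^sub>E {..<N0}. \<Prod>t=1..M. F t (b t))"
    unfolding prod_split by (simp add: F_def)
  also have "\<dots> = (\<Prod>t=1..M. \<Sum>j<N0. F t j)" by (subst prod_sum_PiE) auto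
  also have "\<dots> = (N0 - (\<Sum>j<N0. \<alpha> j)) ^ (s - 1) * (\<Sum>j<N0. \<alpha> j * r j) * real N0 ^ (M - s)"
    unfolding prod_split by (simp add: F_def sum_subtractf)
  finally have eq: "(\<Sum>b\<in>{1..M} \<rightarrow>\<^sub>E {..<N0}. (\<Prod>t=1..<s. 1 - \<alpha> (b t)) * (\<alpha> (b s) * r (b s)))
     = (N0 - (\<Sum>j<N0. \<alpha> j)) ^ (s - 1) * (\<Sum>j<N0. \<alpha> j * r j) * real N0 ^ (M - s)" .
  have "M = (s - 1) + 1 + (M - s)" using s by auto
  then have "real (N0 ^ M) = real N0 ^ (s - 1) * real N0 * real N0 ^ (M - s)"
    by (metis of_nat_power power_add power_one_right)
  then have "(\<Sum>b\<in>{1..M} \<rightarrow>\<^sub>E {..<N0}. (\<Prod>t=1..<s. 1 - \<alpha> (b t)) * (\<alpha> (b s) * r (b s))) / real (N0 ^ M)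
     = ((N0 - (\<Sum>j<N0. \<alpha> j)) ^ (s - 1) * (\<Sum>j<N0. \<alpha> j * r j) * real N0 ^ (M - s)) /
      (real N0 ^ (s - 1) * real N0 * real N0 ^ (M - s))" unfolding eq by simp
  also have "\<dots> = ((N0 - (\<Sum>j<N0. \<alpha> j)) / N0) ^ (s - 1) * ((\<Sum>j<N0. \<alpha> j * r j) / N0)"
    using N0 by (simp add: power_divide)
  also have "(N0 - (\<Sum>j<N0. \<alpha> j)) / N0 = 1 - (\<Sum>j<N0. \<alpha> j) / N0" using N0 by (simp add: diff_divide_distrib)
  finally show ?thesis .
qed

section \<open>Codes with shared randomness and the kernels they induce\<close>

definition code_kernel ::
  "nat \<Rightarrow> (nat \<Rightarrow> 'x \<Rightarrow> nat measure) \<Rightarrow> (nat \<Rightarrow> nat \<Rightarrow> 'y measure) \<Rightarrow> 'x \<Rightarrow> 'y measure" where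
  "code_kernel N enc dec x = uniform_count_measure {1..N} \<bind> (\<lambda>c. enc c x \<bind> (\<lambda>s. dec s c))"

text \<open>Blocklength and rates are absorbed into the numbers \<open>M\<close> of indices and
  \<open>N\<close> of values of the common randomness, so that the construction can be carried out
  over abstract input and output spaces.\<close>

definition code_pair :: "nat \<Rightarrow> nat \<Rightarrow> 'x measure \<Rightarrow> 'y measure \<Rightarrow>
    (nat \<Rightarrow> 'x \<Rightarrow> nat measure) \<Rightarrow> (nat \<Rightarrow> nat \<Rightarrow> 'y measure) \<Rightarrow> bool" where
  "code_pair M N A B enc dec \<longleftrightarrow> N \<ge> 1 \<and> M \<ge> 1 \<and>
     (\<forall>c\<in>{1..N}. enc c \<in> A \<rightarrow>\<^sub>M prob_algebra (count_space {1..M})) \<and>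
     (\<forall>s\<in>{1..M}. \<forall>c\<in>{1..N}. dec s c \<in> space (prob_algebra B))"

lemma space_prob_algebraI: "prob_space P \<Longrightarrow> sets P = sets B \<Longrightarrow> P \<in> space (prob_algebra B)"
  by (simp add: space_prob_algebra)

lemma code_pair_step:
  assumes "code_pair M N A B enc dec" "x \<in> space A" "c \<in> {1..N}"
  shows "enc c x \<bind> (\<lambda>s. dec s c) \<in> space (prob_algebra B)"
    and "S \<in> sets B \<Longrightarrow> emeasure (enc c x \<bind> (\<lambda>s. dec s c)) S = (\<integral>\<^sup>+s. emeasure (dec s c) S \<partial>enc c x)"
proof -
  have enc: "enc c x \<in> space (prob_algebra (count_space {1..M}))"
    using assms by (auto simp: code_pair_def dest: measurable_space)
  have dec: "(\<lambda>s. dec s c) \<in> count_space {1..M} \<rightarrow>\<^sub>M prob_algebra B"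
    using assms by (auto simp: code_pair_def)
  show "enc c x \<bind> (\<lambda>s. dec s c) \<in> space (prob_algebra B)"
    by (intro space_prob_algebraI prob_space_bind'[OF enc dec] sets_bind'[OF enc dec])
  show "emeasure (enc c x \<bind> (\<lambda>s. dec s c)) S = (\<integral>\<^sup>+s. emeasure (dec s c) S \<partial>enc c x)" if "S \<in> sets B"
    by (rule emeasure_bind_prob_algebra[OF enc dec that])
qed

lemma code_pair_kernel:
  assumes cp: "code_pair M N A B enc dec" and x: "x \<in> space A"
  shows "code_kernel N enc dec x \<in> space (prob_algebra B)"
    and "S \<in> sets B \<Longrightarrow> emeasure (code_kernel N enc dec x) S =
      (\<Sum>c=1..N. (\<integral>\<^sup>+s. emeasure (dec s c) S \<partial>enc c x) / ennreal (real N))"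
proof -
  have N: "N \<ge> 1" using cp by (simp add: code_pair_def)
  have u: "uniform_count_measure {1..N} \<in> space (prob_algebra (count_space {1..N}))"
    by (intro space_prob_algebraI prob_space_uniform_count_measure) (use N in \<open>auto simp: sets_uniform_count_measure\<close>)
  have k: "(\<lambda>c. enc c x \<bind> (\<lambda>s. dec s c)) \<in> count_space {1..N} \<rightarrow>\<^sub>M prob_algebra B"
    using code_pair_step(1)[OF cp x] by auto
  show "code_kernel N enc dec x \<in> space (prob_algebra B)"
    unfolding code_kernel_def by (intro space_prob_algebraI prob_space_bind'[OF u k] sets_bind'[OF u k])
  assume S: "S \<in> sets B"
  have "emeasure (code_kernel N enc dec x) S = (\<integral>\<^sup>+c. emeasure (enc c x \<bind> (\<lambda>s. dec s c)) S \<partial>uniform_count_measure {1..N})"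
    unfolding code_kernel_def by (rule emeasure_bind_prob_algebra[OF u k S])
  also have "\<dots> = (\<Sum>c=1..N. ennreal (1 / real N) * emeasure (enc c x \<bind> (\<lambda>s. dec s c)) S)"
    unfolding uniform_count_measure_def by (subst nn_integral_point_measure_finite) auto
  also have "\<dots> = (\<Sum>c=1..N. (\<integral>\<^sup>+s. emeasure (dec s c) S \<partial>enc c x) / ennreal (real N))"
    using N by (intro sum.cong refl)
      (simp add: code_pair_step(2)[OF cp x _ S] divide_ennreal_def mult.commute inverse_ennreal[symmetric] inverse_eq_divide[symmetric])
  finally show "emeasure (code_kernel N enc dec x) S = (\<Sum>c=1..N. (\<integral>\<^sup>+s. emeasure (dec s c) S \<partial>enc c x) / ennreal (real N))" .
qed

lemma code_kernel_measurable:
  assumes cp: "code_pair M N A B enc dec"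
  shows "code_kernel N enc dec \<in> A \<rightarrow>\<^sub>M prob_algebra B"
proof (intro measurable_prob_algebraI measurable_subprob_algebra)
  fix x assume x: "x \<in> space A"
  show "prob_space (code_kernel N enc dec x)" "subprob_space (code_kernel N enc dec x)" "sets (code_kernel N enc dec x) = sets B"
    using code_pair_kernel(1)[OF cp x] by (auto simp: space_prob_algebra prob_space_imp_subprob_space)
next
  fix S assume S: "S \<in> sets B"
  have "(\<lambda>x. \<integral>\<^sup>+s. emeasure (dec s c) S \<partial>enc c x) \<in> borel_measurable A" if "c \<in> {1..N}" for c
  proof -
    have "enc c \<in> A \<rightarrow>\<^sub>M subprob_algebra (count_space {1..M})"
      using cp that by (auto simp: code_pair_def intro: measurable_prob_algebraD)
    then show ?thesis
      by (rule measurable_compose) (rule nn_integral_measurable_subprob_algebra, simp)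
  qed
  then have "(\<lambda>x. \<Sum>c=1..N. (\<integral>\<^sup>+s. emeasure (dec s c) S \<partial>enc c x) / ennreal (real N)) \<in> borel_measurable A"
    by (intro borel_measurable_sum borel_measurable_divide_ennreal) auto
  then show "(\<lambda>x. emeasure (code_kernel N enc dec x) S) \<in> borel_measurable A"
    by (rule measurable_cong[THEN iffD2, rotated]) (rule code_pair_kernel(2)[OF cp _ S])
qed

text \<open>The common randomness picks a codebook of \<^term>\<open>M\<close> letters of \<^term>\<open>{..<N0}\<close>; the encoder
  sends the first position whose letter \<^term>\<open>j\<close> is accepted, which happens with
  probability \<^term>\<open>\<alpha> x j\<close>.\<close>
lemma rejection_sampling:
  fixes \<alpha> :: "'x \<Rightarrow> nat \<Rightarrow> real" and \<nu> :: "nat \<Rightarrow> 'y measure"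
  assumes [measurable]: "\<And>j. (\<lambda>x. \<alpha> x j) \<in> borel_measurable A"
    and \<alpha>: "\<And>x j. x \<in> space A \<Longrightarrow> 0 \<le> \<alpha> x j" "\<And>x j. x \<in> space A \<Longrightarrow> \<alpha> x j \<le> 1"
    and \<nu>: "\<And>j. \<nu> j \<in> space (prob_algebra B)" and N0: "N0 \<ge> 1" and M: "M \<ge> 1"
  shows "\<exists>enc dec. code_pair M (N0 ^ M) A B enc dec \<and>
    (\<forall>x\<in>space A. \<forall>S\<in>sets B. (\<Sum>s<M. (1 - (\<Sum>j<N0. \<alpha> x j) / N0) ^ s) * ((\<Sum>j<N0. \<alpha> x j * measure (\<nu> j) S) / N0)
        \<le> measure (code_kernel (N0 ^ M) enc dec x) S)"
proof -
  define N where "N = N0 ^ M"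
  have N: "N \<ge> 1" using N0 by (simp add: N_def)
  have "card ({1..M} \<rightarrow>\<^sub>E {..<N0}) = N" by (simp add: card_PiE N_def)
  \<comment> \<open>A value of the common randomness is the number of a codebook,
    \<open>bb c\<close>, so a uniform \<open>c\<close> means a uniform codebook.\<close>
  then obtain bb where bb: "bij_betw bb {1..N} ({1..M} \<rightarrow>\<^sub>E {..<N0})"
    using finite_same_card_bij[of "{1..N}" "{1..M} \<rightarrow>\<^sub>E {..<N0}"] by (auto simp: finite_PiE)
  define w where "w b x s = (\<Prod>t=1..<s. 1 - \<alpha> x (b t)) * \<alpha> x (b s)" for b :: "nat \<Rightarrow> nat" and x s
  \<comment> \<open>If every position is rejected the encoder sends \<open>M\<close>; this fallback
    turns the subprobability \<open>w\<close> into a law on \<open>{1..M}\<close>.\<close>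
  define e where "e b x s = w b x s + (if s = M then \<Prod>t=1..M. 1 - \<alpha> x (b t) else 0)" for b x s
  define enc where "enc c x = point_measure {1..M} (\<lambda>s. ennreal (e (bb c) x s))" for c x
  define dec where "dec s c = \<nu> (bb c s)" for s c
  have w0: "w b x s \<ge> 0" if "x \<in> space A" for b x s unfolding w_def using \<alpha> that by (intro mult_nonneg_nonneg prod_nonneg) auto
  have ew: "w b x s \<le> e b x s" if "x \<in> space A" for b x s unfolding e_def using \<alpha> that by (auto intro!: prod_nonneg)
  have e0: "e b x s \<ge> 0" if "x \<in> space A" for b x s using w0[OF that, of b s] ew[OF that, of b s] by linarith
  have [measurable]: "(\<lambda>x. e b x s) \<in> borel_measurable A" for b s unfolding e_def w_def by measurable
  have sum_e: "(\<Sum>s=1..M. e b x s) = 1" for b x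
    using sum_first_success[of "\<lambda>t. \<alpha> x (b t)" M] M by (simp add: e_def w_def sum.distrib)
  have enc: "enc c \<in> A \<rightarrow>\<^sub>M prob_algebra (count_space {1..M})" for c
  proof (intro measurable_prob_algebraI measurable_subprob_algebra)
    fix x assume x: "x \<in> space A"
    show *: "prob_space (enc c x)"
      by (intro prob_spaceI) (simp add: enc_def emeasure_point_measure_finite space_point_measure sum_e[simplified] e0[OF x])
    show "subprob_space (enc c x)" by (rule prob_space_imp_subprob_space[OF *])
    show "sets (enc c x) = sets (count_space {1..M})" by (simp add: enc_def sets_point_measure)
  next
    fix S assume "S \<in> sets (count_space {1..M})"
    then have "(\<lambda>x. emeasure (enc c x) S) = (\<lambda>x. \<Sum>s\<in>S. ennreal (e (bb c) x s))"
      by (auto simp: enc_def emeasure_point_measure_finite)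
    then show "(\<lambda>x. emeasure (enc c x) S) \<in> borel_measurable A" by simp
  qed
  have cp: "code_pair M N A B enc dec"
    using N M enc \<nu> by (simp add: code_pair_def dec_def)
  have "(\<Sum>s<M. (1 - (\<Sum>j<N0. \<alpha> x j) / N0) ^ s) * ((\<Sum>j<N0. \<alpha> x j * measure (\<nu> j) S) / N0)
        \<le> measure (code_kernel N enc dec x) S" if x: "x \<in> space A" and S: "S \<in> sets B" for x S
  proof -
    have \<nu>m: "emeasure (\<nu> j) S = ennreal (measure (\<nu> j) S)" for j
      using \<nu>[of j] by (simp add: space_prob_algebra prob_space_def finite_measure.emeasure_eq_measure)
    have pk: "prob_space (code_kernel N enc dec x)" using code_pair_kernel(1)[OF cp x] by (simp add: space_prob_algebra)
    have "emeasure (code_kernel N enc dec x) S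
       = (\<Sum>c=1..N. (\<Sum>s=1..M. ennreal (e (bb c) x s) * emeasure (\<nu> (bb c s)) S) / ennreal (real N))"
      unfolding code_pair_kernel(2)[OF cp x S] by (simp add: enc_def dec_def nn_integral_point_measure_finite)
    also have "\<dots> = ennreal (\<Sum>c=1..N. (\<Sum>s=1..M. e (bb c) x s * measure (\<nu> (bb c s)) S) / N)"
    proof -
      have "(\<Sum>s=1..M. ennreal (e (bb c) x s) * emeasure (\<nu> (bb c s)) S) / ennreal (real N)
         = ennreal ((\<Sum>s=1..M. e (bb c) x s * measure (\<nu> (bb c s)) S) / N)" for c
        using N e0[OF x] by (simp add: \<nu>m ennreal_mult[symmetric] sum_nonneg divide_ennreal)
      then show ?thesis using e0[OF x] by (simp add: sum_nonneg)
    qed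
    finally have m: "measure (code_kernel N enc dec x) S = (\<Sum>c=1..N. (\<Sum>s=1..M. e (bb c) x s * measure (\<nu> (bb c s)) S) / N)"
      using e0[OF x] by (simp add: measure_def sum_nonneg)
    have "(\<Sum>s<M. (1 - (\<Sum>j<N0. \<alpha> x j) / N0) ^ s) * ((\<Sum>j<N0. \<alpha> x j * measure (\<nu> j) S) / N0)
      = (\<Sum>s=1..M. (1 - (\<Sum>j<N0. \<alpha> x j) / N0) ^ (s - 1) * ((\<Sum>j<N0. \<alpha> x j * measure (\<nu> j) S) / N0))"
      unfolding sum_distrib_right by (rule sum.reindex_bij_witness[of _ "\<lambda>s. s - 1" Suc]) auto
    also have "\<dots> = (\<Sum>s=1..M. (\<Sum>b\<in>{1..M} \<rightarrow>\<^sub>E {..<N0}. w b x s * measure (\<nu> (b s)) S) / real N)"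
      by (intro sum.cong refl, subst average_first_success[symmetric, OF _ N0, where M=M])
         (auto simp: w_def N_def mult.assoc)
    also have "\<dots> = (\<Sum>s=1..M. (\<Sum>c=1..N. w (bb c) x s * measure (\<nu> (bb c s)) S) / real N)"
      by (subst sum.reindex_bij_betw[OF bb]) simp
    also have "\<dots> = (\<Sum>c=1..N. (\<Sum>s=1..M. w (bb c) x s * measure (\<nu> (bb c s)) S) / real N)"
      unfolding sum_divide_distrib by (rule sum.swap)
    \<comment> \<open>The fallback only adds mass, so dropping it leaves a lower bound; the matching
      upper bound is obtained in \<open>channel_simulation\<close> by passing to
      complements.\<close>
    also have "\<dots> \<le> (\<Sum>c=1..N. (\<Sum>s=1..M. e (bb c) x s * measure (\<nu> (bb c s)) S) / real N)"
      by (intro sum_mono divide_right_mono mult_right_mono ew[OF x]) auto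
    finally show ?thesis using m by simp
  qed
  then show ?thesis using cp unfolding N_def by blast
qed

text \<open>Disjoint groups of letters are allotted to the cells one after another. In the
  simulation, letter counts proportional to the cell probabilities make a uniform letter carry an
  almost correctly distributed cell; \<open>None\<close> marks the letters left over by
  rounding.\<close>

lemma colouring_with_counts:
  fixes n :: "nat \<Rightarrow> nat"
  assumes "finite J" "(\<Sum>k<m. n k) \<le> card J"
  shows "\<exists>\<phi> :: 'j \<Rightarrow> nat option. (\<forall>k<m. card {j\<in>J. \<phi> j = Some k} = n k) \<and> (\<forall>j k. \<phi> j = Some k \<longrightarrow> k < m)"
  using assms
proof (induction m arbitrary: J)
  case 0 show ?case by (intro exI[of _ "\<lambda>_. None"]) auto
next
  case (Suc m)
  then have "n m \<le> card J" by simp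
  then obtain J' where J': "J' \<subseteq> J" "card J' = n m" by (meson obtain_subset_with_card_n)
  have "finite (J - J')" "(\<Sum>k<m. n k) \<le> card (J - J')"
    using Suc.prems J' by (auto simp: card_Diff_subset finite_subset)
  from Suc.IH[OF this] obtain \<phi> :: "'j \<Rightarrow> nat option"
    where \<phi>: "\<forall>k<m. card {j\<in>J - J'. \<phi> j = Some k} = n k" "\<forall>j k. \<phi> j = Some k \<longrightarrow> k < m" by blast
  define \<psi> where "\<psi> j = (if j \<in> J' then Some m else \<phi> j)" for j
  have 1: "{j\<in>J. \<psi> j = Some k} = {j\<in>J - J'. \<phi> j = Some k}" if "k < m" for k using that by (auto simp: \<psi>_def)
  have 2: "{j\<in>J. \<psi> j = Some m} = J'" using J'(1) \<phi>(2) by (auto simp: \<psi>_def)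
  show ?case
    by (rule exI[of _ \<psi>]) (use 1 2 \<phi> J' in \<open>auto simp: less_Suc_eq \<psi>_def split: if_splits\<close>)
qed

section \<open>Elementary estimates for the simulation\<close>

lemma abs_diff_le:
  fixes a b c d D :: real
  assumes "\<bar>b - c\<bar> \<le> d" "\<bar>a - b\<bar> \<le> D" "d \<le> D"
  shows "\<bar>a - c\<bar> \<le> 2 * D"
  using assms by linarith

lemma abs_diff_le_add:
  fixes k w d v :: real
  assumes "\<bar>k - w\<bar> \<le> d"
  shows "\<bar>v - k\<bar> \<le> \<bar>v - w\<bar> + d"
  using assms by linarith

text \<open>With acceptance probability \<open>p\<close>, the sum is the expected number of
  proposals examined among the first \<open>M\<close>. It decreases in \<open>p\<close>, and at
  \<open>p = 1 / \<theta>\<close> it has a closed form.\<close>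

lemma geometric_sum_ge:
  fixes p \<theta> :: real
  assumes "\<theta> \<ge> 1" "p \<le> 1 / \<theta>"
  shows "\<theta> * (1 - exp (- real M / \<theta>)) \<le> (\<Sum>s<M. (1 - p) ^ s)"
proof -
  have "(1 - 1 / \<theta>) ^ M \<le> exp (- 1 / \<theta>) ^ M"
    using assms exp_ge_add_one_self[of "- 1 / \<theta>"] by (intro power_mono) auto
  also have "\<dots> = exp (- real M / \<theta>)" by (simp flip: exp_of_nat_mult)
  finally have "\<theta> * (1 - exp (- real M / \<theta>)) \<le> \<theta> * (1 - (1 - 1 / \<theta>) ^ M)"
    using assms by (intro mult_left_mono) auto
  also have "\<dots> = (\<Sum>s<M. (1 - 1 / \<theta>) ^ s)"
    using assms by (subst sum_gp_strict) (auto simp: field_simps)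
  also have "\<dots> \<le> (\<Sum>s<M. (1 - p) ^ s)"
    using assms by (intro sum_mono power_mono) auto
  finally show ?thesis .
qed

lemma prob_algebra_density:
  assumes "prob_space q" and [measurable]: "(\<lambda>(x, y). v x y) \<in> borel_measurable (A \<Otimes>\<^sub>M q)"
    and v: "\<And>x. x \<in> space A \<Longrightarrow> (\<integral>\<^sup>+y. v x y \<partial>q) = 1"
  shows "(\<lambda>x. density q (v x)) \<in> A \<rightarrow>\<^sub>M prob_algebra q"
proof -
  interpret q: prob_space q by fact
  show ?thesis
  proof (intro measurable_prob_algebraI measurable_subprob_algebra)
    fix x assume x: "x \<in> space A"
    then have [measurable]: "v x \<in> borel_measurable q" by measurable
    show *: "prob_space (density q (v x))" by (intro prob_spaceI) (simp add: emeasure_density v[OF x] cong: nn_integral_cong)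
    show "subprob_space (density q (v x))" by (rule prob_space_imp_subprob_space[OF *])
    show "sets (density q (v x)) = sets q" by simp
  next
    fix S assume [measurable]: "S \<in> sets q"
    have "(\<lambda>x. \<integral>\<^sup>+y. v x y * indicator S y \<partial>q) \<in> borel_measurable A" by measurable
    then show "(\<lambda>x. emeasure (density q (v x)) S) \<in> borel_measurable A"
      by (rule measurable_cong[THEN iffD2, rotated]) (simp add: emeasure_density)
  qed
qed

text \<open>Rejection sampling of a density bounded by \<open>\<theta>\<close> ideally accepts each
  proposal with probability \<open>1 / \<theta>\<close>, so \<open>M\<close> proposals fail with
  probability at most \<open>exp (- M / \<theta>)\<close>. The remaining errors are the rounding of
  cell probabilities, at most \<open>\<eta>\<close> for each input, and the cell approximation, at
  most \<open>2 * \<eta>\<close> and only on average over inputs. The privacy conclusion therefore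
  carries a single \<open>\<eta>\<close>, the joint-law conclusion
  \<open>3 * \<eta>\<close>.\<close>

lemma channel_simulation:
  fixes v :: "'x \<Rightarrow> 'y \<Rightarrow> real" and \<mu> :: "'x measure" and q :: "'y measure"
  defines "V \<equiv> \<lambda>x. density q (\<lambda>y. ennreal (v x y))"
  assumes "prob_space \<mu>" "prob_space q"
    and vm[measurable]: "(\<lambda>(x, y). v x y) \<in> borel_measurable (\<mu> \<Otimes>\<^sub>M q)"
    and v: "\<And>x y. x \<in> space \<mu> \<Longrightarrow> y \<in> space q \<Longrightarrow> 0 \<le> v x y" "\<And>x y. x \<in> space \<mu> \<Longrightarrow> y \<in> space q \<Longrightarrow> v x y \<le> \<theta>"
    and v1: "\<And>x. x \<in> space \<mu> \<Longrightarrow> (\<integral>\<^sup>+y. ennreal (v x y) \<partial>q) = 1"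
    and \<theta>: "\<theta> \<ge> 1" and M: "M \<ge> 1" and \<eta>: "\<eta> > 0"
  shows "\<exists>N enc dec. code_pair M N \<mu> q enc dec \<and>
    (\<forall>x\<in>space \<mu>. \<forall>x'\<in>space \<mu>. \<forall>c\<ge>0. \<forall>d. (\<forall>S\<in>sets q. measure (V x) S - c * measure (V x') S \<le> d) \<longrightarrow>
       (\<forall>S\<in>sets q. measure (code_kernel N enc dec x) S - c * measure (code_kernel N enc dec x') S
          \<le> d + (1 + c) * (exp (- real M / \<theta>) + \<eta>))) \<and>
    (\<forall>E\<in>sets (\<mu> \<Otimes>\<^sub>M q). \<bar>(\<integral>x. measure (V x) (Pair x -` E) \<partial>\<mu>) - (\<integral>x. measure (code_kernel N enc dec x) (Pair x -` E) \<partial>\<mu>)\<bar>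
       \<le> exp (- real M / \<theta>) + 3 * \<eta>)"
proof -
  interpret \<mu>: prob_space \<mu> by fact
  interpret q: prob_space q by fact
  interpret pq: pair_prob_space \<mu> q ..
  have Vp[measurable]: "V \<in> \<mu> \<rightarrow>\<^sub>M prob_algebra q"
    unfolding V_def by (rule prob_algebra_density[OF \<open>prob_space q\<close> _ v1]) measurable
  have VP: "prob_space (V x)" and Vsets: "sets (V x) = sets q" if "x \<in> space \<mu>" for x
    using measurable_space[OF Vp that] by (auto simp: space_prob_algebra)
  have vx[measurable]: "v x \<in> borel_measurable q" if "x \<in> space \<mu>" for x using that by measurable
  have vint: "integrable q (v x)" if "x \<in> space \<mu>" for x
    using v that by (intro q.integrable_const_bound[of _ \<theta>]) (auto intro!: AE_I2)
  have Vmeas: "measure (V x) S = (\<integral>y\<in>S. v x y \<partial>q)" if "x \<in> space \<mu>" "S \<in> sets q" for x S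
  proof -
    have "emeasure (V x) S = (\<integral>\<^sup>+y. ennreal (indicator S y *\<^sub>R v x y) \<partial>q)"
      unfolding V_def using that by (subst emeasure_density) (auto intro!: nn_integral_cong simp: indicator_def)
    also have "\<dots> = ennreal (\<integral>y\<in>S. v x y \<partial>q)"
      unfolding set_lebesgue_integral_def using that v
      by (intro nn_integral_eq_integral integrable_mult_indicator vint AE_I2) (auto simp: indicator_def)
    finally show ?thesis using v that
      by (simp add: measure_def set_lebesgue_integral_def integral_nonneg_AE AE_I2)
  qed
  have "integrable (\<mu> \<Otimes>\<^sub>M q) (\<lambda>(x, y). v x y)"
    using v by (intro pq.integrable_const_bound[of _ \<theta>]) (auto intro!: AE_I2 simp: space_pair_measure)
  \<comment> \<open>The approximation \<open>g\<close> may be negative or unnormalised: only the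
    partition behind it enters the code, and \<open>g\<close> itself serves to bound the
    error.\<close>
  from cell_fun_dense[OF _ refl this \<eta>] obtain g where g: "cell_fun \<mu> q g borel"
    and gapp: "(\<integral>\<^sup>+z. ennreal \<bar>(case z of (x, y) \<Rightarrow> v x y) - g z\<bar> \<partial>(\<mu> \<Otimes>\<^sub>M q)) < ennreal \<eta>"
    using pq.finite_measure_axioms by blast
  have [measurable]: "g \<in> borel_measurable (\<mu> \<Otimes>\<^sub>M q)" by (rule cell_fun_measurable[OF g])
  obtain m \<kappa> h where \<kappa>[measurable]: "\<kappa> \<in> q \<rightarrow>\<^sub>M count_space UNIV" and \<kappa>m: "\<And>y. y \<in> space q \<Longrightarrow> \<kappa> y < (m::nat)"
    and gh: "\<And>x y. x \<in> space \<mu> \<Longrightarrow> y \<in> space q \<Longrightarrow> g (x, y) = h (\<kappa> y) x"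
    using g unfolding cell_fun_def by metis
  define Bk where "Bk k = \<kappa> -` {k} \<inter> space q" for k
  have Bk[measurable]: "Bk k \<in> sets q" for k unfolding Bk_def by measurable
  have disj: "disjoint_family_on Bk T" for T by (auto simp: disjoint_family_on_def Bk_def)
  have cover: "(\<Union>k<m. Bk k) = space q" using \<kappa>m by (auto simp: Bk_def)
  define Q where "Q k = measure q (Bk k)" for k
  \<comment> \<open>The law \<open>q\<close> conditioned on a cell. On a null cell the fallback
    \<open>q\<close> is harmless, because \<open>a_le\<close> below gives such a cell no
    weight.\<close>
  define U where "U k = (if Q k > 0 then uniform_measure q (Bk k) else q)" for k
  have U: "U k \<in> space (prob_algebra q)" for k
    unfolding U_def Q_def by (auto simp: q.emeasure_eq_measure space_prob_algebra q.prob_space_axioms intro!: prob_space_uniform_measure)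
  interpret U: prob_space "U k" for k using U[of k] by (simp add: space_prob_algebra)
  have Usets[simp]: "sets (U k) = sets q" for k by (simp add: U_def)
  define a where "a x k = measure (V x) (Bk k)" for x k
  have [measurable]: "(\<lambda>x. a x k) \<in> borel_measurable \<mu>" for k
    unfolding a_def by (rule measurable_compose[OF measurable_prob_algebraD[OF Vp]]) measurable
  have a0: "a x k \<ge> 0" for x k by (simp add: a_def)
  have a_le: "a x k \<le> \<theta> * Q k" if x: "x \<in> space \<mu>" for x k
  proof -
    have "a x k \<le> (\<integral>y\<in>Bk k. \<theta> \<partial>q)" unfolding a_def Vmeas[OF x Bk]
      using v(2)[OF x] integrable_mult_indicator[OF Bk vint[OF x]]
      by (intro set_integral_mono) (auto simp: set_integrable_def q.emeasure_eq_measure Bk_def)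
    then show ?thesis unfolding set_lebesgue_integral_def by (simp add: Q_def mult.commute)
  qed
  have sum_cells: "measure (V x) (S) = (\<Sum>k<m. measure (V x) (S \<inter> Bk k))" if x: "x \<in> space \<mu>" and S: "S \<in> sets q" for x S
  proof -
    interpret Vx: prob_space "V x" by (rule VP[OF x])
    have "S = (\<Union>k<m. S \<inter> Bk k)" using cover sets.sets_into_space[OF S] by blast
    then have "measure (V x) S = measure (V x) (\<Union>k<m. S \<inter> Bk k)" by simp
    also have "\<dots> = (\<Sum>k<m. measure (V x) (S \<inter> Bk k))"
      by (rule Vx.finite_measure_finite_Union) (auto simp: Vsets[OF x] S Bk_def disjoint_family_on_def)
    finally show ?thesis .
  qed
  have a_sum: "(\<Sum>k<m. a x k) = 1" if x: "x \<in> space \<mu>" for x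
  proof -
    interpret Vx: prob_space "V x" by (rule VP[OF x])
    have "space q \<inter> Bk k = Bk k" for k by (auto simp: Bk_def)
    then show ?thesis using sum_cells[OF x sets.top] Vx.prob_space sets_eq_imp_space_eq[OF Vsets[OF x]] by (simp add: a_def)
  qed
  \<comment> \<open>The channel \<open>V x\<close> with its output redrawn from \<open>q\<close>
    inside its cell: the cell probabilities are exact, the shape within a cell is forgotten.\<close>
  define W where "W x S = (\<Sum>k<m. a x k * measure (U k) S)" for x S
  have W1: "W x S \<le> 1" if x: "x \<in> space \<mu>" for x S
  proof -
    have "W x S \<le> (\<Sum>k<m. a x k * 1)" unfolding W_def by (intro sum_mono mult_left_mono a0) auto
    then show ?thesis using a_sum[OF x] by simp
  qed
  have W0: "W x S \<ge> 0" for x S unfolding W_def by (intro sum_nonneg mult_nonneg_nonneg a0) auto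
  have Wc: "W x (space q - S) = 1 - W x S" if x: "x \<in> space \<mu>" and S: "S \<in> sets q" for x S
  proof -
    have "measure (U k) (space q - S) = 1 - measure (U k) S" for k
      using U.prob_compl[of S k] S sets_eq_imp_space_eq[OF Usets[of k]] by simp
    then show ?thesis using a_sum[OF x] by (simp add: W_def right_diff_distrib sum_subtractf)
  qed
  text \<open>Resampling within cells is post-processing of the output, so it preserves privacy bounds.\<close>
  have post: "W x S - c * W x' S \<le> d"
    if x: "x \<in> space \<mu>" "x' \<in> space \<mu>" and d: "\<forall>S\<in>sets q. measure (V x) S - c * measure (V x') S \<le> d" for x x' c d S
  proof -
    \<comment> \<open>Each summand is at most the positive part of
      \<open>a x k - c * a x' k\<close>, and the sum of these positive parts is attained by the
      union of the cells in \<open>T\<close>, an event to which the bound for \<open>V\<close>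
      applies.\<close>
    define T where "T = {k\<in>{..<m}. a x k - c * a x' k > 0}"
    interpret Vx: prob_space "V x" by (rule VP[OF x(1)])
    interpret Vx': prob_space "V x'" by (rule VP[OF x(2)])
    have "W x S - c * W x' S = (\<Sum>k<m. (a x k - c * a x' k) * measure (U k) S)"
      by (simp add: W_def sum_distrib_left sum_subtractf algebra_simps)
    also have "\<dots> \<le> (\<Sum>k<m. if k \<in> T then a x k - c * a x' k else 0)"
    proof (rule sum_mono)
      fix k assume k: "k \<in> {..<m}"
      show "(a x k - c * a x' k) * measure (U k) S \<le> (if k \<in> T then a x k - c * a x' k else 0)"
        using k mult_left_le[OF U.prob_le_1, of "a x k - c * a x' k" k S]
          mult_nonpos_nonneg[of "a x k - c * a x' k" "measure (U k) S"] by (auto simp: T_def)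
    qed
    also have "\<dots> = (\<Sum>k\<in>T. a x k - c * a x' k)"
      by (subst sum.inter_filter[symmetric]) (auto simp: T_def intro!: sum.cong)
    also have "\<dots> = (\<Sum>k\<in>T. a x k) - c * (\<Sum>k\<in>T. a x' k)" by (simp add: sum_subtractf sum_distrib_left)
    also have "(\<Sum>k\<in>T. a x k) = measure (V x) (\<Union>k\<in>T. Bk k)"
      unfolding a_def by (rule Vx.finite_measure_finite_Union[symmetric]) (auto simp: Vsets[OF x(1)] T_def disj)
    also have "(\<Sum>k\<in>T. a x' k) = measure (V x') (\<Union>k\<in>T. Bk k)"
      unfolding a_def by (rule Vx'.finite_measure_finite_Union[symmetric]) (auto simp: Vsets[OF x(2)] T_def disj)
    also have "measure (V x) (\<Union>k\<in>T. Bk k) - c * measure (V x') (\<Union>k\<in>T. Bk k) \<le> d"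
      using d by (auto simp: T_def)
    finally show ?thesis .
  qed
  have VW: "ennreal \<bar>measure (V x) S - W x S\<bar> \<le> 2 * (\<integral>\<^sup>+y. ennreal \<bar>v x y - g (x, y)\<bar> \<partial>q)"
    if x: "x \<in> space \<mu>" and S[measurable]: "S \<in> sets q" for x S
  proof -
    have set_int: "set_integrable q T (\<lambda>y. v x y - h k x)" "set_integrable q T (\<lambda>y. \<bar>v x y - h k x\<bar>)"
      "set_integrable q T (v x)" "set_integrable q T (\<lambda>y. h k x)" if [measurable]: "T \<in> sets q" for T k
      unfolding set_integrable_def
      by (intro integrable_mult_indicator that Bochner_Integration.integrable_diff integrable_abs vint[OF x] q.integrable_const)+
    have abs_int: "\<bar>(\<integral>y\<in>T. v x y - h k x \<partial>q)\<bar> \<le> (\<integral>y\<in>Bk k. \<bar>v x y - h k x\<bar> \<partial>q)" if T[measurable]: "T \<in> sets q" "T \<subseteq> Bk k" for T k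
    proof -
      have "\<bar>(\<integral>y\<in>T. v x y - h k x \<partial>q)\<bar> \<le> (\<integral>y\<in>T. \<bar>v x y - h k x\<bar> \<partial>q)"
        using set_integral_norm_bound[OF set_int(1)[OF T(1)], of k] by simp
      also have "\<dots> \<le> (\<integral>y\<in>Bk k. \<bar>v x y - h k x\<bar> \<partial>q)"
        unfolding set_lebesgue_integral_def
        using T set_int(2)[OF T(1), of k] set_int(2)[OF Bk, of k k]
        by (intro integral_mono) (auto simp: set_integrable_def indicator_def)
      finally show ?thesis .
    qed
    have diff_eq: "(\<integral>y\<in>T. v x y - h k x \<partial>q) = measure (V x) T - h k x * measure q T" if [measurable]: "T \<in> sets q" for T k
    proof -
      have "(\<integral>y\<in>T. v x y - h k x \<partial>q) = (\<integral>y\<in>T. v x y \<partial>q) - (\<integral>y\<in>T. h k x \<partial>q)"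
        by (rule set_integral_diff(2)) (use set_int[OF that] in auto)
      then show ?thesis using Vmeas[OF x that] unfolding set_lebesgue_integral_def by (simp add: mult.commute)
    qed
    \<comment> \<open>Inside a cell \<open>g (x, y)\<close> equals \<open>h k x\<close>, and a
      constant density is left alone by resampling. On the cell, both \<open>V x\<close> and its
      resampled version differ from this constant density by at most the mean deviation, whence the
      factor 2.\<close>
    have cell: "\<bar>measure (V x) (S \<inter> Bk k) - a x k * measure (U k) S\<bar> \<le> 2 * (\<integral>y\<in>Bk k. \<bar>v x y - h k x\<bar> \<partial>q)" for k
    proof -
      have 1: "\<bar>measure (V x) (S \<inter> Bk k) - h k x * measure q (S \<inter> Bk k)\<bar> \<le> (\<integral>y\<in>Bk k. \<bar>v x y - h k x\<bar> \<partial>q)"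
        using abs_int[of "S \<inter> Bk k" k] diff_eq[of "S \<inter> Bk k" k] by simp
      have 2: "\<bar>a x k - h k x * Q k\<bar> \<le> (\<integral>y\<in>Bk k. \<bar>v x y - h k x\<bar> \<partial>q)"
        using abs_int[of "Bk k" k] diff_eq[of "Bk k" k] by (simp add: a_def Q_def)
      have 3: "Q k * measure (U k) S = measure q (S \<inter> Bk k)"
      proof (cases "Q k > 0")
        case True
        then have "measure (U k) S = measure q (Bk k \<inter> S) / measure q (Bk k)"
          by (simp add: U_def Q_def q.emeasure_eq_measure measure_uniform_measure)
        then show ?thesis using True by (simp add: Q_def Int_commute)
      next
        case False
        then have "Q k = 0" using measure_nonneg[of q "Bk k"] by (simp add: Q_def)
        moreover have "measure q (S \<inter> Bk k) \<le> Q k" unfolding Q_def by (intro q.finite_measure_mono) auto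
        ultimately show ?thesis by (simp add: measure_le_0_iff)
      qed
      have "\<bar>h k x * measure q (S \<inter> Bk k) - a x k * measure (U k) S\<bar> = \<bar>a x k - h k x * Q k\<bar> * measure (U k) S"
      proof -
        have "h k x * measure q (S \<inter> Bk k) - a x k * measure (U k) S = - ((a x k - h k x * Q k) * measure (U k) S)"
          unfolding 3[symmetric] by (simp add: left_diff_distrib)
        then show ?thesis by (simp only: abs_minus abs_mult abs_of_nonneg[OF measure_nonneg])
      qed
      also have "\<dots> \<le> \<bar>a x k - h k x * Q k\<bar> * 1" by (intro mult_left_mono) auto
      finally have "\<bar>h k x * measure q (S \<inter> Bk k) - a x k * measure (U k) S\<bar> \<le> \<bar>a x k - h k x * Q k\<bar>" by simp
      then show ?thesis using 1 2 abs_diff_le by blast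
    qed
    have gx: "integrable q (\<lambda>y. \<bar>v x y - g (x, y)\<bar>)"
    proof -
      have "\<bar>g (x, y)\<bar> \<le> (\<Sum>k<m. \<bar>h k x\<bar>)" if "y \<in> space q" for y
        using gh[OF x that] member_le_sum[of "\<kappa> y" "{..<m}" "\<lambda>k. \<bar>h k x\<bar>"] \<kappa>m[OF that] by auto
      then have "integrable q (\<lambda>y. g (x, y))"
        using x by (intro q.integrable_const_bound[of _ "\<Sum>k<m. \<bar>h k x\<bar>"]) (auto intro!: AE_I2)
      then show ?thesis using vint[OF x] by auto
    qed
    have "\<bar>measure (V x) S - W x S\<bar> \<le> (\<Sum>k<m. \<bar>measure (V x) (S \<inter> Bk k) - a x k * measure (U k) S\<bar>)"
      unfolding sum_cells[OF x S] W_def sum_subtractf[symmetric] by (rule sum_abs)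
    also have "\<dots> \<le> (\<Sum>k<m. 2 * (\<integral>y\<in>Bk k. \<bar>v x y - h k x\<bar> \<partial>q))" by (intro sum_mono cell)
    also have "\<dots> = 2 * (\<Sum>k<m. (\<integral>y\<in>Bk k. \<bar>v x y - g (x, y)\<bar> \<partial>q))"
    proof -
      have "(\<integral>y\<in>Bk k. \<bar>v x y - h k x\<bar> \<partial>q) = (\<integral>y\<in>Bk k. \<bar>v x y - g (x, y)\<bar> \<partial>q)" for k
        by (intro set_lebesgue_integral_cong) (auto simp: Bk_def gh[OF x])
      then show ?thesis by (simp add: sum_distrib_left)
    qed
    also have "(\<Sum>k<m. (\<integral>y\<in>Bk k. \<bar>v x y - g (x, y)\<bar> \<partial>q)) = (\<integral>y. \<bar>v x y - g (x, y)\<bar> \<partial>q)"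
    proof -
      have "(\<integral>y. \<bar>v x y - g (x, y)\<bar> \<partial>q) = (\<integral>y. (\<Sum>k<m. indicator (Bk k) y *\<^sub>R \<bar>v x y - g (x, y)\<bar>) \<partial>q)"
      proof (intro Bochner_Integration.integral_cong refl)
        fix y assume y: "y \<in> space q"
        have "(\<Sum>k<m. indicator (Bk k) y *\<^sub>R \<bar>v x y - g (x, y)\<bar>) = (\<Sum>k<m. if k = \<kappa> y then \<bar>v x y - g (x, y)\<bar> else 0)"
          using y by (intro sum.cong) (auto simp: Bk_def)
        then show "\<bar>v x y - g (x, y)\<bar> = (\<Sum>k<m. indicator (Bk k) y *\<^sub>R \<bar>v x y - g (x, y)\<bar>)" using \<kappa>m[OF y] by simp
      qed
      also have "\<dots> = (\<Sum>k<m. (\<integral>y\<in>Bk k. \<bar>v x y - g (x, y)\<bar> \<partial>q))"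
        unfolding set_lebesgue_integral_def by (intro Bochner_Integration.integral_sum integrable_mult_indicator gx) auto
      finally show ?thesis by simp
    qed
    finally have "ennreal \<bar>measure (V x) S - W x S\<bar> \<le> ennreal (2 * (\<integral>y. \<bar>v x y - g (x, y)\<bar> \<partial>q))" by (rule ennreal_leI)
    also have "\<dots> = 2 * (\<integral>\<^sup>+y. ennreal \<bar>v x y - g (x, y)\<bar> \<partial>q)"
      by (subst nn_integral_eq_integral[OF gx]) (auto simp: ennreal_mult)
    finally show ?thesis .
  qed
  define e where "e = exp (- real M / \<theta>)"
  have e: "0 \<le> e" "e \<le> 1" using \<theta> by (auto simp: e_def)
  \<comment> \<open>Rounding changes each of the \<open>m\<close> cell counts by at most one letter;
    after scaling by \<open>\<theta> / N0\<close> this amounts to at most \<open>\<eta>\<close> in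
    total.\<close>
  obtain N0 :: nat where N0: "real m * \<theta> / \<eta> < real N0" "N0 \<ge> 1"
    using reals_Archimedean2[of "max (real m * \<theta> / \<eta>) 1"] by (auto simp: max_less_iff_conj)
  then have N0': "real m * \<theta> / N0 \<le> \<eta>" using \<eta> by (simp add: field_simps)
  define n where "n k = nat \<lfloor>Q k * N0\<rfloor>" for k
  have n: "n k \<le> Q k * N0" "Q k * N0 - 1 \<le> n k" for k
    by (auto simp: n_def Q_def) 
  have "(\<Sum>k<m. Q k) = 1"
  proof -
    have "measure q (\<Union>k<m. Bk k) = (\<Sum>k<m. Q k)"
      unfolding Q_def by (rule q.finite_measure_finite_Union) (auto simp: disj)
    then show ?thesis unfolding cover by (simp add: q.prob_space)
  qed
  have "real (\<Sum>k<m. n k) \<le> (\<Sum>k<m. Q k * N0)" unfolding of_nat_sum by (intro sum_mono n)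
  also have "\<dots> = N0" using \<open>(\<Sum>k<m. Q k) = 1\<close> by (simp flip: sum_distrib_right)
  finally have "(\<Sum>k<m. n k) \<le> card {..<N0}" by (simp only: of_nat_le_iff card_lessThan)
  from colouring_with_counts[OF _ this] obtain \<phi> :: "nat \<Rightarrow> nat option" where
    \<phi>: "\<And>k. k < m \<Longrightarrow> card {j\<in>{..<N0}. \<phi> j = Some k} = n k" "\<And>j k. \<phi> j = Some k \<Longrightarrow> k < m" by auto
  \<comment> \<open>A letter of cell \<open>k\<close> is accepted with the average of
    \<open>v x\<close> over the cell divided by \<open>\<theta>\<close>, which is at most one by
    \<open>a_le\<close>. Leftover letters are never accepted.\<close>
  define \<alpha> where "\<alpha> x j = (case \<phi> j of None \<Rightarrow> 0 | Some k \<Rightarrow> a x k / (Q k * \<theta>))" for x j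
  define \<nu> where "\<nu> j = (case \<phi> j of None \<Rightarrow> q | Some k \<Rightarrow> U k)" for j
  have Q0: "Q k \<ge> 0" for k by (simp add: Q_def)
  have acc: "0 \<le> a x k / (Q k * \<theta>)" "a x k / (Q k * \<theta>) \<le> 1" if "x \<in> space \<mu>" for x k
    using a0[of x k] a_le[OF that, of k] Q0[of k] \<theta> by (auto simp: divide_le_eq_1 mult.commute)
  have avg: "(\<Sum>j<N0. \<alpha> x j * f (\<nu> j)) = (\<Sum>k<m. n k * (a x k / (Q k * \<theta>) * f (U k)))" for x and f :: "'y measure \<Rightarrow> real"
  proof -
    have "(\<Sum>j<N0. \<alpha> x j * f (\<nu> j)) = (\<Sum>j<N0. \<Sum>k<m. if \<phi> j = Some k then a x k / (Q k * \<theta>) * f (U k) else 0)"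
    proof (rule sum.cong[OF refl])
      fix j show "\<alpha> x j * f (\<nu> j) = (\<Sum>k<m. if \<phi> j = Some k then a x k / (Q k * \<theta>) * f (U k) else 0)"
        using \<phi>(2)[of j] by (cases "\<phi> j") (auto simp: \<alpha>_def \<nu>_def)
    qed
    also have "\<dots> = (\<Sum>k<m. \<Sum>j<N0. if \<phi> j = Some k then a x k / (Q k * \<theta>) * f (U k) else 0)" by (rule sum.swap)
    also have "\<dots> = (\<Sum>k<m. n k * (a x k / (Q k * \<theta>) * f (U k)))"
      by (intro sum.cong refl, subst sum.inter_filter[symmetric]) (auto simp: \<phi>(1)[simplified])
    finally show ?thesis .
  qed
  have "\<exists>enc dec. code_pair M (N0 ^ M) \<mu> q enc dec \<and>
    (\<forall>x\<in>space \<mu>. \<forall>S\<in>sets q. (\<Sum>s<M. (1 - (\<Sum>j<N0. \<alpha> x j) / N0) ^ s) * ((\<Sum>j<N0. \<alpha> x j * measure (\<nu> j) S) / N0)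
        \<le> measure (code_kernel (N0 ^ M) enc dec x) S)"
  proof (rule rejection_sampling)
    show "(\<lambda>x. \<alpha> x j) \<in> borel_measurable \<mu>" for j unfolding \<alpha>_def by (cases "\<phi> j") auto
    show "0 \<le> \<alpha> x j" "\<alpha> x j \<le> 1" if "x \<in> space \<mu>" for x j
      using acc[OF that] by (auto simp: \<alpha>_def split: option.splits)
    show "\<nu> j \<in> space (prob_algebra q)" for j using U by (auto simp: \<nu>_def space_prob_algebra q.prob_space_axioms split: option.splits)
  qed (use N0 M in auto)
  then obtain enc dec where cp: "code_pair M (N0 ^ M) \<mu> q enc dec" and
    low: "\<And>x S. x \<in> space \<mu> \<Longrightarrow> S \<in> sets q \<Longrightarrow> (\<Sum>s<M. (1 - (\<Sum>j<N0. \<alpha> x j) / N0) ^ s) * ((\<Sum>j<N0. \<alpha> x j * measure (\<nu> j) S) / N0)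
        \<le> measure (code_kernel (N0 ^ M) enc dec x) S" by blast
  define K where "K = code_kernel (N0 ^ M) enc dec"
  have Kp[measurable]: "K \<in> \<mu> \<rightarrow>\<^sub>M prob_algebra q" unfolding K_def by (rule code_kernel_measurable[OF cp])
  have KP: "prob_space (K x)" and Ksets: "sets (K x) = sets q" if "x \<in> space \<mu>" for x
    using measurable_space[OF Kp that] by (auto simp: space_prob_algebra)
  have KW1: "W x S - (e + \<eta>) \<le> measure (K x) S" if x: "x \<in> space \<mu>" and S: "S \<in> sets q" for x S
  proof -
    \<comment> \<open>Rounding down can only lower the acceptance probability, so it stays at most
      \<open>1 / \<theta>\<close>, as \<open>geometric_sum_ge\<close> requires.\<close>
    have nQ: "n k * (a x k / (Q k * \<theta>)) \<le> N0 * (a x k / \<theta>)" for k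
    proof -
      have "n k * (a x k / (Q k * \<theta>)) \<le> (Q k * N0) * (a x k / (Q k * \<theta>))"
        by (intro mult_right_mono n acc[OF x])
      also have "\<dots> = N0 * (a x k / \<theta>)" using a_le[OF x, of k] a0[of x k] by (cases "Q k = 0") auto
      finally show ?thesis .
    qed
    have "(\<Sum>j<N0. \<alpha> x j) \<le> (\<Sum>k<m. N0 * (a x k / \<theta>))"
      using avg[of x "\<lambda>_. 1"] nQ by (auto intro!: sum_mono)
    also have "\<dots> = N0 / \<theta>" using a_sum[OF x] by (simp flip: sum_distrib_left sum_divide_distrib)
    finally have "(\<Sum>j<N0. \<alpha> x j) / N0 \<le> 1 / \<theta>" using N0(2) by (simp add: field_simps)
    then have geo: "\<theta> * (1 - e) \<le> (\<Sum>s<M. (1 - (\<Sum>j<N0. \<alpha> x j) / N0) ^ s)"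
      unfolding e_def by (rule geometric_sum_ge[OF \<theta>])
    \<comment> \<open>A missing letter costs at most one, since its acceptance weight is at most
      one.\<close>
    have "N0 * (a x k / \<theta> * measure (U k) S) - 1 \<le> n k * (a x k / (Q k * \<theta>) * measure (U k) S)" for k
    proof -
      have "N0 * (a x k / \<theta> * measure (U k) S) = (Q k * N0) * (a x k / (Q k * \<theta>) * measure (U k) S)"
        using a_le[OF x, of k] a0[of x k] by (cases "Q k = 0") auto
      also have "\<dots> \<le> (n k + 1) * (a x k / (Q k * \<theta>) * measure (U k) S)"
        using n(2)[of k] acc[OF x] by (intro mult_right_mono mult_nonneg_nonneg) auto
      also have "\<dots> \<le> n k * (a x k / (Q k * \<theta>) * measure (U k) S) + 1"
      proof -
        have "(n k + 1) * T \<le> n k * T + 1" if "T \<le> 1" for T :: real using that by (simp add: distrib_right)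
        moreover have "a x k / (Q k * \<theta>) * measure (U k) S \<le> 1"
          by (rule mult_le_one) (use acc[OF x] in auto)
        ultimately show ?thesis by blast
      qed
      finally show ?thesis by simp
    qed
    then have "(\<Sum>k<m. N0 * (a x k / \<theta> * measure (U k) S) - 1) \<le> (\<Sum>j<N0. \<alpha> x j * measure (\<nu> j) S)"
      unfolding avg[of x "\<lambda>P. measure P S"] by (intro sum_mono)
    then have "N0 * (W x S / \<theta>) - m \<le> (\<Sum>j<N0. \<alpha> x j * measure (\<nu> j) S)"
      by (simp add: sum_subtractf W_def sum_distrib_left sum_divide_distrib)
    from divide_right_mono[OF this, of N0]
    have "W x S / \<theta> - m / N0 \<le> (\<Sum>j<N0. \<alpha> x j * measure (\<nu> j) S) / N0" (is "_ \<le> ?r")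
      using N0(2) by (simp add: diff_divide_distrib)
    then have r: "W x S - \<eta> \<le> \<theta> * ?r"
      using \<theta> N0' by (simp add: field_simps) 
    have r0: "0 \<le> ?r" using acc[OF x] by (auto intro!: sum_nonneg divide_nonneg_nonneg mult_nonneg_nonneg simp: \<alpha>_def split: option.splits)
    have "W x S - (e + \<eta>) \<le> (1 - e) * (W x S - \<eta>)"
    proof -
      have "e * (W x S - \<eta>) \<le> e * 1" using W1[OF x, of S] \<eta> e by (intro mult_left_mono) auto
      then show ?thesis by (simp add: algebra_simps)
    qed
    also have "\<dots> \<le> (1 - e) * (\<theta> * ?r)" using r e by (intro mult_left_mono) auto
    also have "\<dots> = \<theta> * (1 - e) * ?r" by simp
    also have "\<dots> \<le> (\<Sum>s<M. (1 - (\<Sum>j<N0. \<alpha> x j) / N0) ^ s) * ?r" by (intro mult_right_mono geo r0)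
    also have "\<dots> \<le> measure (K x) S" using low[OF x S] by (simp add: K_def)
    finally show ?thesis .
  qed
  \<comment> \<open>Both sides are probabilities, so the lower bound applied to the complement
    bounds the deviation from above.\<close>
  have KW: "\<bar>measure (K x) S - W x S\<bar> \<le> e + \<eta>" if x: "x \<in> space \<mu>" and S: "S \<in> sets q" for x S
  proof -
    interpret Kx: prob_space "K x" by (rule KP[OF x])
    have "measure (K x) (space q - S) = 1 - measure (K x) S"
      using Kx.prob_compl[of S] S Ksets[OF x] sets_eq_imp_space_eq[OF Ksets[OF x]] by simp
    then show ?thesis using KW1[OF x S] KW1[OF x, of "space q - S"] Wc[OF x S] S by auto
  qed
  \<comment> \<open>As post-processing of \<open>V\<close>, the resampled \<open>W\<close> satisfies
    the bound of \<open>V\<close> exactly; only the deviation of \<open>K\<close> from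
    \<open>W\<close> is paid, once for \<open>x\<close> and \<open>c\<close> times for
    \<open>x'\<close>.\<close>
  have ldp: "measure (K x) S - c * measure (K x') S \<le> d + (1 + c) * (e + \<eta>)"
    if x: "x \<in> space \<mu>" "x' \<in> space \<mu>" and c: "c \<ge> 0" and d: "\<forall>S\<in>sets q. measure (V x) S - c * measure (V x') S \<le> d" and S: "S \<in> sets q" for x x' c d S
  proof -
    have "measure (K x) S \<le> W x S + (e + \<eta>)" using KW[OF x(1) S] by linarith
    moreover have "c * (W x' S - (e + \<eta>)) \<le> c * measure (K x') S" using KW1[OF x(2) S] c by (intro mult_left_mono) auto
    ultimately show ?thesis using post[OF x d, of S] by (simp add: algebra_simps)
  qed
  have app: "\<bar>(\<integral>x. measure (V x) (Pair x -` E) \<partial>\<mu>) - (\<integral>x. measure (K x) (Pair x -` E) \<partial>\<mu>)\<bar> \<le> e + 3 * \<eta>"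
    if E[measurable]: "E \<in> sets (\<mu> \<Otimes>\<^sub>M q)" for E
  proof -
    have Es: "Pair x -` E \<in> sets q" for x by (rule sets_Pair1[OF E])
    have Sig: "Sigma (space \<mu>) (\<lambda>x. Pair x -` E) \<in> sets (\<mu> \<Otimes>\<^sub>M q)"
    proof -
      have "Sigma (space \<mu>) (\<lambda>x. Pair x -` E) = E" using sets.sets_into_space[OF E] by (auto simp: space_pair_measure)
      then show ?thesis using E by simp
    qed
    have [measurable]: "(\<lambda>x. measure (V x) (Pair x -` E)) \<in> borel_measurable \<mu>"
      by (rule measure_measurable_prob_algebra2[OF Sig Vp])
    have [measurable]: "(\<lambda>x. measure (K x) (Pair x -` E)) \<in> borel_measurable \<mu>"
      by (rule measure_measurable_prob_algebra2[OF Sig Kp])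
    have iV: "integrable \<mu> (\<lambda>x. measure (V x) (Pair x -` E))"
      by (rule \<mu>.integrable_const_bound[of _ 1]) (auto intro!: AE_I2 prob_space.prob_le_1 VP)
    have iK: "integrable \<mu> (\<lambda>x. measure (K x) (Pair x -` E))"
      by (rule \<mu>.integrable_const_bound[of _ 1]) (auto intro!: AE_I2 prob_space.prob_le_1 KP)
    have "ennreal \<bar>(\<integral>x. measure (V x) (Pair x -` E) \<partial>\<mu>) - (\<integral>x. measure (K x) (Pair x -` E) \<partial>\<mu>)\<bar>
      = ennreal \<bar>\<integral>x. measure (V x) (Pair x -` E) - measure (K x) (Pair x -` E) \<partial>\<mu>\<bar>"
      using iV iK by simp
    also have "\<dots> \<le> (\<integral>\<^sup>+x. ennreal (norm (measure (V x) (Pair x -` E) - measure (K x) (Pair x -` E))) \<partial>\<mu>)"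
      using integral_norm_bound_ennreal[of \<mu> "\<lambda>x. measure (V x) (Pair x -` E) - measure (K x) (Pair x -` E)"] iV iK by simp
    \<comment> \<open>\<open>KW\<close> is uniform in \<open>x\<close>, whereas the distance of
      \<open>V x\<close> from \<open>W x\<close> is small only after integration and is therefore
      kept as a function of \<open>x\<close>.\<close>
    also have "\<dots> \<le> (\<integral>\<^sup>+x. 2 * (\<integral>\<^sup>+y. ennreal \<bar>v x y - g (x, y)\<bar> \<partial>q) + ennreal (e + \<eta>) \<partial>\<mu>)"
    proof (rule nn_integral_mono)
      fix x assume x: "x \<in> space \<mu>"
      have "ennreal (norm (measure (V x) (Pair x -` E) - measure (K x) (Pair x -` E)))
         \<le> ennreal (\<bar>measure (V x) (Pair x -` E) - W x (Pair x -` E)\<bar> + (e + \<eta>))"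
        using abs_diff_le_add[OF KW[OF x Es]] by (intro ennreal_leI) auto
      also have "\<dots> = ennreal \<bar>measure (V x) (Pair x -` E) - W x (Pair x -` E)\<bar> + ennreal (e + \<eta>)"
        using e \<eta> by (subst ennreal_plus) auto
      also have "\<dots> \<le> 2 * (\<integral>\<^sup>+y. ennreal \<bar>v x y - g (x, y)\<bar> \<partial>q) + ennreal (e + \<eta>)" by (intro add_right_mono VW[OF x Es])
      finally show "ennreal (norm (measure (V x) (Pair x -` E) - measure (K x) (Pair x -` E))) \<le> \<dots>" .
    qed
    also have "\<dots> = 2 * (\<integral>\<^sup>+x. (\<integral>\<^sup>+y. ennreal \<bar>v x y - g (x, y)\<bar> \<partial>q) \<partial>\<mu>) + ennreal (e + \<eta>)"
      by (subst nn_integral_add) (auto simp: nn_integral_cmult \<mu>.emeasure_space_1)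
    also have "(\<integral>\<^sup>+x. (\<integral>\<^sup>+y. ennreal \<bar>v x y - g (x, y)\<bar> \<partial>q) \<partial>\<mu>) = (\<integral>\<^sup>+z. ennreal \<bar>(case z of (x, y) \<Rightarrow> v x y) - g z\<bar> \<partial>(\<mu> \<Otimes>\<^sub>M q))"
      by (subst q.nn_integral_fst[symmetric]) auto
    also have "2 * \<dots> + ennreal (e + \<eta>) \<le> 2 * ennreal \<eta> + ennreal (e + \<eta>)"
      using gapp by (intro add_right_mono mult_left_mono) auto
    also have "\<dots> = ennreal (2 * \<eta> + (e + \<eta>))"
    proof -
      have "2 * ennreal \<eta> = ennreal (2 * \<eta>)" using \<eta> by (simp add: ennreal_mult)
      then show ?thesis using \<eta> e by (simp flip: ennreal_plus)
    qed
    finally have "ennreal \<bar>(\<integral>x. measure (V x) (Pair x -` E) \<partial>\<mu>) - (\<integral>x. measure (K x) (Pair x -` E) \<partial>\<mu>)\<bar> \<le> ennreal (2 * \<eta> + (e + \<eta>))" .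
    then show ?thesis using \<eta> e by (subst (asm) ennreal_le_iff) auto
  qed
  show ?thesis
    by (rule exI[of _ "N0 ^ M"], rule exI[of _ enc], rule exI[of _ dec])
       (use cp ldp app in \<open>auto simp: K_def e_def\<close>)
qed

section \<open>Flattening a density\<close>

definition tail :: "'y measure \<Rightarrow> ('y \<Rightarrow> real) \<Rightarrow> real \<Rightarrow> ennreal" where
  "tail q F u = (\<integral>\<^sup>+y. indicator {u<..} (F y) \<partial>q)"

text \<open>Layer cake: \<open>F y\<close> is the length of the levels below it, and level
  \<open>u\<close> is kept with weight \<open>1 - k / tail q F u\<close>, or not at all if its
  superlevel set has measure at most \<open>k\<close>; the truncated difference and
  \<open>0 / 0 = 0\<close> on \<open>ennreal\<close> cover that case. The weight depends on
  \<open>F\<close> only through the size of the superlevel set and increases with it, which makes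
  the operator monotone, and the mass taken from a level depends on that size alone.\<close>

definition flatten :: "real \<Rightarrow> 'y measure \<Rightarrow> ('y \<Rightarrow> real) \<Rightarrow> 'y \<Rightarrow> ennreal" where
  "flatten k q F y = (\<integral>\<^sup>+u. indicator {0<..<F y} u * ((tail q F u - ennreal k) / tail q F u) \<partial>lborel)"

definition excess :: "real \<Rightarrow> 'y measure \<Rightarrow> ('y \<Rightarrow> real) \<Rightarrow> ennreal" where
  "excess k q F = (\<integral>\<^sup>+u. indicator {0<..} u * min (ennreal k) (tail q F u) \<partial>lborel)"

text \<open>For \<open>k < b\<close> the kept fraction is \<open>1 - k / b\<close>, which increases
  in \<open>b\<close>; otherwise it vanishes.\<close>

lemma ennreal_keep_mono:
  fixes b c k :: ennreal
  assumes "b \<le> c" "c < \<top>"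
  shows "(b - k) / b \<le> (c - k) / c"
proof (cases "b \<le> k")
  case True
  then have "b - k = 0" using assms by (intro diff_eq_0_ennreal) auto
  then show ?thesis by simp
next
  case False
  then have *: "k < b" by simp
  with assms have "b < \<top>" by order
  obtain b' c' k' where r: "b = ennreal b'" "c = ennreal c'" "k = ennreal k'" "0 \<le> b'" "0 \<le> c'" "0 \<le> k'"
    using assms * \<open>b < \<top>\<close> by (metis ennreal_cases less_top order_less_trans top.not_eq_extremum)
  then have le: "k' < b'" "b' \<le> c'" "0 < b'" "0 < c'" using * assms by (auto simp: ennreal_less_iff)
  have "(b' - k') / b' \<le> (c' - k') / c'" using le r by (simp add: field_simps mult_right_mono)
  then show ?thesis unfolding r using le r by (simp add: ennreal_minus divide_ennreal ennreal_leI)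
qed

text \<open>Kept mass plus removed mass of a single level; integrated over the levels this becomes
  preservation of mass.\<close>

lemma ennreal_keep_split:
  fixes b k :: ennreal
  assumes "b < \<top>"
  shows "(b - k) / b * b + min k b = b"
proof (cases "b \<le> k")
  case True
  then have "b - k = 0" using assms by (intro diff_eq_0_ennreal) auto
  then show ?thesis using True by (simp add: min_def)
next
  case False
  then have "b \<noteq> 0" by auto
  then have "b / b = 1" using assms by (simp add: less_top)
  moreover have "(b - k) / b * b = (b - k) * (b / b)" by (simp add: divide_ennreal_def ac_simps)
  ultimately have "(b - k) / b * b = b - k" by simp
  moreover have "k \<le> b" using False by simp
  ultimately show ?thesis by (simp add: min_def diff_add_cancel_ennreal)
qed

lemma ennreal_keep_le_1:
  fixes b k :: ennreal
  assumes "b < \<top>" shows "(b - k) / b \<le> 1"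
proof (cases "b = 0")
  case False
  have "(b - k) / b \<le> b / b" by (intro divide_right_mono_ennreal diff_le_self_ennreal)
  also have "\<dots> = 1" using False assms by (simp add: ennreal_divide_self less_top)
  finally show ?thesis .
qed simp

context prob_space begin

lemma tail_le_1: "F \<in> borel_measurable M \<Longrightarrow> tail M F u \<le> 1"
proof -
  assume "F \<in> borel_measurable M"
  have "tail M F u \<le> (\<integral>\<^sup>+y. 1 \<partial>M)" unfolding tail_def by (intro nn_integral_mono) (auto simp: indicator_def)
  then show ?thesis by (simp add: emeasure_space_1)
qed

lemma tail_finite: "F \<in> borel_measurable M \<Longrightarrow> tail M F u < \<top>"
  using tail_le_1[of F u] by (simp add: order_le_less_trans)

lemma tail_measurable:
  assumes [measurable]: "(\<lambda>(x, y). F x y) \<in> borel_measurable (N \<Otimes>\<^sub>M M)" "u \<in> borel_measurable N"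
  shows "(\<lambda>x. tail M (F x) (u x)) \<in> borel_measurable N"
proof -
  have [measurable]: "(\<lambda>z. indicator {u (fst z)<..} (F (fst z) (snd z)) :: ennreal) \<in> borel_measurable (N \<Otimes>\<^sub>M M)"
    unfolding indicator_def greaterThan_iff by measurable
  show ?thesis unfolding tail_def by (rule borel_measurable_nn_integral) (simp add: case_prod_beta')
qed

lemma flatten_measurable:
  assumes [measurable]: "(\<lambda>(x, y). F x y) \<in> borel_measurable (N \<Otimes>\<^sub>M M)"
  shows "(\<lambda>(x, y). flatten k M (F x) y) \<in> borel_measurable (N \<Otimes>\<^sub>M M)"
proof -
  have [measurable]: "(\<lambda>w. F (fst (fst w)) (snd (fst w))) \<in> borel_measurable ((N \<Otimes>\<^sub>M M) \<Otimes>\<^sub>M lborel)"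
    by measurable
  have [measurable]: "(\<lambda>w. tail M (F (fst (fst w))) (snd w)) \<in> borel_measurable ((N \<Otimes>\<^sub>M M) \<Otimes>\<^sub>M lborel)"
    by (rule tail_measurable) measurable
  have "(\<lambda>w. (indicator {0<..<F (fst (fst w)) (snd (fst w))} (snd w) *
      ((tail M (F (fst (fst w))) (snd w) - ennreal k) / tail M (F (fst (fst w))) (snd w)) :: ennreal)) \<in> borel_measurable ((N \<Otimes>\<^sub>M M) \<Otimes>\<^sub>M lborel)"
    unfolding indicator_def greaterThanLessThan_iff by measurable
  then show ?thesis unfolding flatten_def case_prod_beta'
    by (intro lborel.borel_measurable_nn_integral) (simp add: case_prod_beta')
qed

lemma excess_measurable:
  assumes [measurable]: "(\<lambda>(x, y). F x y) \<in> borel_measurable (N \<Otimes>\<^sub>M M)"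
  shows "(\<lambda>x. excess k M (F x)) \<in> borel_measurable N"
proof -
  have [measurable]: "(\<lambda>w. tail M (F (fst w)) (snd w)) \<in> borel_measurable (N \<Otimes>\<^sub>M lborel)"
    by (rule tail_measurable) measurable
  show ?thesis unfolding excess_def
    by (intro lborel.borel_measurable_nn_integral) measurable
qed

lemma flatten_measurable1[measurable (raw)]:
  assumes [measurable]: "F \<in> borel_measurable M"
  shows "flatten k M F \<in> borel_measurable M"
proof -
  \<comment> \<open>A single function is treated as a family over a one-point space, so that joint
    measurability applies.\<close>
  have "(\<lambda>(x, y). flatten k M ((\<lambda>_::unit. F) x) y) \<in> borel_measurable (count_space UNIV \<Otimes>\<^sub>M M)"
    by (rule flatten_measurable) measurable
  from measurable_Pair2[OF this, of "()"] show ?thesis by (simp only: case_prod_conv space_count_space UNIV_I)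
qed

lemma tail_measurable1[measurable (raw)]:
  assumes [measurable]: "F \<in> borel_measurable M"
  shows "tail M F \<in> borel_measurable borel"
proof -
  have "(\<lambda>u. tail M ((\<lambda>_. F) u) u) \<in> borel_measurable borel" by (rule tail_measurable) measurable
  then show ?thesis .
qed

lemma tail_mono:
  assumes "\<And>y. y \<in> space M \<Longrightarrow> F y \<le> G y"
  shows "tail M F u \<le> tail M G u"
  unfolding tail_def by (intro nn_integral_mono) (auto simp: indicator_def dest: assms)

text \<open>A larger function has more levels below its value and larger superlevel sets;
  \<open>ennreal_keep_mono\<close> turns the latter into larger weights.\<close>

lemma flatten_mono:
  assumes "\<And>y. y \<in> space M \<Longrightarrow> F y \<le> G y" "y \<in> space M" "G \<in> borel_measurable M"
  shows "flatten k M F y \<le> flatten k M G y"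
  unfolding flatten_def
proof (intro nn_integral_mono mult_mono)
  fix u show "indicator {0<..<F y} u \<le> (indicator {0<..<G y} u :: ennreal)"
    using assms(1)[OF assms(2)] by (auto simp: indicator_def)
  show "(tail M F u - ennreal k) / tail M F u \<le> (tail M G u - ennreal k) / tail M G u"
    by (intro ennreal_keep_mono tail_mono assms tail_finite)
qed auto

lemma excess_mono:
  assumes "\<And>y. y \<in> space M \<Longrightarrow> F y \<le> G y"
  shows "excess k M F \<le> excess k M G"
  unfolding excess_def by (intro nn_integral_mono mult_left_mono min.mono tail_mono assms) auto

lemma flatten_le:
  assumes "F \<in> borel_measurable M" "F y \<ge> 0"
  shows "flatten k M F y \<le> ennreal (F y)"
proof -
  have "flatten k M F y \<le> (\<integral>\<^sup>+u. indicator {0<..<F y} u * 1 \<partial>lborel)"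
    unfolding flatten_def by (intro nn_integral_mono mult_left_mono ennreal_keep_le_1 tail_finite assms) auto
  then show ?thesis using assms(2) by simp
qed

text \<open>Truncation loses no mass: what is removed from level \<^term>\<open>u\<close> is \<^term>\<open>min k (tail M F u)\<close>.\<close>
lemma flatten_excess:
  assumes [measurable]: "F \<in> borel_measurable M" and F0: "\<And>y. y \<in> space M \<Longrightarrow> F y \<ge> 0"
  shows "(\<integral>\<^sup>+y. flatten k M F y \<partial>M) + excess k M F = (\<integral>\<^sup>+y. ennreal (F y) \<partial>M)"
proof -
  interpret pair_sigma_finite M lborel ..
  define r where "r u = (tail M F u - ennreal k) / tail M F u" for u
  have [measurable]: "r \<in> borel_measurable borel" unfolding r_def by measurable
  have [measurable]: "(\<lambda>w. indicator {0<..<F (fst w)} (snd w) :: ennreal) \<in> borel_measurable (M \<Otimes>\<^sub>M lborel)"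
    unfolding indicator_def greaterThanLessThan_iff by measurable
  \<comment> \<open>Fubini turns a weighted layer-cake integral into an integral of weighted
    superlevel measures; it is used for the weight \<open>r\<close> and for the weight one.\<close>
  have swap: "(\<integral>\<^sup>+y. (\<integral>\<^sup>+u. indicator {0<..<F y} u * f u \<partial>lborel) \<partial>M) = (\<integral>\<^sup>+u. indicator {0<..} u * (f u * tail M F u) \<partial>lborel)"
    if [measurable]: "f \<in> borel_measurable borel" for f :: "real \<Rightarrow> ennreal"
  proof -
    have "(\<integral>\<^sup>+y. (\<integral>\<^sup>+u. indicator {0<..<F y} u * f u \<partial>lborel) \<partial>M) = (\<integral>\<^sup>+u. (\<integral>\<^sup>+y. indicator {0<..<F y} u * f u \<partial>M) \<partial>lborel)"
      by (rule Fubini'[symmetric]) (simp add: case_prod_beta')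
    also have "\<dots> = (\<integral>\<^sup>+u. indicator {0<..} u * (f u * tail M F u) \<partial>lborel)"
    proof (intro nn_integral_cong)
      fix u :: real
      have "(\<integral>\<^sup>+y. indicator {0<..<F y} u * f u \<partial>M) = (\<integral>\<^sup>+y. (indicator {0<..} u * f u) * indicator {u<..} (F y) \<partial>M)"
        by (intro nn_integral_cong) (auto simp: indicator_def)
      also have "\<dots> = (indicator {0<..} u * f u) * tail M F u"
        unfolding tail_def by (rule nn_integral_cmult) measurable
      finally show "(\<integral>\<^sup>+y. indicator {0<..<F y} u * f u \<partial>M) = indicator {0<..} u * (f u * tail M F u)"
        by (simp add: mult.assoc)
    qed
    finally show ?thesis .
  qed
  have "(\<integral>\<^sup>+y. flatten k M F y \<partial>M) + excess k M F
     = (\<integral>\<^sup>+u. indicator {0<..} u * (r u * tail M F u) + indicator {0<..} u * min (ennreal k) (tail M F u) \<partial>lborel)"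
    unfolding flatten_def excess_def r_def[symmetric] by (subst swap, measurable, rule nn_integral_add[symmetric]) measurable
  also have "\<dots> = (\<integral>\<^sup>+u. indicator {0<..} u * (1 * tail M F u) \<partial>lborel)"
    unfolding r_def distrib_left[symmetric] by (subst ennreal_keep_split[OF tail_finite]) auto
  also have "\<dots> = (\<integral>\<^sup>+y. (\<integral>\<^sup>+u. indicator {0<..<F y} u * 1 \<partial>lborel) \<partial>M)" by (rule swap[symmetric]) simp
  also have "\<dots> = (\<integral>\<^sup>+y. ennreal (F y) \<partial>M)" using F0 by (intro nn_integral_cong) simp
  finally show ?thesis .
qed

lemma tail_scale: "c > 0 \<Longrightarrow> tail M (\<lambda>y. c * F y) (c * u) = tail M F u"
  unfolding tail_def by (intro nn_integral_cong) (auto simp: indicator_def)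

text \<open>Rescaling function and levels together leaves the superlevel sets unchanged. Homogeneity
  is what lets the factor of a hockey-stick divergence pass through the truncation.\<close>

lemma flatten_scale:
  assumes [measurable]: "F \<in> borel_measurable M" and c: "c > 0"
  shows "flatten k M (\<lambda>y. c * F y) y = ennreal c * flatten k M F y"
proof -
  have "flatten k M (\<lambda>y. c * F y) y = ennreal \<bar>c\<bar> * (\<integral>\<^sup>+u. indicator {0<..<c * F y} (0 + c * u) *
      ((tail M (\<lambda>y. c * F y) (0 + c * u) - ennreal k) / tail M (\<lambda>y. c * F y) (0 + c * u)) \<partial>lborel)"
    unfolding flatten_def using c by (intro nn_integral_real_affine) (auto intro!: borel_measurable_divide_ennreal)
  also have "\<dots> = ennreal c * flatten k M F y"
    unfolding flatten_def using c by (auto simp: tail_scale indicator_def zero_less_mult_iff intro!: arg_cong[where f="\<lambda>x. ennreal c * x"] nn_integral_cong)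
  finally show ?thesis .
qed

lemma excess_scale:
  assumes [measurable]: "F \<in> borel_measurable M" and c: "c > 0"
  shows "excess k M (\<lambda>y. c * F y) = ennreal c * excess k M F"
proof -
  have "excess k M (\<lambda>y. c * F y) = ennreal \<bar>c\<bar> * (\<integral>\<^sup>+u. indicator {0<..} (0 + c * u) *
      min (ennreal k) (tail M (\<lambda>y. c * F y) (0 + c * u)) \<partial>lborel)"
    unfolding excess_def using c by (intro nn_integral_real_affine) auto
  also have "\<dots> = ennreal c * excess k M F"
    unfolding excess_def using c by (auto simp: tail_scale indicator_def zero_less_mult_iff intro!: arg_cong[where f="\<lambda>x. ennreal c * x"] nn_integral_cong)
  finally show ?thesis .
qed

text \<open>A level \<^term>\<open>u > 1 / k\<close> survives on a set of measure below \<^term>\<open>k\<close>, by Markov's inequality,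
  and is therefore removed.\<close>
lemma flatten_bounded:
  assumes [measurable]: "F \<in> borel_measurable M" and F0: "\<And>y. y \<in> space M \<Longrightarrow> F y \<ge> 0"
    and F1: "(\<integral>\<^sup>+y. ennreal (F y) \<partial>M) \<le> 1" and k: "k > 0"
  shows "flatten k M F y \<le> ennreal (1 / k)"
proof -
  have "flatten k M F y \<le> (\<integral>\<^sup>+u. indicator {0..1/k} u \<partial>lborel)"
    unfolding flatten_def
  proof (rule nn_integral_mono)
    fix u :: real
    show "indicator {0<..<F y} u * ((tail M F u - ennreal k) / tail M F u) \<le> indicator {0..1/k} u"
    proof (cases "1 / k < u")
      case True
      have "u > 0" using True k by (meson less_trans zero_less_divide_1_iff)
      have "ennreal u * tail M F u = (\<integral>\<^sup>+y. ennreal u * indicator {u<..} (F y) \<partial>M)"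
        unfolding tail_def by (rule nn_integral_cmult[symmetric]) measurable
      also have "\<dots> \<le> (\<integral>\<^sup>+y. ennreal (F y) \<partial>M)" by (intro nn_integral_mono) (auto simp: indicator_def ennreal_leI)
      also have "\<dots> \<le> ennreal 1" using F1 by simp
      also have "\<dots> \<le> ennreal (u * k)" using True k by (intro ennreal_leI) (simp add: field_simps)
      also have "\<dots> = ennreal u * ennreal k" using \<open>u > 0\<close> k by (simp add: ennreal_mult)
      finally have "tail M F u \<le> ennreal k" using \<open>u > 0\<close> by (simp add: ennreal_mult_le_mult_iff)
      then have "tail M F u - ennreal k = 0" using tail_finite[of F u] by (intro diff_eq_0_ennreal) auto
      then show ?thesis by simp
    next
      case False
      have "indicator {0<..<F y} u * ((tail M F u - ennreal k) / tail M F u) \<le> indicator {0<..<F y} u * 1"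
        by (intro mult_left_mono ennreal_keep_le_1 tail_finite) auto
      then show ?thesis using False by (auto simp: indicator_def split: if_splits)
    qed
  qed
  then show ?thesis using k by simp
qed

text \<open>Levels below \<open>u0\<close> lose at most \<open>k\<close> each. Above
  \<open>u0\<close> the whole tail is charged; it integrates to the part of \<open>F\<close> beyond
  \<open>u0\<close>, and there \<open>F\<close> is at most
  \<open>u0 powr (1 - p) * F powr p\<close>. The split point is left free and is chosen in
  \<open>flattened_kernel\<close>.\<close>

lemma excess_bound:
  assumes [measurable]: "F \<in> borel_measurable M" and F0: "\<And>y. y \<in> space M \<Longrightarrow> F y \<ge> 0"
    and u0: "u0 > 0" and k: "k > 0" and p: "p > 1"
  shows "excess k M F \<le> ennreal (k * u0) + ennreal (u0 powr (1 - p)) * (\<integral>\<^sup>+y. ennreal (F y powr p) \<partial>M)"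
proof -
  interpret pair_sigma_finite M lborel ..
  have [measurable]: "(\<lambda>w. indicator {u0..<F (fst w)} (snd w) :: ennreal) \<in> borel_measurable (M \<Otimes>\<^sub>M lborel)"
    unfolding indicator_def atLeastLessThan_iff by measurable
  have "excess k M F \<le> (\<integral>\<^sup>+u. ennreal k * indicator {0..u0} u + indicator {u0..} u * tail M F u \<partial>lborel)"
    unfolding excess_def
  proof (rule nn_integral_mono)
    fix u
    have "min (ennreal k) (tail M F u) \<le> ennreal k + tail M F u"
      by (intro min.coboundedI1 add_increasing2) auto
    then show "indicator {0<..} u * min (ennreal k) (tail M F u) \<le> ennreal k * indicator {0..u0} u + indicator {u0..} u * tail M F u"
      by (auto simp: indicator_def)
  qed
  also have "\<dots> = ennreal (k * u0) + (\<integral>\<^sup>+u. indicator {u0..} u * tail M F u \<partial>lborel)"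
    using u0 k by (subst nn_integral_add) (auto simp: nn_integral_cmult_indicator ennreal_mult)
  also have "(\<integral>\<^sup>+u. indicator {u0..} u * tail M F u \<partial>lborel) = (\<integral>\<^sup>+u. (\<integral>\<^sup>+y. indicator {u0..<F y} u \<partial>M) \<partial>lborel)"
  proof (rule nn_integral_cong)
    fix u
    have "indicator {u0..} u * tail M F u = (\<integral>\<^sup>+y. indicator {u0..} u * indicator {u<..} (F y) \<partial>M)"
      unfolding tail_def by (rule nn_integral_cmult[symmetric]) measurable
    also have "\<dots> = (\<integral>\<^sup>+y. indicator {u0..<F y} u \<partial>M)" by (intro nn_integral_cong) (auto simp: indicator_def)
    finally show "indicator {u0..} u * tail M F u = (\<integral>\<^sup>+y. indicator {u0..<F y} u \<partial>M)" .
  qed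
  also have "\<dots> = (\<integral>\<^sup>+y. (\<integral>\<^sup>+u. indicator {u0..<F y} u \<partial>lborel) \<partial>M)"
    by (rule Fubini') (simp add: case_prod_beta')
  also have "\<dots> \<le> (\<integral>\<^sup>+y. ennreal (u0 powr (1 - p)) * ennreal (F y powr p) \<partial>M)"
  proof (rule nn_integral_mono)
    fix y assume "y \<in> space M"
    show "(\<integral>\<^sup>+u. indicator {u0..<F y} u \<partial>lborel) \<le> ennreal (u0 powr (1 - p)) * ennreal (F y powr p)"
    proof (cases "u0 \<le> F y")
      case True
      have "u0 powr (p - 1) \<le> F y powr (p - 1)" using True u0 p by (intro powr_mono2) auto
      then have "F y * 1 \<le> F y * (u0 powr (1 - p) * F y powr (p - 1))"
        using True u0 by (intro mult_left_mono) (auto simp: powr_diff field_simps)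
      also have "\<dots> = u0 powr (1 - p) * F y powr p" using True u0 by (simp add: powr_diff)
      finally have "F y - u0 \<le> u0 powr (1 - p) * F y powr p" using u0 by simp
      then show ?thesis using True by (simp add: ennreal_mult[symmetric] ennreal_leI)
    qed simp
  qed
  also have "\<dots> = ennreal (u0 powr (1 - p)) * (\<integral>\<^sup>+y. ennreal (F y powr p) \<partial>M)" by (rule nn_integral_cmult) simp
  finally show ?thesis by simp
qed

text \<open>An order preserving map that preserves integrals is a contraction for the
  one-sided \<open>L\<^sup>1\<close> distance (Crandall--Tartar).\<close>
lemma flatten_contraction:
  assumes [measurable]: "F \<in> borel_measurable M" "G \<in> borel_measurable M" "S \<in> sets M"
    and F0: "\<And>y. y \<in> space M \<Longrightarrow> F y \<ge> 0" and G0: "\<And>y. y \<in> space M \<Longrightarrow> G y \<ge> 0"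
    and fin: "(\<integral>\<^sup>+y. ennreal (G y) \<partial>M) < \<top>"
  shows "(\<integral>\<^sup>+y\<in>S. flatten k M F y + excess k M F \<partial>M)
    \<le> (\<integral>\<^sup>+y\<in>S. flatten k M G y + excess k M G \<partial>M) + (\<integral>\<^sup>+y. ennreal (F y - G y) \<partial>M)"
proof -
  \<comment> \<open>Both functions are compared with their pointwise maximum: monotonicity bounds
    \<open>F\<close> by \<open>H\<close> on \<open>S\<close> and \<open>G\<close> by
    \<open>H\<close> off \<open>S\<close>, and preservation of integrals turns the total gap into
    the integral of the positive part of \<open>F - G\<close>.\<close>
  define H where "H y = max (F y) (G y)" for y
  have [measurable]: "H \<in> borel_measurable M" unfolding H_def by measurable
  have H0: "H y \<ge> 0" if "y \<in> space M" for y using F0[OF that] by (simp add: H_def)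
  define V where "V F S = (\<integral>\<^sup>+y\<in>S. flatten k M F y + excess k M F \<partial>M)" for F S
  have V_mono: "V F' S' \<le> V H S'" if "\<And>y. y \<in> space M \<Longrightarrow> F' y \<le> H y" for F' S'
    unfolding V_def by (intro nn_integral_mono mult_right_mono add_mono flatten_mono excess_mono that) auto
  have tot: "V F' S + V F' (space M - S) = (\<integral>\<^sup>+y. ennreal (F' y) \<partial>M)"
    if [measurable]: "F' \<in> borel_measurable M" and "\<And>y. y \<in> space M \<Longrightarrow> F' y \<ge> 0" for F'
  proof -
    have "V F' S + V F' (space M - S) = (\<integral>\<^sup>+y. (flatten k M F' y + excess k M F') * indicator S y
       + (flatten k M F' y + excess k M F') * indicator (space M - S) y \<partial>M)"
      unfolding V_def by (rule nn_integral_add[symmetric]) measurable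
    also have "\<dots> = (\<integral>\<^sup>+y. flatten k M F' y + excess k M F' \<partial>M)"
      by (intro nn_integral_cong) (auto simp: indicator_def)
    also have "\<dots> = (\<integral>\<^sup>+y. flatten k M F' y \<partial>M) + excess k M F'"
      by (subst nn_integral_add) (auto simp: emeasure_space_1)
    finally show ?thesis using flatten_excess[OF that] by simp
  qed
  have "V F S + V G (space M - S) \<le> V H S + V H (space M - S)"
    by (intro add_mono V_mono) (auto simp: H_def)
  also have "\<dots> = (\<integral>\<^sup>+y. ennreal (H y) \<partial>M)" by (rule tot) (auto intro: H0)
  also have "\<dots> = (\<integral>\<^sup>+y. ennreal (G y) + ennreal (F y - G y) \<partial>M)"
  proof (rule nn_integral_cong)
    fix y assume "y \<in> space M"
    then show "ennreal (H y) = ennreal (G y) + ennreal (F y - G y)"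
      using G0[of y] by (cases "F y \<le> G y") (auto simp: H_def max_def ennreal_neg ennreal_plus[symmetric] simp del: ennreal_plus)
  qed
  also have "\<dots> = (\<integral>\<^sup>+y. ennreal (G y) \<partial>M) + (\<integral>\<^sup>+y. ennreal (F y - G y) \<partial>M)" by (rule nn_integral_add) auto
  also have "\<dots> = (V G S + V G (space M - S)) + (\<integral>\<^sup>+y. ennreal (F y - G y) \<partial>M)" by (subst tot) (auto intro: G0)
  finally have "V G (space M - S) + V F S \<le> V G (space M - S) + (V G S + (\<integral>\<^sup>+y. ennreal (F y - G y) \<partial>M))"
    by (simp add: ac_simps)
  moreover have "V G (space M - S) < \<top>"
  proof -
    have "V G (space M - S) \<le> V G S + V G (space M - S)" by simp
    also have "\<dots> < \<top>" using tot[of G] G0 fin by simp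
    finally show ?thesis .
  qed
  ultimately have "V F S \<le> V G S + (\<integral>\<^sup>+y. ennreal (F y - G y) \<partial>M)"
    unfolding ennreal_add_left_cancel_le by auto
  then show ?thesis by (simp add: V_def)
qed

end

section \<open>Private simulation of a kernel\<close>

lemma (in prob_space) density_measure:
  fixes f :: "'a \<Rightarrow> real"
  assumes [measurable]: "f \<in> borel_measurable M" "S \<in> sets M"
    and f1: "(\<integral>\<^sup>+y. ennreal (f y) \<partial>M) = 1"
  shows "prob_space (density M (\<lambda>y. ennreal (f y)))"
    and "emeasure (density M (\<lambda>y. ennreal (f y))) S = ennreal (measure (density M (\<lambda>y. ennreal (f y))) S)"
    and "emeasure (density M (\<lambda>y. ennreal (f y))) S = (\<integral>\<^sup>+y\<in>S. ennreal (f y) \<partial>M)"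
proof -
  show P: "prob_space (density M (\<lambda>y. ennreal (f y)))"
    using f1 by (intro prob_spaceI) (simp add: emeasure_density cong: nn_integral_cong)
  then interpret P: prob_space "density M (\<lambda>y. ennreal (f y))" .
  show "emeasure (density M (\<lambda>y. ennreal (f y))) S = ennreal (measure (density M (\<lambda>y. ennreal (f y))) S)"
    by (rule P.emeasure_eq_measure)
  show "emeasure (density M (\<lambda>y. ennreal (f y))) S = (\<integral>\<^sup>+y\<in>S. ennreal (f y) \<partial>M)"
    by (rule emeasure_density) auto
qed

text \<open>A one-sided bound on two probability densities is two-sided, by complementation.\<close>
lemma (in prob_space) density_measure_close:
  fixes f g :: "'a \<Rightarrow> real"
  assumes [measurable]: "f \<in> borel_measurable M" "g \<in> borel_measurable M" "S \<in> sets M"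
    and f0: "\<And>y. y \<in> space M \<Longrightarrow> f y \<ge> 0" and g0: "\<And>y. y \<in> space M \<Longrightarrow> g y \<ge> 0"
    and f1: "(\<integral>\<^sup>+y. ennreal (f y) \<partial>M) = 1" and g1: "(\<integral>\<^sup>+y. ennreal (g y) \<partial>M) = 1"
    and le: "\<And>y. y \<in> space M \<Longrightarrow> f y \<le> g y + D" and D: "D \<ge> 0"
  shows "\<bar>measure (density M (\<lambda>y. ennreal (f y))) S - measure (density M (\<lambda>y. ennreal (g y))) S\<bar> \<le> D"
proof -
  let ?F = "density M (\<lambda>y. ennreal (f y))" and ?G = "density M (\<lambda>y. ennreal (g y))"
  interpret F: prob_space ?F by (rule density_measure(1)[OF assms(1,3) f1])
  interpret G: prob_space ?G by (rule density_measure(1)[OF assms(2,3) g1])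
  have up: "measure ?F T \<le> measure ?G T + D" if [measurable]: "T \<in> sets M" for T
  proof -
    have "ennreal (measure ?F T) = (\<integral>\<^sup>+y\<in>T. ennreal (f y) \<partial>M)"
      by (simp add: F.emeasure_eq_measure[symmetric] emeasure_density)
    also have "\<dots> \<le> (\<integral>\<^sup>+y. ennreal (g y) * indicator T y + ennreal D \<partial>M)"
      by (intro nn_integral_mono) (use le g0 D in \<open>auto simp: indicator_def simp flip: ennreal_plus intro!: ennreal_leI\<close>)
    also have "\<dots> = (\<integral>\<^sup>+y\<in>T. ennreal (g y) \<partial>M) + ennreal D"
      by (subst nn_integral_add) (auto simp: emeasure_space_1)
    also have "(\<integral>\<^sup>+y\<in>T. ennreal (g y) \<partial>M) = ennreal (measure ?G T)"
      by (simp add: G.emeasure_eq_measure[symmetric] emeasure_density)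
    finally show ?thesis using D by (simp flip: ennreal_plus)
  qed
  have "measure ?F (space M - S) = 1 - measure ?F S" "measure ?G (space M - S) = 1 - measure ?G S"
    using F.prob_compl[of S] G.prob_compl[of S] by auto
  then show ?thesis using up[of S] up[of "space M - S"] by auto
qed

lemma (in prob_space) density_measure_hockey_stick:
  fixes f g :: "'a \<Rightarrow> real"
  assumes [measurable]: "f \<in> borel_measurable M" "g \<in> borel_measurable M" "S \<in> sets M"
    and f0: "\<And>y. y \<in> space M \<Longrightarrow> f y \<ge> 0" and g0: "\<And>y. y \<in> space M \<Longrightarrow> g y \<ge> 0"
    and f1: "(\<integral>\<^sup>+y. ennreal (f y) \<partial>M) = 1" and g1: "(\<integral>\<^sup>+y. ennreal (g y) \<partial>M) = 1"
    and c: "c \<ge> 0" and d: "(\<integral>\<^sup>+y. ennreal (f y - c * g y) \<partial>M) \<le> ennreal d" "d \<ge> 0"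
  shows "measure (density M (\<lambda>y. ennreal (f y))) S - c * measure (density M (\<lambda>y. ennreal (g y))) S \<le> d"
proof -
  let ?F = "density M (\<lambda>y. ennreal (f y))" and ?G = "density M (\<lambda>y. ennreal (g y))"
  interpret F: prob_space ?F by (rule density_measure(1)[OF assms(1,3) f1])
  interpret G: prob_space ?G by (rule density_measure(1)[OF assms(2,3) g1])
  have "ennreal (measure ?F S) = (\<integral>\<^sup>+y\<in>S. ennreal (f y) \<partial>M)"
    by (simp add: F.emeasure_eq_measure[symmetric] emeasure_density)
  also have "\<dots> \<le> (\<integral>\<^sup>+y. ennreal c * (ennreal (g y) * indicator S y) + ennreal (f y - c * g y) \<partial>M)"
  proof (rule nn_integral_mono)
    fix y assume y: "y \<in> space M"
    have "ennreal (f y) \<le> ennreal (c * g y) + ennreal (f y - c * g y)"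
    proof (cases "f y \<le> c * g y")
      case False
      then show ?thesis using g0[OF y] c by (subst ennreal_plus[symmetric]) auto
    qed (auto intro!: add_increasing2 ennreal_leI)
    then show "ennreal (f y) * indicator S y \<le> ennreal c * (ennreal (g y) * indicator S y) + ennreal (f y - c * g y)"
      using g0[OF y] c by (auto simp: indicator_def ennreal_mult)
  qed
  also have "\<dots> = ennreal c * (\<integral>\<^sup>+y\<in>S. ennreal (g y) \<partial>M) + (\<integral>\<^sup>+y. ennreal (f y - c * g y) \<partial>M)"
    by (subst nn_integral_add) (auto simp: nn_integral_cmult)
  also have "\<dots> \<le> ennreal c * (\<integral>\<^sup>+y\<in>S. ennreal (g y) \<partial>M) + ennreal d" using d by (intro add_left_mono)
  also have "(\<integral>\<^sup>+y\<in>S. ennreal (g y) \<partial>M) = ennreal (measure ?G S)"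
    by (simp add: G.emeasure_eq_measure[symmetric] emeasure_density)
  finally have "ennreal (measure ?F S) \<le> ennreal (c * measure ?G S + d)"
    using c d by (simp add: ennreal_mult ennreal_plus)
  then show ?thesis using c d by (subst (asm) ennreal_le_iff) auto
qed

text \<open>Cutting off at \<^term>\<open>L\<close> has a smaller loss than the flattening below, but privacy survives only if
  the loss is controlled for each input.\<close>

lemma cut_off_kernel:
  fixes g :: "'x \<Rightarrow> 'y \<Rightarrow> real" and \<mu> :: "'x measure" and q :: "'y measure"
  assumes "prob_space q" and gm[measurable]: "(\<lambda>(x, y). g x y) \<in> borel_measurable (\<mu> \<Otimes>\<^sub>M q)"
    and g0: "\<And>x y. x \<in> space \<mu> \<Longrightarrow> y \<in> space q \<Longrightarrow> 0 \<le> g x y"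
    and g1: "\<And>x. x \<in> space \<mu> \<Longrightarrow> (\<integral>\<^sup>+y. ennreal (g x y) \<partial>q) = 1"
    and p: "p > 1" and L: "L > 0" and C: "C \<ge> 0"
    and gp: "\<And>x. x \<in> space \<mu> \<Longrightarrow> (\<integral>\<^sup>+y. ennreal (g x y powr p) \<partial>q) \<le> ennreal C"
  shows "\<exists>v. (\<lambda>(x, y). v x y) \<in> borel_measurable (\<mu> \<Otimes>\<^sub>M q) \<and>
    (\<forall>x\<in>space \<mu>. \<forall>y\<in>space q. 0 \<le> v x y \<and> v x y \<le> L + 1) \<and>
    (\<forall>x\<in>space \<mu>. (\<integral>\<^sup>+y. ennreal (v x y) \<partial>q) = 1) \<and>
    (\<forall>x\<in>space \<mu>. \<forall>S\<in>sets q. \<bar>measure (density q (\<lambda>y. ennreal (v x y))) S - measure (density q (\<lambda>y. ennreal (g x y))) S\<bar>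
       \<le> L powr (1 - p) * C)"
proof -
  interpret q: prob_space q by fact
  define D where "D x = enn2real (\<integral>\<^sup>+y. ennreal (g x y - L) \<partial>q)" for x
  \<comment> \<open>The mass cut off is spread evenly over \<open>q\<close>; as it is at most one,
    the density rises to at most \<open>L + 1\<close>.\<close>
  define v where "v x y = min (g x y) L + D x" for x y
  have [measurable]: "D \<in> borel_measurable \<mu>" unfolding D_def by measurable
  have gx[measurable]: "g x \<in> borel_measurable q" if "x \<in> space \<mu>" for x using that by measurable
  have Dle1: "(\<integral>\<^sup>+y. ennreal (g x y - L) \<partial>q) \<le> 1" if x: "x \<in> space \<mu>" for x
    unfolding g1[OF x, symmetric] using L by (intro nn_integral_mono ennreal_leI) auto
  have D: "(\<integral>\<^sup>+y. ennreal (g x y - L) \<partial>q) = ennreal (D x)" if x: "x \<in> space \<mu>" for x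
    using order_le_less_trans[OF Dle1[OF x]] unfolding D_def by (subst ennreal_enn2real) auto
  have D0: "D x \<ge> 0" for x by (simp add: D_def)
  have D1: "D x \<le> 1" if x: "x \<in> space \<mu>" for x using Dle1[OF x] unfolding D[OF x] by simp
  have Dle: "D x \<le> L powr (1 - p) * C" if x: "x \<in> space \<mu>" for x
  proof -
    have "ennreal (D x) \<le> (\<integral>\<^sup>+y. ennreal (L powr (1 - p)) * ennreal (g x y powr p) \<partial>q)"
      unfolding D[OF x, symmetric]
    proof (rule nn_integral_mono)
      fix y assume y: "y \<in> space q"
      show "ennreal (g x y - L) \<le> ennreal (L powr (1 - p)) * ennreal (g x y powr p)"
      proof (cases "L \<le> g x y")
        case True
        have "L powr (p - 1) \<le> g x y powr (p - 1)" using True L p by (intro powr_mono2) auto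
        then have "g x y * 1 \<le> g x y * (L powr (1 - p) * g x y powr (p - 1))"
          using True L by (intro mult_left_mono) (auto simp: powr_diff field_simps)
        also have "\<dots> = L powr (1 - p) * g x y powr p" using True L by (simp add: powr_diff)
        finally have "g x y - L \<le> L powr (1 - p) * g x y powr p" using L by simp
        then show ?thesis by (simp add: ennreal_mult[symmetric] ennreal_leI)
      qed (simp add: ennreal_neg)
    qed
    also have "\<dots> = ennreal (L powr (1 - p)) * (\<integral>\<^sup>+y. ennreal (g x y powr p) \<partial>q)" using x by (intro nn_integral_cmult) measurable
    also have "\<dots> \<le> ennreal (L powr (1 - p)) * ennreal C" by (intro mult_left_mono gp x) auto
    finally show ?thesis using C by (simp add: ennreal_mult[symmetric])
  qed
  have vm: "(\<lambda>(x, y). v x y) \<in> borel_measurable (\<mu> \<Otimes>\<^sub>M q)" unfolding v_def by measurable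
  have vb: "0 \<le> v x y" "v x y \<le> L + 1" if "x \<in> space \<mu>" "y \<in> space q" for x y
    using g0[OF that] D0[of x] D1[OF that(1)] L by (auto simp: v_def intro!: add_mono)
  have v1: "(\<integral>\<^sup>+y. ennreal (v x y) \<partial>q) = 1" if x: "x \<in> space \<mu>" for x
  proof -
    have "(\<integral>\<^sup>+y. ennreal (v x y) \<partial>q) = (\<integral>\<^sup>+y. ennreal (min (g x y) L) + ennreal (D x) \<partial>q)"
      unfolding v_def using g0[OF x] L D0 by (intro nn_integral_cong ennreal_plus) auto
    also have "\<dots> = (\<integral>\<^sup>+y. ennreal (min (g x y) L) \<partial>q) + (\<integral>\<^sup>+y. ennreal (g x y - L) \<partial>q)"
      using x unfolding D[OF x] by (subst nn_integral_add) (auto simp: q.emeasure_space_1)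
    also have "\<dots> = (\<integral>\<^sup>+y. ennreal (min (g x y) L) + ennreal (g x y - L) \<partial>q)"
      using x by (intro nn_integral_add[symmetric]) measurable
    also have "\<dots> = (\<integral>\<^sup>+y. ennreal (g x y) \<partial>q)"
    proof (rule nn_integral_cong)
      fix y assume "y \<in> space q"
      then show "ennreal (min (g x y) L) + ennreal (g x y - L) = ennreal (g x y)"
        using g0[OF x, of y] L by (cases "g x y \<le> L") (auto simp: min_def ennreal_neg ennreal_plus[symmetric] simp del: ennreal_plus)
    qed
    finally show ?thesis using g1[OF x] by simp
  qed
  have "\<bar>measure (density q (\<lambda>y. ennreal (v x y))) S - measure (density q (\<lambda>y. ennreal (g x y))) S\<bar> \<le> L powr (1 - p) * C"
    if x: "x \<in> space \<mu>" and S: "S \<in> sets q" for x S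
  proof -
    have "v x \<in> borel_measurable q" unfolding v_def using x by measurable
    then have "\<bar>measure (density q (\<lambda>y. ennreal (v x y))) S - measure (density q (\<lambda>y. ennreal (g x y))) S\<bar> \<le> D x"
      by (rule q.density_measure_close[OF _ gx[OF x] S]) (use x vb g0 v1 g1 D0 in \<open>auto simp: v_def\<close>)
    then show ?thesis using Dle[OF x] by linarith
  qed
  then show ?thesis using vm vb v1 by blast
qed

text \<open>The loss at \<open>x\<close> is of order \<open>L powr (1 / p - 1)\<close> times the
  \<open>p\<close>-norm of \<open>g x\<close>, hence may be large at some inputs. The privacy
  conclusion is free of this loss, so it is enough later to control it on average.\<close>

lemma flattened_kernel:
  fixes g :: "'x \<Rightarrow> 'y \<Rightarrow> real" and \<mu> :: "'x measure" and q :: "'y measure" and \<phi> :: "'x \<Rightarrow> real"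
  assumes "prob_space q" and gm[measurable]: "(\<lambda>(x, y). g x y) \<in> borel_measurable (\<mu> \<Otimes>\<^sub>M q)"
    and g0: "\<And>x y. x \<in> space \<mu> \<Longrightarrow> y \<in> space q \<Longrightarrow> 0 \<le> g x y"
    and g1: "\<And>x. x \<in> space \<mu> \<Longrightarrow> (\<integral>\<^sup>+y. ennreal (g x y) \<partial>q) = 1"
    and p: "p > 1" and L: "L > 0"
    and gp: "\<And>x. x \<in> space \<mu> \<Longrightarrow> (\<integral>\<^sup>+y. ennreal (g x y powr p) \<partial>q) = ennreal (\<phi> x)"
    and \<phi>0: "\<And>x. x \<in> space \<mu> \<Longrightarrow> 0 < \<phi> x"
  shows "\<exists>v. (\<lambda>(x, y). v x y) \<in> borel_measurable (\<mu> \<Otimes>\<^sub>M q) \<and>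
    (\<forall>x\<in>space \<mu>. \<forall>y\<in>space q. 0 \<le> v x y \<and> v x y \<le> L + 1) \<and>
    (\<forall>x\<in>space \<mu>. (\<integral>\<^sup>+y. ennreal (v x y) \<partial>q) = 1) \<and>
    (\<forall>x\<in>space \<mu>. \<forall>S\<in>sets q. \<bar>measure (density q (\<lambda>y. ennreal (v x y))) S - measure (density q (\<lambda>y. ennreal (g x y))) S\<bar>
       \<le> 2 * L powr (1 / p - 1) * \<phi> x powr (1 / p)) \<and>
    (\<forall>x\<in>space \<mu>. \<forall>x'\<in>space \<mu>. \<forall>c>0. \<forall>d\<ge>0. (\<integral>\<^sup>+y. ennreal (g x y - c * g x' y) \<partial>q) \<le> ennreal d \<longrightarrow>
       (\<forall>S\<in>sets q. measure (density q (\<lambda>y. ennreal (v x y))) S - c * measure (density q (\<lambda>y. ennreal (v x' y))) S \<le> d))"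
proof -
  interpret q: prob_space q by fact
  \<comment> \<open>With this \<open>k\<close> the levels above \<open>L\<close> are removed, by
    \<open>flatten_bounded\<close>.\<close>
  define k where "k = 1 / L"
  have k: "k > 0" using L by (simp add: k_def)
  have gx[measurable]: "g x \<in> borel_measurable q" if "x \<in> space \<mu>" for x using that by measurable
  have tot: "(\<integral>\<^sup>+y. flatten k q (g x) y \<partial>q) + excess k q (g x) = 1" if x: "x \<in> space \<mu>" for x
    using q.flatten_excess[OF gx[OF x], of k] g0[OF x] g1[OF x] by simp
  have e1: "excess k q (g x) \<le> 1" if x: "x \<in> space \<mu>" for x
    unfolding tot[OF x, symmetric] by simp
  have f1: "flatten k q (g x) y \<le> ennreal L" if x: "x \<in> space \<mu>" for x y
    using q.flatten_bounded[OF gx[OF x] g0[OF x] _ k] g1[OF x] by (simp add: k_def)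
  define v where "v x y = enn2real (flatten k q (g x) y + excess k q (g x))" for x y
  have v: "ennreal (v x y) = flatten k q (g x) y + excess k q (g x)" if x: "x \<in> space \<mu>" for x y
  proof -
    have "flatten k q (g x) y + excess k q (g x) \<le> ennreal L + 1" by (intro add_mono f1 e1 x)
    also have "\<dots> < \<top>" by simp
    finally show ?thesis unfolding v_def by (subst ennreal_enn2real) auto
  qed
  have vm[measurable]: "(\<lambda>(x, y). v x y) \<in> borel_measurable (\<mu> \<Otimes>\<^sub>M q)"
  proof -
    have [measurable]: "(\<lambda>z. flatten k q (g (fst z)) (snd z)) \<in> borel_measurable (\<mu> \<Otimes>\<^sub>M q)"
      using q.flatten_measurable[OF gm, of k] by (simp add: case_prod_beta')
    have [measurable]: "(\<lambda>x. excess k q (g x)) \<in> borel_measurable \<mu>" by (rule q.excess_measurable[OF gm])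
    show ?thesis unfolding v_def case_prod_beta' by measurable
  qed
  have vx[measurable]: "v x \<in> borel_measurable q" if "x \<in> space \<mu>" for x using that by measurable
  have v0: "0 \<le> v x y" for x y by (simp add: v_def)
  have vL: "v x y \<le> L + 1" if x: "x \<in> space \<mu>" for x y
  proof -
    have "ennreal (v x y) \<le> ennreal L + ennreal 1" unfolding v[OF x] using f1[OF x] e1[OF x] by (intro add_mono) auto
    also have "\<dots> = ennreal (L + 1)" using L by (subst ennreal_plus) auto
    finally show ?thesis using L by (subst (asm) ennreal_le_iff) auto
  qed
  have v1: "(\<integral>\<^sup>+y. ennreal (v x y) \<partial>q) = 1" if x: "x \<in> space \<mu>" for x
    unfolding v[OF x] using q.flatten_measurable1[OF gx[OF x]] tot[OF x] by (subst nn_integral_add) (auto simp: q.emeasure_space_1)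
  have ex: "excess k q (g x) \<le> ennreal (2 * L powr (1 / p - 1) * \<phi> x powr (1 / p))" if x: "x \<in> space \<mu>" for x
  proof -
    \<comment> \<open>This split point makes the two terms of \<open>excess_bound\<close> equal,
      hence the factor 2.\<close>
    define u0 where "u0 = (\<phi> x / k) powr (1 / p)"
    have u0: "u0 > 0" using \<phi>0[OF x] k by (simp add: u0_def)
    have "excess k q (g x) \<le> ennreal (k * u0) + ennreal (u0 powr (1 - p)) * ennreal (\<phi> x)"
      using q.excess_bound[OF gx[OF x] g0[OF x] u0 k p] gp[OF x] by simp
    also have "\<dots> = ennreal (k * u0 + u0 powr (1 - p) * \<phi> x)"
      using u0 k \<phi>0[OF x] by (simp add: ennreal_mult ennreal_plus)
    also have "k * u0 + u0 powr (1 - p) * \<phi> x = 2 * L powr (1 / p - 1) * \<phi> x powr (1 / p)"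
    proof -
      have "k = L powr - 1" using L by (simp add: k_def powr_minus field_simps)
      have "\<phi> x / k = \<phi> x * L" by (simp add: k_def)
      then have 1: "u0 = \<phi> x powr (1 / p) * L powr (1 / p)" using L \<phi>0[OF x] by (simp add: u0_def powr_mult)
      have "k * u0 = (L powr - 1 * L powr (1 / p)) * \<phi> x powr (1 / p)" using \<open>k = L powr - 1\<close> 1 by simp
      then have 2: "k * u0 = L powr (1 / p - 1) * \<phi> x powr (1 / p)" using L by (simp add: powr_diff)
      have "(1 / p) * (1 - p) = 1 / p - 1" using p by (simp add: field_simps)
      then have "u0 powr (1 - p) = \<phi> x powr (1 / p - 1) * L powr (1 / p - 1)"
        unfolding 1 using L \<phi>0[OF x] by (simp add: powr_mult powr_powr)
      moreover have "\<phi> x powr (1 / p - 1) * \<phi> x = \<phi> x powr (1 / p)" using \<phi>0[OF x] by (simp add: powr_diff)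
      ultimately have "u0 powr (1 - p) * \<phi> x = L powr (1 / p - 1) * \<phi> x powr (1 / p)" by (simp add: mult.commute mult.left_commute)
      with 2 show ?thesis by simp
    qed
    finally show ?thesis .
  qed
  have close: "\<bar>measure (density q (\<lambda>y. ennreal (v x y))) S - measure (density q (\<lambda>y. ennreal (g x y))) S\<bar>
       \<le> 2 * L powr (1 / p - 1) * \<phi> x powr (1 / p)" if x: "x \<in> space \<mu>" and S: "S \<in> sets q" for x S
  proof (rule q.density_measure_close[OF vx[OF x] gx[OF x] S])
    fix y assume y: "y \<in> space q"
    have "ennreal (v x y) \<le> ennreal (g x y) + ennreal (2 * L powr (1 / p - 1) * \<phi> x powr (1 / p))"
      unfolding v[OF x] by (intro add_mono ex x q.flatten_le gx g0 y)
    also have "\<dots> = ennreal (g x y + 2 * L powr (1 / p - 1) * \<phi> x powr (1 / p))" using g0[OF x y] by (subst ennreal_plus) auto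
    finally show "v x y \<le> g x y + 2 * L powr (1 / p - 1) * \<phi> x powr (1 / p)"
      using g0[OF x y] by (subst (asm) ennreal_le_iff) auto
  qed (use x g0 g1 v0 v1 in auto)
  have priv: "measure (density q (\<lambda>y. ennreal (v x y))) S - c * measure (density q (\<lambda>y. ennreal (v x' y))) S \<le> d"
    if x: "x \<in> space \<mu>" "x' \<in> space \<mu>" and c: "c > 0" and d: "d \<ge> 0" "(\<integral>\<^sup>+y. ennreal (g x y - c * g x' y) \<partial>q) \<le> ennreal d"
      and S[measurable]: "S \<in> sets q" for x x' c d S
  proof -
    have meas: "emeasure (density q (\<lambda>y. ennreal (v x y))) S = ennreal (measure (density q (\<lambda>y. ennreal (v x y))) S)"
      "emeasure (density q (\<lambda>y. ennreal (v x y))) S = (\<integral>\<^sup>+y\<in>S. ennreal (v x y) \<partial>q)" if x: "x \<in> space \<mu>" for x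
      using q.density_measure(2,3)[OF vx[OF x] S v1[OF x]] by auto
    have cg: "(\<lambda>y. c * g x' y) \<in> borel_measurable q" using x by measurable
    have [measurable]: "flatten k q (g x') \<in> borel_measurable q" by (rule q.flatten_measurable1[OF gx[OF x(2)]])
    have "ennreal (measure (density q (\<lambda>y. ennreal (v x y))) S) = (\<integral>\<^sup>+y\<in>S. flatten k q (g x) y + excess k q (g x) \<partial>q)"
      using meas[OF x(1)] v[OF x(1)] by simp
    \<comment> \<open>The contraction compares \<open>g x\<close> with \<open>c * g x'\<close>,
      which has mass \<open>c\<close>; homogeneity takes \<open>c\<close> out again in the next
      line.\<close>
    also have "\<dots> \<le> (\<integral>\<^sup>+y\<in>S. flatten k q (\<lambda>y. c * g x' y) y + excess k q (\<lambda>y. c * g x' y) \<partial>q) + (\<integral>\<^sup>+y. ennreal (g x y - c * g x' y) \<partial>q)"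
    proof (rule q.flatten_contraction[OF gx[OF x(1)] cg S])
      show "(\<integral>\<^sup>+y. ennreal (c * g x' y) \<partial>q) < \<top>"
        using x c g1[OF x(2)] g0[OF x(2)] by (simp add: ennreal_mult nn_integral_cmult cong: nn_integral_cong)
    qed (use x c g0 in auto)
    also have "(\<integral>\<^sup>+y\<in>S. flatten k q (\<lambda>y. c * g x' y) y + excess k q (\<lambda>y. c * g x' y) \<partial>q)
       = (\<integral>\<^sup>+y. ennreal c * ((flatten k q (g x') y + excess k q (g x')) * indicator S y) \<partial>q)"
      by (simp add: q.flatten_scale[OF gx[OF x(2)] c] q.excess_scale[OF gx[OF x(2)] c] distrib_left mult.assoc distrib_right)
    also have "\<dots> = ennreal c * (\<integral>\<^sup>+y\<in>S. flatten k q (g x') y + excess k q (g x') \<partial>q)"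
      by (rule nn_integral_cmult) measurable
    also have "(\<integral>\<^sup>+y\<in>S. flatten k q (g x') y + excess k q (g x') \<partial>q) = ennreal (measure (density q (\<lambda>y. ennreal (v x' y))) S)"
      using meas[OF x(2)] v[OF x(2)] by simp
    also have "ennreal c * \<dots> + (\<integral>\<^sup>+y. ennreal (g x y - c * g x' y) \<partial>q) \<le> ennreal c * ennreal (measure (density q (\<lambda>y. ennreal (v x' y))) S) + ennreal d"
      by (intro add_left_mono d)
    also have "\<dots> = ennreal (c * measure (density q (\<lambda>y. ennreal (v x' y))) S + d)"
      using c d by (simp add: ennreal_mult ennreal_plus)
    finally show ?thesis using c d by (subst (asm) ennreal_le_iff) auto
  qed
  show ?thesis using vm v0 vL v1 close priv by (intro exI[of _ v]) blast
qed

section \<open>Integration over the input\<close>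

lemma slice_measurable:
  assumes V: "V \<in> \<mu> \<rightarrow>\<^sub>M prob_algebra q" and E: "E \<in> sets (\<mu> \<Otimes>\<^sub>M q)"
  shows "(\<lambda>x. measure (V x) (Pair x -` E)) \<in> borel_measurable \<mu>"
    and "prob_space \<mu> \<Longrightarrow> integrable \<mu> (\<lambda>x. measure (V x) (Pair x -` E))"
proof -
  have "Sigma (space \<mu>) (\<lambda>x. Pair x -` E) = E" using sets.sets_into_space[OF E] by (auto simp: space_pair_measure)
  then have "Sigma (space \<mu>) (\<lambda>x. Pair x -` E) \<in> sets (\<mu> \<Otimes>\<^sub>M q)" using E by simp
  from measure_measurable_prob_algebra2[OF this V]
  show m: "(\<lambda>x. measure (V x) (Pair x -` E)) \<in> borel_measurable \<mu>" .
  assume "prob_space \<mu>"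
  then interpret prob_space \<mu> .
  show "integrable \<mu> (\<lambda>x. measure (V x) (Pair x -` E))"
    using measurable_space[OF V] m
    by (intro integrable_const_bound[of _ 1]) (auto intro!: AE_I2 prob_space.prob_le_1 simp: space_prob_algebra)
qed

lemma slice_close:
  assumes "prob_space \<mu>" and V: "V \<in> \<mu> \<rightarrow>\<^sub>M prob_algebra q" and W: "W \<in> \<mu> \<rightarrow>\<^sub>M prob_algebra q"
    and E: "E \<in> sets (\<mu> \<Otimes>\<^sub>M q)"
    and close: "\<And>x S. x \<in> space \<mu> \<Longrightarrow> S \<in> sets q \<Longrightarrow> \<bar>measure (V x) S - measure (W x) S\<bar> \<le> l x"
    and l: "(\<integral>\<^sup>+x. ennreal (l x) \<partial>\<mu>) \<le> ennreal \<tau>" and \<tau>: "\<tau> \<ge> 0"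
  shows "\<bar>(\<integral>x. measure (V x) (Pair x -` E) \<partial>\<mu>) - (\<integral>x. measure (W x) (Pair x -` E) \<partial>\<mu>)\<bar> \<le> \<tau>"
proof -
  note iV = slice_measurable(2)[OF V E assms(1)] and iW = slice_measurable(2)[OF W E assms(1)]
  have "ennreal \<bar>(\<integral>x. measure (V x) (Pair x -` E) \<partial>\<mu>) - (\<integral>x. measure (W x) (Pair x -` E) \<partial>\<mu>)\<bar>
     = ennreal (norm (\<integral>x. measure (V x) (Pair x -` E) - measure (W x) (Pair x -` E) \<partial>\<mu>))" using iV iW by simp
  also have "\<dots> \<le> (\<integral>\<^sup>+x. ennreal (norm (measure (V x) (Pair x -` E) - measure (W x) (Pair x -` E))) \<partial>\<mu>)"
    using iV iW by (intro integral_norm_bound_ennreal) auto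
  also have "\<dots> \<le> (\<integral>\<^sup>+x. ennreal (l x) \<partial>\<mu>)"
    using close sets_Pair1[OF E] by (intro nn_integral_mono ennreal_leI) auto
  also have "\<dots> \<le> ennreal \<tau>" by (rule l)
  finally show ?thesis using \<tau> by simp
qed

text \<open>The alternatives in \<open>cases\<close> are a loss controlled at each input, served by
  \<open>cut_off_kernel\<close>, and a loss controlled on average, served by
  \<open>flattened_kernel\<close>. The former moves every output law by at most
  \<open>\<tau>\<close> and so costs \<open>(1 + c) * \<tau>\<close> in privacy; the latter costs
  nothing there, and both are brought under the weaker bound.\<close>

lemma private_simulation:
  fixes g :: "'x \<Rightarrow> 'y \<Rightarrow> real" and \<mu> :: "'x measure" and q :: "'y measure" and \<phi> :: "'x \<Rightarrow> real"
  defines "W \<equiv> \<lambda>x. density q (\<lambda>y. ennreal (g x y))"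
  assumes \<mu>: "prob_space \<mu>" and q: "prob_space q" and gm[measurable]: "(\<lambda>(x, y). g x y) \<in> borel_measurable (\<mu> \<Otimes>\<^sub>M q)"
    and g0: "\<And>x y. x \<in> space \<mu> \<Longrightarrow> y \<in> space q \<Longrightarrow> 0 \<le> g x y"
    and g1: "\<And>x. x \<in> space \<mu> \<Longrightarrow> (\<integral>\<^sup>+y. ennreal (g x y) \<partial>q) = 1"
    and p: "p > 1" and L: "L > 0" and M: "M \<ge> 1" and \<eta>: "\<eta> > 0" and c: "c > 0" and d: "d \<ge> 0" and \<tau>: "\<tau> \<ge> 0"
    and gp: "\<And>x. x \<in> space \<mu> \<Longrightarrow> (\<integral>\<^sup>+y. ennreal (g x y powr p) \<partial>q) = ennreal (\<phi> x)"
    and \<phi>0: "\<And>x. x \<in> space \<mu> \<Longrightarrow> 0 < \<phi> x"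
    and cases: "(\<forall>x\<in>space \<mu>. L powr (1 - p) * \<phi> x \<le> \<tau>) \<or>
      (\<integral>\<^sup>+x. ennreal (2 * L powr (1 / p - 1) * \<phi> x powr (1 / p)) \<partial>\<mu>) \<le> ennreal \<tau>"
  shows "\<exists>N enc dec. code_pair M N \<mu> q enc dec \<and>
    (\<forall>x\<in>space \<mu>. \<forall>x'\<in>space \<mu>. (\<integral>\<^sup>+y. ennreal (g x y - c * g x' y) \<partial>q) \<le> ennreal d \<longrightarrow>
       (\<forall>S\<in>sets q. measure (code_kernel N enc dec x) S - c * measure (code_kernel N enc dec x') S
          \<le> d + (1 + c) * (\<tau> + exp (- real M / (L + 1)) + 3 * \<eta>))) \<and>
    (\<forall>E\<in>sets (\<mu> \<Otimes>\<^sub>M q). \<bar>(\<integral>x. measure (code_kernel N enc dec x) (Pair x -` E) \<partial>\<mu>) - (\<integral>x. measure (W x) (Pair x -` E) \<partial>\<mu>)\<bar>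
       \<le> \<tau> + exp (- real M / (L + 1)) + 3 * \<eta>)"
proof -
  interpret q: prob_space q by fact
  interpret \<mu>: prob_space \<mu> by fact
  have gx[measurable]: "g x \<in> borel_measurable q" if "x \<in> space \<mu>" for x using that by measurable
  have W: "W \<in> \<mu> \<rightarrow>\<^sub>M prob_algebra q" unfolding W_def by (rule prob_algebra_density[OF q _ g1]) measurable
  have "\<exists>v. (\<lambda>(x, y). v x y) \<in> borel_measurable (\<mu> \<Otimes>\<^sub>M q) \<and>
    (\<forall>x\<in>space \<mu>. \<forall>y\<in>space q. 0 \<le> v x y \<and> v x y \<le> L + 1) \<and>
    (\<forall>x\<in>space \<mu>. (\<integral>\<^sup>+y. ennreal (v x y) \<partial>q) = 1) \<and>
    (\<exists>l. (\<forall>x\<in>space \<mu>. \<forall>S\<in>sets q. \<bar>measure (density q (\<lambda>y. ennreal (v x y))) S - measure (W x) S\<bar> \<le> l x) \<and>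
       (\<integral>\<^sup>+x. ennreal (l x) \<partial>\<mu>) \<le> ennreal \<tau>) \<and>
    (\<forall>x\<in>space \<mu>. \<forall>x'\<in>space \<mu>. (\<integral>\<^sup>+y. ennreal (g x y - c * g x' y) \<partial>q) \<le> ennreal d \<longrightarrow>
       (\<forall>S\<in>sets q. measure (density q (\<lambda>y. ennreal (v x y))) S - c * measure (density q (\<lambda>y. ennreal (v x' y))) S \<le> d + (1 + c) * \<tau>))"
    using cases
  proof
    assume A: "\<forall>x\<in>space \<mu>. L powr (1 - p) * \<phi> x \<le> \<tau>"
    have "(\<integral>\<^sup>+y. ennreal (g x y powr p) \<partial>q) \<le> ennreal (L powr (p - 1) * \<tau>)" if x: "x \<in> space \<mu>" for x
    proof -
      have "L powr (p - 1) * (L powr (1 - p) * \<phi> x) \<le> L powr (p - 1) * \<tau>" using A x by (intro mult_left_mono) auto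
      then have "\<phi> x \<le> L powr (p - 1) * \<tau>" using L by (simp add: mult.assoc[symmetric] powr_add[symmetric])
      then show ?thesis unfolding gp[OF x] by (rule ennreal_leI)
    qed
    from cut_off_kernel[OF q gm g0 g1 p L _ this] \<tau>
    obtain v where vm: "(\<lambda>(x, y). v x y) \<in> borel_measurable (\<mu> \<Otimes>\<^sub>M q)"
      and vb: "\<forall>x\<in>space \<mu>. \<forall>y\<in>space q. 0 \<le> v x y \<and> v x y \<le> L + 1" and v1: "\<forall>x\<in>space \<mu>. (\<integral>\<^sup>+y. ennreal (v x y) \<partial>q) = 1"
      and vc: "\<And>x S. x \<in> space \<mu> \<Longrightarrow> S \<in> sets q \<Longrightarrow> \<bar>measure (density q (\<lambda>y. ennreal (v x y))) S - measure (W x) S\<bar>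
       \<le> L powr (1 - p) * (L powr (p - 1) * \<tau>)" unfolding W_def by auto
    \<comment> \<open>The moment bound passed to \<open>cut_off_kernel\<close> was chosen so that
      its loss is exactly \<open>\<tau>\<close>.\<close>
    have "L powr (1 - p) * (L powr (p - 1) * \<tau>) = \<tau>" using L by (simp add: mult.assoc[symmetric] powr_add[symmetric])
    note vc = vc[unfolded this]
    have "measure (density q (\<lambda>y. ennreal (v x y))) S - c * measure (density q (\<lambda>y. ennreal (v x' y))) S \<le> d + (1 + c) * \<tau>"
      if x: "x \<in> space \<mu>" "x' \<in> space \<mu>" and hs: "(\<integral>\<^sup>+y. ennreal (g x y - c * g x' y) \<partial>q) \<le> ennreal d" and S: "S \<in> sets q" for x x' S
    proof -
      have "measure (W x) S - c * measure (W x') S \<le> d" unfolding W_def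
        by (rule q.density_measure_hockey_stick[OF gx[OF x(1)] gx[OF x(2)] S g0[OF x(1)] g0[OF x(2)] g1[OF x(1)] g1[OF x(2)] _ hs d])
           (use c in auto)
      moreover have "c * (measure (W x') S - \<tau>) \<le> c * measure (density q (\<lambda>y. ennreal (v x' y))) S"
        using vc[OF x(2) S] c by (intro mult_left_mono) (auto simp: abs_le_iff)
      ultimately show ?thesis using vc[OF x(1) S] by (simp add: algebra_simps abs_le_iff)
    qed
    then show ?thesis using vm vb v1 vc
      by (intro exI[of _ v] conjI exI[of _ "\<lambda>_. \<tau>"]) (auto simp: \<mu>.emeasure_space_1)
  next
    assume B: "(\<integral>\<^sup>+x. ennreal (2 * L powr (1 / p - 1) * \<phi> x powr (1 / p)) \<partial>\<mu>) \<le> ennreal \<tau>"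
    from flattened_kernel[OF q gm g0 g1 p L gp \<phi>0]
    obtain v where v: "(\<lambda>(x, y). v x y) \<in> borel_measurable (\<mu> \<Otimes>\<^sub>M q)"
      "\<forall>x\<in>space \<mu>. \<forall>y\<in>space q. 0 \<le> v x y \<and> v x y \<le> L + 1" "\<forall>x\<in>space \<mu>. (\<integral>\<^sup>+y. ennreal (v x y) \<partial>q) = 1"
      "\<forall>x\<in>space \<mu>. \<forall>S\<in>sets q. \<bar>measure (density q (\<lambda>y. ennreal (v x y))) S - measure (W x) S\<bar>
       \<le> 2 * L powr (1 / p - 1) * \<phi> x powr (1 / p)"
      and vd: "\<And>x x' c d S. x \<in> space \<mu> \<Longrightarrow> x' \<in> space \<mu> \<Longrightarrow> c > 0 \<Longrightarrow> d \<ge> 0 \<Longrightarrow> (\<integral>\<^sup>+y. ennreal (g x y - c * g x' y) \<partial>q) \<le> ennreal d \<Longrightarrow>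
       S \<in> sets q \<Longrightarrow> measure (density q (\<lambda>y. ennreal (v x y))) S - c * measure (density q (\<lambda>y. ennreal (v x' y))) S \<le> d"
      unfolding W_def by blast
    have "measure (density q (\<lambda>y. ennreal (v x y))) S - c * measure (density q (\<lambda>y. ennreal (v x' y))) S \<le> d + (1 + c) * \<tau>"
      if "x \<in> space \<mu>" "x' \<in> space \<mu>" "(\<integral>\<^sup>+y. ennreal (g x y - c * g x' y) \<partial>q) \<le> ennreal d" "S \<in> sets q" for x x' S
      using vd[OF that(1,2) c d that(3,4)] c \<tau> mult_nonneg_nonneg[of "1 + c" \<tau>] by linarith
    then show ?thesis using v B
      by (intro exI[of _ v] conjI exI[of _ "\<lambda>x. 2 * L powr (1 / p - 1) * \<phi> x powr (1 / p)"]) auto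
  qed
  then obtain v l where vm[measurable]: "(\<lambda>(x, y). v x y) \<in> borel_measurable (\<mu> \<Otimes>\<^sub>M q)"
    and vb: "\<And>x y. x \<in> space \<mu> \<Longrightarrow> y \<in> space q \<Longrightarrow> 0 \<le> v x y" "\<And>x y. x \<in> space \<mu> \<Longrightarrow> y \<in> space q \<Longrightarrow> v x y \<le> L + 1"
    and v1: "\<And>x. x \<in> space \<mu> \<Longrightarrow> (\<integral>\<^sup>+y. ennreal (v x y) \<partial>q) = 1"
    and vl: "\<And>x S. x \<in> space \<mu> \<Longrightarrow> S \<in> sets q \<Longrightarrow> \<bar>measure (density q (\<lambda>y. ennreal (v x y))) S - measure (W x) S\<bar> \<le> l x"
    and l: "(\<integral>\<^sup>+x. ennreal (l x) \<partial>\<mu>) \<le> ennreal \<tau>"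
    and vp: "\<And>x x'. x \<in> space \<mu> \<Longrightarrow> x' \<in> space \<mu> \<Longrightarrow> (\<integral>\<^sup>+y. ennreal (g x y - c * g x' y) \<partial>q) \<le> ennreal d \<Longrightarrow>
       \<forall>S\<in>sets q. measure (density q (\<lambda>y. ennreal (v x y))) S - c * measure (density q (\<lambda>y. ennreal (v x' y))) S \<le> d + (1 + c) * \<tau>"
    by blast
  have V: "(\<lambda>x. density q (\<lambda>y. ennreal (v x y))) \<in> \<mu> \<rightarrow>\<^sub>M prob_algebra q"
    by (rule prob_algebra_density[OF q _ v1]) measurable
  \<comment> \<open>Both constructions return a density bounded by \<open>L + 1\<close>, which
    becomes the \<open>\<theta>\<close> of the simulation.\<close>
  have "L + 1 \<ge> 1" using L by simp
  from channel_simulation[OF \<mu> q vm vb v1 this M \<eta>]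
  obtain N enc dec where cp: "code_pair M N \<mu> q enc dec"
    and kp: "\<And>x x' c d S. x \<in> space \<mu> \<Longrightarrow> x' \<in> space \<mu> \<Longrightarrow> c \<ge> 0 \<Longrightarrow> 
       \<forall>S\<in>sets q. measure (density q (\<lambda>y. ennreal (v x y))) S - c * measure (density q (\<lambda>y. ennreal (v x' y))) S \<le> d \<Longrightarrow> S \<in> sets q \<Longrightarrow>
       measure (code_kernel N enc dec x) S - c * measure (code_kernel N enc dec x') S \<le> d + (1 + c) * (exp (- real M / (L + 1)) + \<eta>)"
    and ke: "\<And>E. E \<in> sets (\<mu> \<Otimes>\<^sub>M q) \<Longrightarrow> \<bar>(\<integral>x. measure (density q (\<lambda>y. ennreal (v x y))) (Pair x -` E) \<partial>\<mu>) - (\<integral>x. measure (code_kernel N enc dec x) (Pair x -` E) \<partial>\<mu>)\<bar>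
       \<le> exp (- real M / (L + 1)) + 3 * \<eta>"
    by blast
  have "measure (code_kernel N enc dec x) S - c * measure (code_kernel N enc dec x') S
          \<le> d + (1 + c) * (\<tau> + exp (- real M / (L + 1)) + 3 * \<eta>)"
    if x: "x \<in> space \<mu>" "x' \<in> space \<mu>" and hs: "(\<integral>\<^sup>+y. ennreal (g x y - c * g x' y) \<partial>q) \<le> ennreal d" and S: "S \<in> sets q" for x x' S
  proof -
    have "measure (code_kernel N enc dec x) S - c * measure (code_kernel N enc dec x') S
      \<le> d + (1 + c) * \<tau> + (1 + c) * (exp (- real M / (L + 1)) + \<eta>)"
      using kp[OF x _ vp[OF x hs] S] c by simp
    also have "\<dots> \<le> d + (1 + c) * \<tau> + (1 + c) * (exp (- real M / (L + 1)) + 3 * \<eta>)"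
      using c \<eta> by (intro add_left_mono mult_left_mono) auto
    finally show ?thesis by (simp add: algebra_simps)
  qed
  moreover have "\<bar>(\<integral>x. measure (code_kernel N enc dec x) (Pair x -` E) \<partial>\<mu>) - (\<integral>x. measure (W x) (Pair x -` E) \<partial>\<mu>)\<bar>
       \<le> \<tau> + exp (- real M / (L + 1)) + 3 * \<eta>" if E: "E \<in> sets (\<mu> \<Otimes>\<^sub>M q)" for E
    using ke[OF E] slice_close[OF \<mu> V W E vl l \<tau>] by linarith
  ultimately show ?thesis using cp by blast
qed

section \<open>Densities of memoryless blocks\<close>

lemma nn_integral_PiM_prod:
  fixes n :: nat
  assumes "prob_space q" and F: "\<And>i. i < n \<Longrightarrow> F i \<in> borel_measurable q"
  shows "(\<integral>\<^sup>+ys. (\<Prod>i<n. F i (ys i)) \<partial>PiM {..<n} (\<lambda>_. q)) = (\<Prod>i<n. \<integral>\<^sup>+y. F i y \<partial>q)"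
proof -
  interpret product_sigma_finite "\<lambda>_::nat. q"
    unfolding product_sigma_finite_def using \<open>prob_space q\<close> by (simp add: prob_space_imp_sigma_finite)
  show ?thesis by (rule product_nn_integral_prod) (use F in auto)
qed

lemma prod_kernel_measurable:
  fixes n :: nat
  assumes [measurable]: "(\<lambda>(x, y). g x y) \<in> borel_measurable (\<mu> \<Otimes>\<^sub>M q)"
  shows "(\<lambda>(xs, ys). \<Prod>i<n. g (xs i) (ys i) :: real) \<in> borel_measurable (PiM {..<n} (\<lambda>_. \<mu>) \<Otimes>\<^sub>M PiM {..<n} (\<lambda>_. q))"
  unfolding case_prod_beta' by (intro borel_measurable_prod) measurable

text \<open>The power of \<open>Q\<close> lives on sequences of pairs, the density on pairs of
  sequences. The two laws are compared on boxes in the space of sequences of pairs, where both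
  factor over coordinates, and the result is carried back along the bijection.\<close>

lemma iid_joint_density:
  fixes g :: "'a \<Rightarrow> 'b \<Rightarrow> real" and n :: nat
  assumes \<mu>: "prob_space \<mu>" and q: "prob_space q" and gm[measurable]: "(\<lambda>(x, y). g x y) \<in> borel_measurable (\<mu> \<Otimes>\<^sub>M q)"
    and g0: "\<And>x y. x \<in> space \<mu> \<Longrightarrow> y \<in> space q \<Longrightarrow> 0 \<le> g x y"
    and Qp: "prob_space Q" and Q: "Q = density (\<mu> \<Otimes>\<^sub>M q) (\<lambda>(x, y). ennreal (g x y))"
    and MX: "sets \<mu> = sets MX" and MY: "sets q = sets MY"
  shows "iid_joint n MX MY Q = density (PiM {..<n} (\<lambda>_. \<mu>) \<Otimes>\<^sub>M PiM {..<n} (\<lambda>_. q))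
    (\<lambda>(xs, ys). ennreal (\<Prod>i<n. g (xs i) (ys i)))"
proof -
  interpret \<mu>: prob_space \<mu> by fact
  interpret q: prob_space q by fact
  interpret Q: prob_space Q by fact
  interpret PQ: product_sigma_finite "\<lambda>_::nat. Q"
    unfolding product_sigma_finite_def using Qp by (simp add: prob_space_imp_sigma_finite)
  define \<mu>n where "\<mu>n = PiM {..<n} (\<lambda>_. \<mu>)"
  define qn where "qn = PiM {..<n} (\<lambda>_. q)"
  interpret \<mu>n: prob_space \<mu>n unfolding \<mu>n_def by (intro prob_space_PiM \<mu>)
  interpret qn: prob_space qn unfolding qn_def by (intro prob_space_PiM q)
  have setsQ[measurable_cong]: "sets Q = sets (\<mu> \<Otimes>\<^sub>M q)" by (simp add: Q)
  have Qe: "emeasure Q A = (\<integral>\<^sup>+x. \<integral>\<^sup>+y. ennreal (g x y) * indicator A (x, y) \<partial>q \<partial>\<mu>)" if [measurable]: "A \<in> sets Q" for A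
    unfolding Q using that by (subst emeasure_density) (auto simp: setsQ q.nn_integral_fst[symmetric])
  define G where "G z = (case z of (xs, ys) \<Rightarrow> \<Prod>i<n. g (xs i) (ys i))" for z
  have Gm[measurable]: "G \<in> borel_measurable (\<mu>n \<Otimes>\<^sub>M qn)"
    unfolding G_def \<mu>n_def qn_def by (rule prod_kernel_measurable[OF gm])
  define J where "J = density (\<mu>n \<Otimes>\<^sub>M qn) (\<lambda>z. ennreal (G z))"
  \<comment> \<open>Sequences are extensional on \<open>{..<n}\<close>, so \<open>unzip\<close>
    undoes \<open>zip\<close> only on the space of \<open>J\<close>, which is what the final change
    of variables needs.\<close>
  define zip where "zip z = (\<lambda>i\<in>{..<n}. (fst z i, snd z i))" for z :: "(nat \<Rightarrow> 'a) \<times> (nat \<Rightarrow> 'b)"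
  define unzip where "unzip z = ((\<lambda>i\<in>{..<n}. fst (z i)), (\<lambda>i\<in>{..<n}. snd (z i)))" for z :: "nat \<Rightarrow> 'a \<times> 'b"
  have setsJ[measurable_cong]: "sets J = sets (\<mu>n \<Otimes>\<^sub>M qn)" by (simp add: J_def)
  have zm[measurable]: "zip \<in> \<mu>n \<Otimes>\<^sub>M qn \<rightarrow>\<^sub>M PiM {..<n} (\<lambda>_. Q)"
    unfolding zip_def \<mu>n_def qn_def by measurable
  have um[measurable]: "unzip \<in> PiM {..<n} (\<lambda>_. Q) \<rightarrow>\<^sub>M \<mu>n \<Otimes>\<^sub>M qn"
    unfolding unzip_def \<mu>n_def qn_def by measurable
  have "distr J (PiM {..<n} (\<lambda>_. Q)) zip = PiM {..<n} (\<lambda>_. Q)"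
  proof (rule PQ.PiM_eqI)
    fix A assume A: "\<And>i. i \<in> {..<n} \<Longrightarrow> A i \<in> sets Q"
    have Am: "PiE {..<n} A \<in> sets (PiM {..<n} (\<lambda>_. Q))" by (intro sets_PiM_I_finite) (use A in auto)
    have F: "(\<lambda>(x, y). ennreal (g x y) * indicator (A i) (x, y)) \<in> borel_measurable (\<mu> \<Otimes>\<^sub>M q)" if "i < n" for i
    proof -
      have [measurable]: "A i \<in> sets (\<mu> \<Otimes>\<^sub>M q)" using A[of i] that by (simp add: setsQ)
      show ?thesis by measurable
    qed
    have F1: "(\<lambda>y. ennreal (g x y) * indicator (A i) (x, y)) \<in> borel_measurable q" if "i < n" "x \<in> space \<mu>" for i x
      using measurable_compose[OF measurable_Pair1'[OF that(2)] F[OF that(1)]] by simp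
    have F2: "(\<lambda>x. \<integral>\<^sup>+y. ennreal (g x y) * indicator (A i) (x, y) \<partial>q) \<in> borel_measurable \<mu>" if "i < n" for i
      by (rule q.borel_measurable_nn_integral) (use F[OF that] in simp)
    \<comment> \<open>The indicator of a box factors over coordinates just as the density does, so
      one product of integrals remains.\<close>
    have eq: "ennreal (G (xs, ys)) * indicator (zip -` PiE {..<n} A \<inter> space J) (xs, ys)
        = (\<Prod>i<n. ennreal (g (xs i) (ys i)) * indicator (A i) (xs i, ys i))"
      if xs: "xs \<in> space \<mu>n" and ys: "ys \<in> space qn" for xs ys
    proof -
      have sp: "xs i \<in> space \<mu>" "ys i \<in> space q" if "i < n" for i
        using xs ys that by (auto simp: \<mu>n_def qn_def space_PiM)
      have "(\<Prod>i<n. ennreal (g (xs i) (ys i)) * indicator (A i) (xs i, ys i)) =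
         ennreal (\<Prod>i<n. g (xs i) (ys i)) * (\<Prod>i<n. indicator (A i) (xs i, ys i))"
        by (subst prod_ennreal[symmetric]) (auto simp: prod.distrib intro: g0 sp)
      also have "(\<Prod>i<n. indicator (A i) (xs i, ys i)) = (indicator (zip -` PiE {..<n} A \<inter> space J) (xs, ys) :: ennreal)"
      proof (cases "\<forall>i<n. (xs i, ys i) \<in> A i")
        case True
        then show ?thesis using xs ys by (auto simp: indicator_def zip_def J_def space_pair_measure)
      next
        case False
        then show ?thesis by (auto simp: indicator_def zip_def prod_zero_iff PiE_iff)
      qed
      finally show ?thesis by (simp add: G_def)
    qed
    have "emeasure (distr J (PiM {..<n} (\<lambda>_. Q)) zip) (PiE {..<n} A) = emeasure J (zip -` PiE {..<n} A \<inter> space J)"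
      by (rule emeasure_distr[OF _ Am]) measurable
    also have "\<dots> = (\<integral>\<^sup>+z. ennreal (G z) * indicator (zip -` PiE {..<n} A \<inter> space J) z \<partial>(\<mu>n \<Otimes>\<^sub>M qn))"
    proof -
      have "zip -` PiE {..<n} A \<inter> space J \<in> sets (\<mu>n \<Otimes>\<^sub>M qn)"
        using measurable_sets[OF zm Am] by (simp add: J_def)
      then show ?thesis unfolding J_def by (subst emeasure_density) auto
    qed
    also have "\<dots> = (\<integral>\<^sup>+xs. \<integral>\<^sup>+ys. ennreal (G (xs, ys)) * indicator (zip -` PiE {..<n} A \<inter> space J) (xs, ys) \<partial>qn \<partial>\<mu>n)"
    proof -
      have [measurable]: "zip -` PiE {..<n} A \<inter> space J \<in> sets (\<mu>n \<Otimes>\<^sub>M qn)"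
        using measurable_sets[OF zm Am] by (simp add: J_def)
      show ?thesis by (rule qn.nn_integral_fst[symmetric]) measurable
    qed
    also have "\<dots> = (\<integral>\<^sup>+xs. \<integral>\<^sup>+ys. (\<Prod>i<n. ennreal (g (xs i) (ys i)) * indicator (A i) (xs i, ys i)) \<partial>qn \<partial>\<mu>n)"
      by (intro nn_integral_cong eq)
    also have "\<dots> = (\<integral>\<^sup>+xs. (\<Prod>i<n. \<integral>\<^sup>+y. ennreal (g (xs i) y) * indicator (A i) (xs i, y) \<partial>q) \<partial>\<mu>n)"
    proof (rule nn_integral_cong)
      fix xs assume "xs \<in> space \<mu>n"
      then show "(\<integral>\<^sup>+ys. (\<Prod>i<n. ennreal (g (xs i) (ys i)) * indicator (A i) (xs i, ys i)) \<partial>qn) = (\<Prod>i<n. \<integral>\<^sup>+y. ennreal (g (xs i) y) * indicator (A i) (xs i, y) \<partial>q)"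
        unfolding qn_def by (intro nn_integral_PiM_prod q F1) (auto simp: \<mu>n_def space_PiM)
    qed
    also have "\<dots> = (\<Prod>i<n. \<integral>\<^sup>+x. \<integral>\<^sup>+y. ennreal (g x y) * indicator (A i) (x, y) \<partial>q \<partial>\<mu>)"
      unfolding \<mu>n_def by (intro nn_integral_PiM_prod \<mu> F2)
    also have "\<dots> = (\<Prod>i<n. emeasure Q (A i))" using A by (intro prod.cong) (auto simp: Qe)
    finally show "emeasure (distr J (PiM {..<n} (\<lambda>_. Q)) zip) (PiE {..<n} A) = (\<Prod>i\<in>{..<n}. emeasure Q (A i))" .
  qed auto
  then have "iid_joint n MX MY Q = distr (distr J (PiM {..<n} (\<lambda>_. Q)) zip) (PiM {..<n} (\<lambda>_. MX) \<Otimes>\<^sub>M PiM {..<n} (\<lambda>_. MY)) unzip"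
    by (simp add: iid_joint_def unzip_def[abs_def])
  also have "\<dots> = distr (distr J (PiM {..<n} (\<lambda>_. Q)) zip) (\<mu>n \<Otimes>\<^sub>M qn) unzip"
    by (intro distr_cong refl sets_pair_measure_cong) (auto simp: \<mu>n_def qn_def MX MY intro!: sets_PiM_cong)
  also have "\<dots> = distr J (\<mu>n \<Otimes>\<^sub>M qn) (unzip \<circ> zip)" by (rule distr_distr) measurable
  also have "\<dots> = distr J (\<mu>n \<Otimes>\<^sub>M qn) (\<lambda>z. z)"
  proof (rule distr_cong[OF refl refl])
    fix z assume "z \<in> space J"
    then show "(unzip \<circ> zip) z = z"
      by (cases z) (auto simp: unzip_def zip_def J_def space_pair_measure \<mu>n_def qn_def space_PiM PiE_iff extensional_def fun_eq_iff)
  qed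
  also have "\<dots> = J" by (rule distr_id2) (simp add: J_def)
  finally show ?thesis by (simp add: J_def \<mu>n_def qn_def G_def case_prod_beta')
qed

section \<open>From blocks to letters\<close>

lemma prob_algebra_cong: "sets M = sets N \<Longrightarrow> prob_algebra M = prob_algebra N"
  by (simp add: prob_algebra_def cong: subprob_algebra_cong)

section \<open>Joint laws of an input and a kernel output\<close>

definition kernel_joint :: "'x measure \<Rightarrow> 'y measure \<Rightarrow> ('x \<Rightarrow> 'y measure) \<Rightarrow> ('x \<times> 'y) measure" where
  "kernel_joint \<mu> q K = \<mu> \<bind> (\<lambda>x. K x \<bind> (\<lambda>y. return (\<mu> \<Otimes>\<^sub>M q) (x, y)))"

lemma kernel_joint:
  assumes "prob_space \<mu>" and K: "K \<in> \<mu> \<rightarrow>\<^sub>M prob_algebra q"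
  shows "kernel_joint \<mu> q K \<in> space (prob_algebra (\<mu> \<Otimes>\<^sub>M q))"
    and "E \<in> sets (\<mu> \<Otimes>\<^sub>M q) \<Longrightarrow> emeasure (kernel_joint \<mu> q K) E = (\<integral>\<^sup>+x. emeasure (K x) (Pair x -` E) \<partial>\<mu>)"
    and "E \<in> sets (\<mu> \<Otimes>\<^sub>M q) \<Longrightarrow> measure (kernel_joint \<mu> q K) E = (\<integral>x. measure (K x) (Pair x -` E) \<partial>\<mu>)"
proof -
  interpret \<mu>: prob_space \<mu> by fact
  have \<mu>': "\<mu> \<in> space (prob_algebra \<mu>)" by (simp add: space_prob_algebra \<mu>.prob_space_axioms)
  have R: "(\<lambda>(x, y). return (\<mu> \<Otimes>\<^sub>M q) (x, y)) \<in> \<mu> \<Otimes>\<^sub>M q \<rightarrow>\<^sub>M prob_algebra (\<mu> \<Otimes>\<^sub>M q)"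
    using measurable_return_prob_space[of "\<mu> \<Otimes>\<^sub>M q"] by (simp add: case_prod_beta')
  have B: "(\<lambda>x. K x \<bind> (\<lambda>y. return (\<mu> \<Otimes>\<^sub>M q) (x, y))) \<in> \<mu> \<rightarrow>\<^sub>M prob_algebra (\<mu> \<Otimes>\<^sub>M q)"
    by (rule measurable_bind_prob_space2[OF K R])
  show P: "kernel_joint \<mu> q K \<in> space (prob_algebra (\<mu> \<Otimes>\<^sub>M q))"
    unfolding kernel_joint_def
    by (intro space_prob_algebraI prob_space_bind'[OF \<mu>' B] sets_bind'[OF \<mu>' B])
  assume E: "E \<in> sets (\<mu> \<Otimes>\<^sub>M q)"
  have step: "emeasure (K x \<bind> (\<lambda>y. return (\<mu> \<Otimes>\<^sub>M q) (x, y))) E = emeasure (K x) (Pair x -` E)" if x: "x \<in> space \<mu>" for x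
  proof -
    have Kx: "K x \<in> space (prob_algebra q)" by (rule measurable_space[OF K x])
    have Rx: "(\<lambda>y. return (\<mu> \<Otimes>\<^sub>M q) (x, y)) \<in> q \<rightarrow>\<^sub>M prob_algebra (\<mu> \<Otimes>\<^sub>M q)"
      by (rule measurable_compose[OF measurable_Pair1'[OF x] measurable_return_prob_space])
    have "emeasure (K x \<bind> (\<lambda>y. return (\<mu> \<Otimes>\<^sub>M q) (x, y))) E = (\<integral>\<^sup>+y. indicator (Pair x -` E) y \<partial>K x)"
      unfolding emeasure_bind_prob_algebra[OF Kx Rx E]
      using E by (intro nn_integral_cong) (simp add: indicator_def)
    also have "\<dots> = emeasure (K x) (Pair x -` E)"
      using sets_Pair1[OF E] Kx by (intro nn_integral_indicator) (simp add: space_prob_algebra)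
    finally show ?thesis .
  qed
  show e: "emeasure (kernel_joint \<mu> q K) E = (\<integral>\<^sup>+x. emeasure (K x) (Pair x -` E) \<partial>\<mu>)"
    unfolding kernel_joint_def emeasure_bind_prob_algebra[OF \<mu>' B E] by (intro nn_integral_cong step)
  also have "\<dots> = (\<integral>\<^sup>+x. ennreal (measure (K x) (Pair x -` E)) \<partial>\<mu>)"
    using measurable_space[OF K]
    by (intro nn_integral_cong) (auto simp: space_prob_algebra prob_space_def finite_measure.emeasure_eq_measure)
  also have "\<dots> = ennreal (\<integral>x. measure (K x) (Pair x -` E) \<partial>\<mu>)"
    by (intro nn_integral_eq_integral slice_measurable(2)[OF K E assms(1)]) auto
  finally show "measure (kernel_joint \<mu> q K) E = (\<integral>x. measure (K x) (Pair x -` E) \<partial>\<mu>)"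
    by (simp add: measure_def integral_nonneg_AE)
qed

text \<open>Associativity of the monadic bind moves the pairing with \<open>x\<close> outside the
  averages over \<open>c\<close> and \<open>s\<close>. As \<open>\<mu>\<close> has the measurable
  sets of \<open>MX\<close>, and \<open>q\<close> those of \<open>MY\<close>, the products may be
  formed with either.\<close>

lemma rdfc_joint_eq_kernel_joint:
  assumes cp: "code_pair (nidx n R) (nidx n R0) (PiM {..<n} (\<lambda>_. \<mu>)) (PiM {..<n} (\<lambda>_. q)) enc dec"
    and MX: "sets \<mu> = sets MX" and MY: "sets q = sets MY" and R0: "R0 \<ge> 0"
  shows "rdfc_pair n R R0 MX MY enc dec"
    and "rdfc_joint n R0 MX MY \<mu> enc dec = kernel_joint (PiM {..<n} (\<lambda>_. \<mu>)) (PiM {..<n} (\<lambda>_. q)) (code_kernel (nidx n R0) enc dec)"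
proof -
  define \<mu>n where "\<mu>n = PiM {..<n} (\<lambda>_. \<mu>)"
  define qn where "qn = PiM {..<n} (\<lambda>_. q)"
  have s: "sets (PiM {..<n} (\<lambda>_. MX)) = sets \<mu>n" "sets (PiM {..<n} (\<lambda>_. MY)) = sets qn"
    using MX MY by (auto simp: \<mu>n_def qn_def intro!: sets_PiM_cong)
  note cp = cp[folded \<mu>n_def qn_def]
  show "rdfc_pair n R R0 MX MY enc dec"
    using cp R0 unfolding rdfc_pair_def code_pair_def
    by (simp add: measurable_cong_sets[OF s(1) refl] prob_algebra_cong[OF s(2)])
  let ?r = "\<lambda>x y. return (\<mu>n \<Otimes>\<^sub>M qn) (x, y)"
  have N: "nidx n R0 \<ge> 1" using cp by (simp add: code_pair_def)
  have ret: "return (PiM {..<n} (\<lambda>_. MX) \<Otimes>\<^sub>M PiM {..<n} (\<lambda>_. MY)) = return (\<mu>n \<Otimes>\<^sub>M qn)"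
    by (rule ext, rule return_cong, rule sets_pair_measure_cong[OF s])
  have "rdfc_joint n R0 MX MY \<mu> enc dec = \<mu>n \<bind> (\<lambda>x. uniform_count_measure {1..nidx n R0} \<bind> (\<lambda>c.
         enc c x \<bind> (\<lambda>s. dec s c \<bind> ?r x)))"
    unfolding rdfc_joint_def ret by (simp add: \<mu>n_def)
  also have "\<dots> = \<mu>n \<bind> (\<lambda>x. code_kernel (nidx n R0) enc dec x \<bind> ?r x)"
  proof (rule bind_cong[OF refl])
    fix x assume x: "x \<in> space \<mu>n"
    have r: "?r x \<in> qn \<rightarrow>\<^sub>M subprob_algebra (\<mu>n \<Otimes>\<^sub>M qn)"
      by (rule measurable_prob_algebraD, rule measurable_compose[OF measurable_Pair1'[OF x] measurable_return_prob_space])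
    have k: "(\<lambda>c. enc c x \<bind> (\<lambda>s. dec s c)) \<in> uniform_count_measure {1..nidx n R0} \<rightarrow>\<^sub>M subprob_algebra qn"
    proof -
      have "(\<lambda>c. enc c x \<bind> (\<lambda>s. dec s c)) \<in> count_space {1..nidx n R0} \<rightarrow>\<^sub>M prob_algebra qn"
        using code_pair_step(1)[OF cp x] by auto
      then have "(\<lambda>c. enc c x \<bind> (\<lambda>s. dec s c)) \<in> uniform_count_measure {1..nidx n R0} \<rightarrow>\<^sub>M prob_algebra qn"
        by (subst measurable_cong_sets[where M'="count_space {1..nidx n R0}", OF _ refl]) (auto simp: sets_uniform_count_measure)
      then show ?thesis by (rule measurable_prob_algebraD)
    qed
    have "code_kernel (nidx n R0) enc dec x \<bind> ?r x = uniform_count_measure {1..nidx n R0} \<bind> (\<lambda>c. (enc c x \<bind> (\<lambda>s. dec s c)) \<bind> ?r x)"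
      unfolding code_kernel_def by (rule bind_assoc[OF k r])
    also have "\<dots> = uniform_count_measure {1..nidx n R0} \<bind> (\<lambda>c. enc c x \<bind> (\<lambda>s. dec s c \<bind> ?r x))"
    proof (rule bind_cong[OF refl])
      fix c assume "c \<in> space (uniform_count_measure {1..nidx n R0})"
      then have c: "c \<in> {1..nidx n R0}" by (simp add: space_uniform_count_measure)
      have "enc c x \<in> space (prob_algebra (count_space {1..nidx n R}))"
        using cp x c by (auto simp: code_pair_def dest: measurable_space)
      then have e: "sets (enc c x) = sets (count_space {1..nidx n R})" by (simp add: space_prob_algebra)
      have "(\<lambda>s. dec s c) \<in> count_space {1..nidx n R} \<rightarrow>\<^sub>M prob_algebra qn"
        using cp c by (auto simp: code_pair_def)
      then have "(\<lambda>s. dec s c) \<in> enc c x \<rightarrow>\<^sub>M subprob_algebra qn"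
        by (subst measurable_cong_sets[OF e refl]) (rule measurable_prob_algebraD)
      then show "(enc c x \<bind> (\<lambda>s. dec s c)) \<bind> ?r x = enc c x \<bind> (\<lambda>s. dec s c \<bind> ?r x)"
        by (rule bind_assoc[OF _ r])
    qed
    finally show "uniform_count_measure {1..nidx n R0} \<bind> (\<lambda>c. enc c x \<bind> (\<lambda>s. dec s c \<bind> ?r x)) = code_kernel (nidx n R0) enc dec x \<bind> ?r x"
      by simp
  qed
  finally show "rdfc_joint n R0 MX MY \<mu> enc dec = kernel_joint (PiM {..<n} (\<lambda>_. \<mu>)) (PiM {..<n} (\<lambda>_. q)) (code_kernel (nidx n R0) enc dec)"
    unfolding kernel_joint_def \<mu>n_def qn_def .
qed

text \<open>The overwritten entry is lost and its replacement is an independent draw from the same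
  law. With this, conditioning a block on its letter \<open>i\<close> becomes integration over a
  product of the letter and a whole block.\<close>

lemma PiM_resample_coordinate:
  assumes \<mu>: "prob_space \<mu>" and i: "i < (n::nat)"
  shows "(\<lambda>(x, xs). xs(i := x)) \<in> \<mu> \<Otimes>\<^sub>M PiM {..<n} (\<lambda>_. \<mu>) \<rightarrow>\<^sub>M PiM {..<n} (\<lambda>_. \<mu>)"
    and "distr (\<mu> \<Otimes>\<^sub>M PiM {..<n} (\<lambda>_. \<mu>)) (PiM {..<n} (\<lambda>_. \<mu>)) (\<lambda>(x, xs). xs(i := x)) = PiM {..<n} (\<lambda>_. \<mu>)"
proof -
  interpret \<mu>: prob_space \<mu> by fact
  interpret P: product_sigma_finite "\<lambda>_::nat. \<mu>"
    unfolding product_sigma_finite_def by (simp add: prob_space_imp_sigma_finite \<mu>)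
  let ?\<mu>n = "PiM {..<n} (\<lambda>_. \<mu>)"
  interpret \<mu>n: prob_space ?\<mu>n by (intro prob_space_PiM \<mu>)
  have ins: "insert i {..<n} = {..<n}" using i by auto
  have "(\<lambda>(f, y). f(i := y)) \<in> ?\<mu>n \<Otimes>\<^sub>M \<mu> \<rightarrow>\<^sub>M ?\<mu>n"
    using measurable_add_dim[of i "{..<n}" "\<lambda>_. \<mu>"] by (simp only: ins)
  then have "(\<lambda>z. (\<lambda>(f, y). f(i := y)) (snd z, fst z)) \<in> \<mu> \<Otimes>\<^sub>M ?\<mu>n \<rightarrow>\<^sub>M ?\<mu>n"
    by (rule measurable_compose[rotated]) measurable
  then show m: "(\<lambda>(x, xs). xs(i := x)) \<in> \<mu> \<Otimes>\<^sub>M ?\<mu>n \<rightarrow>\<^sub>M ?\<mu>n" by (simp add: case_prod_beta')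
  show "distr (\<mu> \<Otimes>\<^sub>M ?\<mu>n) ?\<mu>n (\<lambda>(x, xs). xs(i := x)) = ?\<mu>n"
  proof (rule P.PiM_eqI)
    fix A assume A: "\<And>j. j \<in> {..<n} \<Longrightarrow> A j \<in> sets \<mu>"
    \<comment> \<open>The entry about to be overwritten is unconstrained.\<close>
    define B where "B = A(i := space \<mu>)"
    have B: "B j \<in> sets \<mu>" if "j \<in> {..<n}" for j using A that by (simp add: B_def)
    have Am: "PiE {..<n} A \<in> sets ?\<mu>n" "PiE {..<n} B \<in> sets ?\<mu>n" by (intro sets_PiM_I_finite; use A B in auto)+
    have "(\<lambda>(x, xs). xs(i := x)) -` PiE {..<n} A \<inter> space (\<mu> \<Otimes>\<^sub>M ?\<mu>n) = A i \<times> PiE {..<n} B"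
    proof (intro set_eqI iffI)
      fix z assume z: "z \<in> (\<lambda>(x, xs). xs(i := x)) -` PiE {..<n} A \<inter> space (\<mu> \<Otimes>\<^sub>M ?\<mu>n)"
      obtain x xs where zz: "z = (x, xs)" by (cases z)
      have "\<forall>j<n. (xs(i := x)) j \<in> A j" "xs \<in> space ?\<mu>n" "x \<in> space \<mu>" using z zz by (auto simp: space_pair_measure PiE_iff)
      then show "z \<in> A i \<times> PiE {..<n} B" using i zz by (auto simp: B_def space_PiM PiE_iff split: if_splits)
    next
      fix z assume z: "z \<in> A i \<times> PiE {..<n} B"
      obtain x xs where zz: "z = (x, xs)" by (cases z)
      have x: "x \<in> A i" and xs: "xs \<in> PiE {..<n} B" using z zz by auto
      have "x \<in> space \<mu>" using x A[of i] i sets.sets_into_space by blast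
      moreover have "xs \<in> space ?\<mu>n" using xs sets.sets_into_space[OF Am(2)] by blast
      moreover have "xs(i := x) \<in> PiE {..<n} A"
      proof (rule PiE_I)
        fix j assume "j \<in> {..<n}"
        then show "(xs(i := x)) j \<in> A j" using x PiE_mem[OF xs, of j] by (auto simp: B_def)
      next
        fix j assume "j \<notin> {..<n}"
        then show "(xs(i := x)) j = undefined" using i PiE_arb[OF xs] by auto
      qed
      ultimately show "z \<in> (\<lambda>(x, xs). xs(i := x)) -` PiE {..<n} A \<inter> space (\<mu> \<Otimes>\<^sub>M ?\<mu>n)"
        using zz by (simp add: space_pair_measure)
    qed
    then have "emeasure (distr (\<mu> \<Otimes>\<^sub>M ?\<mu>n) ?\<mu>n (\<lambda>(x, xs). xs(i := x))) (PiE {..<n} A) = emeasure (\<mu> \<Otimes>\<^sub>M ?\<mu>n) (A i \<times> PiE {..<n} B)"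
      by (simp add: emeasure_distr[OF m Am(1)])
    also have "\<dots> = emeasure \<mu> (A i) * emeasure ?\<mu>n (PiE {..<n} B)"
      using A i Am by (intro \<mu>n.emeasure_pair_measure_Times) auto
    also have "emeasure ?\<mu>n (PiE {..<n} B) = (\<Prod>j<n. emeasure \<mu> (B j))" using B by (intro P.emeasure_PiM) auto
    also have "\<dots> = (\<Prod>j\<in>{..<n} - {i}. emeasure \<mu> (A j))"
      using i by (subst prod.remove[of _ i]) (auto simp: B_def \<mu>.emeasure_space_1 intro!: prod.cong)
    also have "emeasure \<mu> (A i) * \<dots> = (\<Prod>j<n. emeasure \<mu> (A j))" using i by (subst (2) prod.remove[of _ i]) auto
    finally show "emeasure (distr (\<mu> \<Otimes>\<^sub>M ?\<mu>n) ?\<mu>n (\<lambda>(x, xs). xs(i := x))) (PiE {..<n} A) = (\<Prod>j\<in>{..<n}. emeasure \<mu> (A j))" .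
  qed auto
qed

lemma synthesizes_ldp_cong:
  assumes MX: "sets MX = sets MX'" and MY: "sets MY = sets MY'" and s: "synthesizes_ldp MX MY J \<epsilon> \<delta>"
  shows "synthesizes_ldp MX' MY' J \<epsilon> \<delta>"
proof -
  have 1: "distr J MX fst = distr J MX' fst" by (rule distr_cong[OF refl MX refl])
  have 2: "return (MX \<Otimes>\<^sub>M MY) = return (MX' \<Otimes>\<^sub>M MY')"
    by (rule ext, rule return_cong, rule sets_pair_measure_cong[OF MX MY])
  show ?thesis
    using s unfolding synthesizes_ldp_def ldp_mechanism_def 1 2 MY sets_eq_imp_space_eq[OF MX]
      measurable_cong_sets[OF MX refl] prob_algebra_cong[OF MY] .
qed

lemma synthesizes_ldp_mono:
  assumes "synthesizes_ldp MX MY J \<epsilon> \<delta>" "\<delta> \<le> \<delta>'"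
  shows "synthesizes_ldp MX MY J \<epsilon> \<delta>'"
  using assms unfolding synthesizes_ldp_def ldp_mechanism_def by (meson order_trans)

text \<open>Given letter \<open>i\<close> the other letters keep their law, so a version of the
  conditional law of the output letter is the average of \<open>K (xs(i := x))\<close> over
  \<open>xs\<close>. For two inputs the averaged blocks differ only at \<open>i\<close>, and a bound
  that holds for each such pair survives averaging; passing to a single output letter merely
  restricts the events.\<close>

lemma kernel_joint_letter_ldp:
  fixes n :: nat
  assumes \<mu>: "prob_space \<mu>" and q: "prob_space q"
    and K: "K \<in> PiM {..<n} (\<lambda>_. \<mu>) \<rightarrow>\<^sub>M prob_algebra (PiM {..<n} (\<lambda>_. q))" and i: "i < n"
    and ldp: "\<And>xs x x' S. xs \<in> space (PiM {..<n} (\<lambda>_. \<mu>)) \<Longrightarrow> x \<in> space \<mu> \<Longrightarrow> x' \<in> space \<mu> \<Longrightarrow>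
      S \<in> sets (PiM {..<n} (\<lambda>_. q)) \<Longrightarrow> measure (K (xs(i := x))) S - exp \<epsilon> * measure (K (xs(i := x'))) S \<le> d"
  shows "synthesizes_ldp \<mu> q (distr (kernel_joint (PiM {..<n} (\<lambda>_. \<mu>)) (PiM {..<n} (\<lambda>_. q)) K) (\<mu> \<Otimes>\<^sub>M q) (\<lambda>(xs, ys). (xs i, ys i))) \<epsilon> d"
proof -
  define \<mu>n where "\<mu>n = PiM {..<n} (\<lambda>_. \<mu>)"
  define qn where "qn = PiM {..<n} (\<lambda>_. q)"
  note K = K[folded \<mu>n_def qn_def]
  note ldp = ldp[folded \<mu>n_def qn_def]
  interpret \<mu>: prob_space \<mu> by fact
  interpret \<mu>n: prob_space \<mu>n unfolding \<mu>n_def by (intro prob_space_PiM \<mu>)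
  have upd[measurable]: "(\<lambda>(x, xs). xs(i := x)) \<in> \<mu> \<Otimes>\<^sub>M \<mu>n \<rightarrow>\<^sub>M \<mu>n"
    and upd_distr: "distr (\<mu> \<Otimes>\<^sub>M \<mu>n) \<mu>n (\<lambda>(x, xs). xs(i := x)) = \<mu>n"
    unfolding \<mu>n_def using PiM_resample_coordinate[OF \<mu> i] by auto
  have updx: "xs(i := x) \<in> space \<mu>n" if "x \<in> space \<mu>" "xs \<in> space \<mu>n" for x xs
    using measurable_space[OF upd, of "(x, xs)"] that by (simp add: space_pair_measure)
  have Ki[measurable]: "(\<lambda>ys. ys i) \<in> qn \<rightarrow>\<^sub>M q" unfolding qn_def using i by (intro measurable_component_singleton) simp
  have Xi[measurable]: "(\<lambda>xs. xs i) \<in> \<mu>n \<rightarrow>\<^sub>M \<mu>" unfolding \<mu>n_def using i by (intro measurable_component_singleton) simp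
  define J where "J = kernel_joint \<mu>n qn K"
  have Jp: "J \<in> space (prob_algebra (\<mu>n \<Otimes>\<^sub>M qn))" unfolding J_def by (rule kernel_joint(1)[OF \<mu>n.prob_space_axioms K])
  then have Jsets[measurable_cong]: "sets J = sets (\<mu>n \<Otimes>\<^sub>M qn)" and Jps: "prob_space J" by (auto simp: space_prob_algebra)
  have proj[measurable]: "(\<lambda>(xs, ys). (xs i, ys i)) \<in> \<mu>n \<Otimes>\<^sub>M qn \<rightarrow>\<^sub>M \<mu> \<Otimes>\<^sub>M q" by measurable
  define Ji where "Ji = distr J (\<mu> \<Otimes>\<^sub>M q) (\<lambda>(xs, ys). (xs i, ys i))"
  \<comment> \<open>Defined for every \<open>x\<close>, because LDP asks about all inputs and not
    only almost all. Entry \<open>i\<close> of \<open>xs\<close> is discarded.\<close>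
  define W where "W x = \<mu>n \<bind> (\<lambda>xs. distr (K (xs(i := x))) q (\<lambda>ys. ys i))" for x
  have Wk: "(\<lambda>(x, xs). distr (K (xs(i := x))) q (\<lambda>ys. ys i)) \<in> \<mu> \<Otimes>\<^sub>M \<mu>n \<rightarrow>\<^sub>M prob_algebra q"
  proof -
    have "(\<lambda>z. distr (K ((\<lambda>(x, xs). xs(i := x)) z)) q (\<lambda>ys. ys i)) \<in> \<mu> \<Otimes>\<^sub>M \<mu>n \<rightarrow>\<^sub>M prob_algebra q"
      by (rule measurable_compose[OF measurable_compose[OF upd K] measurable_distr_prob_space[OF Ki]])
    then show ?thesis by (simp add: case_prod_beta')
  qed
  have \<mu>n': "\<mu>n \<in> space (prob_algebra \<mu>n)" by (simp add: space_prob_algebra \<mu>n.prob_space_axioms)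
  have W: "W \<in> \<mu> \<rightarrow>\<^sub>M prob_algebra q"
    unfolding W_def by (rule measurable_bind_prob_space2[OF _ Wk]) (use \<mu>n' in simp)
  have KE: "emeasure (distr (K xs) q (\<lambda>ys. ys i)) S = emeasure (K xs) ((\<lambda>ys. ys i) -` S \<inter> space qn)"
    "measure (distr (K xs) q (\<lambda>ys. ys i)) S = measure (K xs) ((\<lambda>ys. ys i) -` S \<inter> space qn)"
    if xs: "xs \<in> space \<mu>n" and S: "S \<in> sets q" for xs S
  proof -
    have s: "sets (K xs) = sets qn" using measurable_space[OF K xs] by (simp add: space_prob_algebra)
    have m: "(\<lambda>ys. ys i) \<in> K xs \<rightarrow>\<^sub>M q" using Ki by (simp add: measurable_cong_sets[OF s refl])
    show "emeasure (distr (K xs) q (\<lambda>ys. ys i)) S = emeasure (K xs) ((\<lambda>ys. ys i) -` S \<inter> space qn)"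
      "measure (distr (K xs) q (\<lambda>ys. ys i)) S = measure (K xs) ((\<lambda>ys. ys i) -` S \<inter> space qn)"
      using emeasure_distr[OF m S] measure_distr[OF m S] sets_eq_imp_space_eq[OF s] by auto
  qed
  have Wkx: "(\<lambda>xs. distr (K (xs(i := x))) q (\<lambda>ys. ys i)) \<in> \<mu>n \<rightarrow>\<^sub>M prob_algebra q" if x: "x \<in> space \<mu>" for x
    using measurable_compose[OF measurable_Pair1'[OF x] Wk] by simp
  have We: "emeasure (W x) S = (\<integral>\<^sup>+xs. emeasure (K (xs(i := x))) ((\<lambda>ys. ys i) -` S \<inter> space qn) \<partial>\<mu>n)"
    if x: "x \<in> space \<mu>" and S: "S \<in> sets q" for x S
  proof -
    have "emeasure (W x) S = (\<integral>\<^sup>+xs. emeasure (distr (K (xs(i := x))) q (\<lambda>ys. ys i)) S \<partial>\<mu>n)"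
      unfolding W_def by (rule emeasure_bind_prob_algebra[OF \<mu>n' Wkx[OF x] S])
    also have "\<dots> = (\<integral>\<^sup>+xs. emeasure (K (xs(i := x))) ((\<lambda>ys. ys i) -` S \<inter> space qn) \<partial>\<mu>n)"
    proof (rule nn_integral_cong)
      fix xs assume "xs \<in> space \<mu>n"
      then show "emeasure (distr (K (xs(i := x))) q (\<lambda>ys. ys i)) S = emeasure (K (xs(i := x))) ((\<lambda>ys. ys i) -` S \<inter> space qn)"
        using KE(1)[OF updx[OF x] S, of xs] by blast
    qed
    finally show ?thesis .
  qed
  have Je: "emeasure Ji E = (\<integral>\<^sup>+xs. emeasure (K xs) ((\<lambda>ys. ys i) -` (Pair (xs i) -` E) \<inter> space qn) \<partial>\<mu>n)"
    if E: "E \<in> sets (\<mu> \<Otimes>\<^sub>M q)" for E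
  proof -
    have E': "(\<lambda>(xs, ys). (xs i, ys i)) -` E \<inter> space J \<in> sets (\<mu>n \<Otimes>\<^sub>M qn)"
      unfolding sets_eq_imp_space_eq[OF Jsets] by (rule measurable_sets[OF proj E])
    have "emeasure Ji E = emeasure J ((\<lambda>(xs, ys). (xs i, ys i)) -` E \<inter> space J)"
      unfolding Ji_def by (rule emeasure_distr[OF _ E]) (simp add: measurable_cong_sets[OF Jsets refl] proj)
    also have "\<dots> = (\<integral>\<^sup>+xs. emeasure (K xs) (Pair xs -` ((\<lambda>(xs, ys). (xs i, ys i)) -` E \<inter> space J)) \<partial>\<mu>n)"
      unfolding J_def[symmetric] by (subst (1) J_def, rule kernel_joint(2)[OF \<mu>n.prob_space_axioms K E'])
    also have "\<dots> = (\<integral>\<^sup>+xs. emeasure (K xs) ((\<lambda>ys. ys i) -` (Pair (xs i) -` E) \<inter> space qn) \<partial>\<mu>n)"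
      by (intro nn_integral_cong arg_cong2[where f=emeasure] refl)
         (auto simp: sets_eq_imp_space_eq[OF Jsets] space_pair_measure)
    finally show ?thesis .
  qed
  have Jisets: "sets Ji = sets (\<mu> \<Otimes>\<^sub>M q)" by (simp add: Ji_def)
  have fst_Ji: "distr Ji \<mu> fst = \<mu>"
  proof (rule measure_eqI)
    fix A assume "A \<in> sets (distr Ji \<mu> fst)"
    then have A[measurable]: "A \<in> sets \<mu>" by simp
    have "fst -` A \<inter> space Ji = A \<times> space q"
      using sets.sets_into_space[OF A] sets_eq_imp_space_eq[OF Jisets] by (auto simp: space_pair_measure)
    then have "emeasure (distr Ji \<mu> fst) A = emeasure Ji (A \<times> space q)"
      by (subst emeasure_distr) (auto simp: measurable_cong_sets[OF Jisets refl])
    also have "\<dots> = (\<integral>\<^sup>+xs. indicator A (xs i) \<partial>\<mu>n)"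
    proof (subst Je, simp, rule nn_integral_cong)
      fix xs assume xs: "xs \<in> space \<mu>n"
      have "K xs \<in> space (prob_algebra qn)" by (rule measurable_space[OF K xs])
      then have "emeasure (K xs) (space qn) = 1"
        by (auto simp: space_prob_algebra dest!: sets_eq_imp_space_eq prob_space.emeasure_space_1)
      moreover have "(\<lambda>ys. ys i) -` space q \<inter> space qn = space qn" using measurable_space[OF Ki] by auto
      ultimately show "emeasure (K xs) ((\<lambda>ys. ys i) -` (Pair (xs i) -` (A \<times> space q)) \<inter> space qn) = indicator A (xs i)"
        by (auto simp: indicator_def)
    qed
    also have "\<dots> = (\<integral>\<^sup>+x. indicator A x \<partial>distr \<mu>n \<mu> (\<lambda>xs. xs i))" by (rule nn_integral_distr[symmetric]) auto
    also have "distr \<mu>n \<mu> (\<lambda>xs. xs i) = \<mu>"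
      unfolding \<mu>n_def using i \<mu> by (intro distr_PiM_component) auto
    finally show "emeasure (distr Ji \<mu> fst) A = emeasure \<mu> A" by simp
  qed simp
  \<comment> \<open>Integrating over \<open>x\<close> and over \<open>xs\<close> with entry
    \<open>i\<close> overwritten by \<open>x\<close> is integrating over the block law, by
    \<open>PiM_resample_coordinate\<close>.\<close>
  have Ji_eq: "Ji = kernel_joint \<mu> q W"
  proof (rule measure_eqI)
    show "sets Ji = sets (kernel_joint \<mu> q W)" using kernel_joint(1)[OF \<mu> W] by (simp add: Jisets space_prob_algebra)
    fix E assume "E \<in> sets Ji"
    then have E: "E \<in> sets (\<mu> \<Otimes>\<^sub>M q)" by (simp add: Jisets)
    define h where "h xs = emeasure (K xs) ((\<lambda>ys. ys i) -` (Pair (xs i) -` E) \<inter> space qn)" for xs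
    have hm: "h \<in> borel_measurable \<mu>n"
    proof -
      have "(\<lambda>(xs, ys). (xs i, ys i)) -` E \<inter> space (\<mu>n \<Otimes>\<^sub>M qn) \<in> sets (\<mu>n \<Otimes>\<^sub>M qn)" by (rule measurable_sets[OF proj E])
      moreover have "(\<lambda>(xs, ys). (xs i, ys i)) -` E \<inter> space (\<mu>n \<Otimes>\<^sub>M qn) = Sigma (space \<mu>n) (\<lambda>xs. (\<lambda>ys. ys i) -` (Pair (xs i) -` E) \<inter> space qn)"
        by (auto simp: space_pair_measure)
      ultimately show ?thesis unfolding h_def
        by (intro emeasure_measurable_subprob_algebra2[OF _ measurable_prob_algebraD[OF K]]) simp
    qed
    have "emeasure (kernel_joint \<mu> q W) E = (\<integral>\<^sup>+x. \<integral>\<^sup>+xs. h (xs(i := x)) \<partial>\<mu>n \<partial>\<mu>)"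
      unfolding kernel_joint(2)[OF \<mu> W E] h_def
      by (intro nn_integral_cong) (simp add: We sets_Pair1[OF E])
    also have "\<dots> = (\<integral>\<^sup>+z. h ((\<lambda>(x, xs). xs(i := x)) z) \<partial>(\<mu> \<Otimes>\<^sub>M \<mu>n))"
      using measurable_compose[OF upd hm] by (subst \<mu>n.nn_integral_fst[symmetric]) auto
    also have "\<dots> = (\<integral>\<^sup>+xs. h xs \<partial>distr (\<mu> \<Otimes>\<^sub>M \<mu>n) \<mu>n (\<lambda>(x, xs). xs(i := x)))"
      by (rule nn_integral_distr[OF upd, symmetric]) (use hm in simp)
    also have "\<dots> = emeasure Ji E" unfolding upd_distr Je[OF E] h_def ..
    finally show "emeasure Ji E = emeasure (kernel_joint \<mu> q W) E" by simp
  qed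
  have ldpW: "ldp_mechanism \<mu> q W \<epsilon> d"
    unfolding ldp_mechanism_def
  proof (intro ballI)
    fix x x' S assume x: "x \<in> space \<mu>" and x': "x' \<in> space \<mu>" and S: "S \<in> sets q"
    let ?T = "(\<lambda>ys. ys i) -` S \<inter> space qn"
    have T: "?T \<in> sets qn" by (rule measurable_sets[OF Ki S])
    have int: "integrable \<mu>n (\<lambda>xs. measure (K (xs(i := x))) ?T)" and meas: "measure (W x) S = (\<integral>xs. measure (K (xs(i := x))) ?T \<partial>\<mu>n)"
      if x: "x \<in> space \<mu>" for x
    proof -
      have um: "(\<lambda>xs. xs(i := x)) \<in> \<mu>n \<rightarrow>\<^sub>M \<mu>n" using measurable_compose[OF measurable_Pair1'[OF x] upd] by simp
      have Kp: "prob_space (K (xs(i := x)))" if "xs \<in> space \<mu>n" for xs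
        using measurable_space[OF K updx[OF x that]] by (simp add: space_prob_algebra)
      show int: "integrable \<mu>n (\<lambda>xs. measure (K (xs(i := x))) ?T)"
      proof (rule \<mu>n.integrable_const_bound[of _ 1])
        show "AE xs in \<mu>n. norm (measure (K (xs(i := x))) ?T) \<le> 1"
        proof (rule AE_I2)
          fix xs assume "xs \<in> space \<mu>n"
          from prob_space.prob_le_1[OF Kp[OF this], of ?T] show "norm (measure (K (xs(i := x))) ?T) \<le> 1" by simp
        qed
        show "(\<lambda>xs. measure (K (xs(i := x))) ?T) \<in> borel_measurable \<mu>n"
          by (rule measurable_compose[OF measurable_compose[OF um measurable_prob_algebraD[OF K]] measurable_measure_subprob_algebra[OF T]])
      qed
      have "emeasure (W x) S = (\<integral>\<^sup>+xs. ennreal (measure (K (xs(i := x))) ?T) \<partial>\<mu>n)"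
        unfolding We[OF x S]
      proof (rule nn_integral_cong)
        fix xs assume "xs \<in> space \<mu>n"
        then interpret Kx: prob_space "K (xs(i := x))" by (rule Kp)
        show "emeasure (K (xs(i := x))) ?T = ennreal (measure (K (xs(i := x))) ?T)" by (rule Kx.emeasure_eq_measure)
      qed
      also have "\<dots> = ennreal (\<integral>xs. measure (K (xs(i := x))) ?T \<partial>\<mu>n)" by (rule nn_integral_eq_integral[OF int]) simp
      finally show "measure (W x) S = (\<integral>xs. measure (K (xs(i := x))) ?T \<partial>\<mu>n)" by (simp add: measure_def integral_nonneg_AE)
    qed
    have "measure (W x) S - exp \<epsilon> * measure (W x') S = (\<integral>xs. measure (K (xs(i := x))) ?T - exp \<epsilon> * measure (K (xs(i := x'))) ?T \<partial>\<mu>n)"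
      using int[OF x] int[OF x'] by (simp add: meas x x')
    also have "\<dots> \<le> (\<integral>xs. d \<partial>\<mu>n)"
      using int[OF x] int[OF x'] by (intro integral_mono ldp x x' T) auto
    finally show "measure (W x) S - exp \<epsilon> * measure (W x') S \<le> d" by (simp add: \<mu>n.prob_space)
  qed
  have "Ji = distr Ji \<mu> fst \<bind> (\<lambda>x. W x \<bind> (\<lambda>y. return (\<mu> \<Otimes>\<^sub>M q) (x, y)))"
    unfolding fst_Ji using Ji_eq unfolding kernel_joint_def .
  then have "synthesizes_ldp \<mu> q Ji \<epsilon> d"
    unfolding synthesizes_ldp_def using W ldpW by blast
  then show ?thesis by (simp add: Ji_def J_def \<mu>n_def qn_def)
qed

text \<open>The common-randomness rate is chosen last and read off from the number \<open>N\<close>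
  of codebooks; the rounding in \<open>nidx\<close> is exact for it.\<close>

lemma nidx_log: "n \<ge> 1 \<Longrightarrow> N \<ge> 1 \<Longrightarrow> nidx n (ln (real N) / real n) = N"
  by (simp add: nidx_def)

text \<open>The two block densities share all factors but one. The common product comes out of the
  positive part and integrates to one, so neighbouring blocks are as hard to tell apart as the two
  letters.\<close>

lemma neighbour_hockey_stick:
  fixes g :: "'a \<Rightarrow> 'b \<Rightarrow> real" and n :: nat
  assumes q: "prob_space q" and gx: "\<And>x. x \<in> space \<mu> \<Longrightarrow> g x \<in> borel_measurable q"
    and g0: "\<And>x y. x \<in> space \<mu> \<Longrightarrow> y \<in> space q \<Longrightarrow> 0 \<le> g x y"
    and g1: "\<And>x. x \<in> space \<mu> \<Longrightarrow> (\<integral>\<^sup>+y. ennreal (g x y) \<partial>q) = 1"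
    and hs: "(\<integral>\<^sup>+y. ennreal (g x y - c * g x' y) \<partial>q) \<le> ennreal d"
    and x: "x \<in> space \<mu>" "x' \<in> space \<mu>" and xs: "xs \<in> space (PiM {..<n} (\<lambda>_. \<mu>))" and i: "i < n"
  shows "(\<integral>\<^sup>+ys. ennreal ((\<Prod>j<n. g ((xs(i := x)) j) (ys j)) - c * (\<Prod>j<n. g ((xs(i := x')) j) (ys j))) \<partial>PiM {..<n} (\<lambda>_. q)) \<le> ennreal d"
proof -
  have xs': "xs j \<in> space \<mu>" if "j < n" for j using xs that by (auto simp: space_PiM)
  define F where "F j y = (if j = i then ennreal (g x y - c * g x' y) else ennreal (g (xs j) y))" for j y
  have "(\<integral>\<^sup>+ys. ennreal ((\<Prod>j<n. g ((xs(i := x)) j) (ys j)) - c * (\<Prod>j<n. g ((xs(i := x')) j) (ys j))) \<partial>PiM {..<n} (\<lambda>_. q))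
    = (\<integral>\<^sup>+ys. (\<Prod>j<n. F j (ys j)) \<partial>PiM {..<n} (\<lambda>_. q))"
  proof (rule nn_integral_cong)
    fix ys assume "ys \<in> space (PiM {..<n} (\<lambda>_. q))"
    then have ys: "ys j \<in> space q" if "j < n" for j using that by (auto simp: space_PiM)
    have split: "(\<Prod>j<n. g ((xs(i := z)) j) (ys j)) = g z (ys i) * (\<Prod>j\<in>{..<n} - {i}. g (xs j) (ys j))" for z
      using i by (subst prod.remove[of _ i]) (auto intro!: prod.cong)
    have nn: "0 \<le> (\<Prod>j\<in>{..<n} - {i}. g (xs j) (ys j))" using xs' ys g0 by (intro prod_nonneg) auto
    have "(\<Prod>j<n. F j (ys j)) = F i (ys i) * (\<Prod>j\<in>{..<n} - {i}. F j (ys j))" using i by (subst prod.remove[of _ i]) auto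
    also have "(\<Prod>j\<in>{..<n} - {i}. F j (ys j)) = (\<Prod>j\<in>{..<n} - {i}. ennreal (g (xs j) (ys j)))" by (intro prod.cong) (auto simp: F_def)
    also have "\<dots> = ennreal (\<Prod>j\<in>{..<n} - {i}. g (xs j) (ys j))" using xs' ys g0 by (intro prod_ennreal) auto
    finally have "(\<Prod>j<n. F j (ys j)) = ennreal ((g x (ys i) - c * g x' (ys i)) * (\<Prod>j\<in>{..<n} - {i}. g (xs j) (ys j)))"
      using nn by (simp add: F_def ennreal_mult'')
    then show "ennreal ((\<Prod>j<n. g ((xs(i := x)) j) (ys j)) - c * (\<Prod>j<n. g ((xs(i := x')) j) (ys j))) = (\<Prod>j<n. F j (ys j))"
      unfolding split by (simp add: left_diff_distrib mult.assoc)
  qed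
  also have "\<dots> = (\<Prod>j<n. \<integral>\<^sup>+y. F j y \<partial>q)"
    by (rule nn_integral_PiM_prod[OF q]) (use gx x xs' in \<open>auto simp: F_def\<close>)
  also have "\<dots> = (\<integral>\<^sup>+y. F i y \<partial>q) * (\<Prod>j\<in>{..<n} - {i}. \<integral>\<^sup>+y. F j y \<partial>q)" using i by (subst prod.remove[of _ i]) auto
  also have "(\<Prod>j\<in>{..<n} - {i}. \<integral>\<^sup>+y. F j y \<partial>q) = 1" using xs' by (intro prod.neutral) (auto simp: F_def g1)
  also have "(\<integral>\<^sup>+y. F i y \<partial>q) * 1 \<le> ennreal d" using hs by (simp add: F_def)
  finally show ?thesis .
qed

text \<open>For blocks the \<open>p\<close>-th moment of the density is the product of the letter
  moments. A pointwise bound \<open>C\<close> thus becomes \<open>C ^ n\<close>, and an average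
  bound \<open>m\<close> becomes \<open>m ^ n\<close> by independence of the input letters. Privacy
  is asked only of blocks that differ in one letter, so the divergence \<open>d\<close> does not
  grow with \<open>n\<close>.\<close>

lemma rdfc_code:
  fixes g :: "'a \<Rightarrow> 'b \<Rightarrow> real" and n :: nat
  assumes \<mu>: "prob_space \<mu>" and q: "prob_space q" and gm[measurable]: "(\<lambda>(x, y). g x y) \<in> borel_measurable (\<mu> \<Otimes>\<^sub>M q)"
    and g0: "\<And>x y. x \<in> space \<mu> \<Longrightarrow> y \<in> space q \<Longrightarrow> 0 \<le> g x y"
    and g1: "\<And>x. x \<in> space \<mu> \<Longrightarrow> (\<integral>\<^sup>+y. ennreal (g x y) \<partial>q) = 1"
    and Qp: "prob_space Q" and Q: "Q = density (\<mu> \<Otimes>\<^sub>M q) (\<lambda>(x, y). ennreal (g x y))"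
    and MX: "sets \<mu> = sets MX" and MY: "sets q = sets MY"
    and hs: "\<And>x x'. x \<in> space \<mu> \<Longrightarrow> x' \<in> space \<mu> \<Longrightarrow> (\<integral>\<^sup>+y. ennreal (g x y - exp \<epsilon> * g x' y) \<partial>q) \<le> ennreal d" and d: "d \<ge> 0"
    and p: "p > 1" and gp: "\<And>x. x \<in> space \<mu> \<Longrightarrow> (\<integral>\<^sup>+y. ennreal (g x y powr p) \<partial>q) = ennreal (\<phi> x)"
    and \<phi>m[measurable]: "\<phi> \<in> borel_measurable \<mu>" and \<phi>0: "\<And>x. x \<in> space \<mu> \<Longrightarrow> 0 < \<phi> x"
    and n: "n \<ge> 1" and M: "nidx n R \<ge> 1" and L: "L > 0" and \<eta>: "\<eta> > 0" and \<tau>: "\<tau> \<ge> 0"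
    and cases: "(\<exists>C. (\<forall>x\<in>space \<mu>. \<phi> x \<le> C) \<and> L powr (1 - p) * C ^ n \<le> \<tau>) \<or>
      (\<exists>m\<ge>0. (\<integral>\<^sup>+x. ennreal (\<phi> x powr (1 / p)) \<partial>\<mu>) \<le> ennreal m \<and> 2 * L powr (1 / p - 1) * m ^ n \<le> \<tau>)"
  defines "\<omega> \<equiv> \<tau> + exp (- real (nidx n R) / (L + 1)) + 3 * \<eta>"
  shows "\<exists>R0 enc dec. rdfc_pair n R R0 MX MY enc dec \<and>
    tv_dist (rdfc_joint n R0 MX MY \<mu> enc dec) (iid_joint n MX MY Q) \<le> \<omega> \<and>
    synthesizes_ldp_n n MX MY (rdfc_joint n R0 MX MY \<mu> enc dec) \<epsilon> (d + (1 + exp \<epsilon>) * \<omega>)"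
proof -
  interpret \<mu>: prob_space \<mu> by fact
  interpret q: prob_space q by fact
  define \<mu>n where "\<mu>n = PiM {..<n} (\<lambda>_. \<mu>)"
  define qn where "qn = PiM {..<n} (\<lambda>_. q)"
  interpret \<mu>n: prob_space \<mu>n unfolding \<mu>n_def by (intro prob_space_PiM \<mu>)
  interpret qn: prob_space qn unfolding qn_def by (intro prob_space_PiM q)
  define G where "G xs ys = (\<Prod>i<n. g (xs i) (ys i))" for xs :: "nat \<Rightarrow> 'a" and ys :: "nat \<Rightarrow> 'b"
  define \<Phi> where "\<Phi> xs = (\<Prod>i<n. \<phi> (xs i))" for xs
  have gx[measurable]: "g x \<in> borel_measurable q" if "x \<in> space \<mu>" for x using that by measurable
  have Gm[measurable]: "(\<lambda>(xs, ys). G xs ys) \<in> borel_measurable (\<mu>n \<Otimes>\<^sub>M qn)"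
    unfolding G_def \<mu>n_def qn_def by (rule prod_kernel_measurable[OF gm])
  have spx: "xs i \<in> space \<mu>" if "xs \<in> space \<mu>n" "i < n" for xs i using that by (auto simp: \<mu>n_def space_PiM)
  have spy: "ys i \<in> space q" if "ys \<in> space qn" "i < n" for ys i using that by (auto simp: qn_def space_PiM)
  have G0: "0 \<le> G xs ys" if "xs \<in> space \<mu>n" "ys \<in> space qn" for xs ys
    unfolding G_def using that spx spy g0 by (intro prod_nonneg) auto
  have Gint: "(\<integral>\<^sup>+ys. (\<Prod>i<n. ennreal (f (g (xs i) (ys i)))) \<partial>qn) = (\<Prod>i<n. \<integral>\<^sup>+y. ennreal (f (g (xs i) y)) \<partial>q)"
    if xs: "xs \<in> space \<mu>n" and [measurable]: "f \<in> borel_measurable borel" for xs and f :: "real \<Rightarrow> real"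
    unfolding qn_def by (rule nn_integral_PiM_prod[OF q]) (use spx[OF xs] in auto)
  have G1: "(\<integral>\<^sup>+ys. ennreal (G xs ys) \<partial>qn) = 1" if xs: "xs \<in> space \<mu>n" for xs
  proof -
    have "(\<integral>\<^sup>+ys. ennreal (G xs ys) \<partial>qn) = (\<integral>\<^sup>+ys. (\<Prod>i<n. ennreal (g (xs i) (ys i))) \<partial>qn)"
      unfolding G_def using spx[OF xs] spy g0 by (intro nn_integral_cong prod_ennreal[symmetric]) auto
    also have "\<dots> = 1" using Gint[OF xs, of "\<lambda>x. x"] spx[OF xs] g1 by simp
    finally show ?thesis .
  qed
  have Gp: "(\<integral>\<^sup>+ys. ennreal (G xs ys powr p) \<partial>qn) = ennreal (\<Phi> xs)" if xs: "xs \<in> space \<mu>n" for xs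
  proof -
    have "(\<integral>\<^sup>+ys. ennreal (G xs ys powr p) \<partial>qn) = (\<integral>\<^sup>+ys. (\<Prod>i<n. ennreal (g (xs i) (ys i) powr p)) \<partial>qn)"
    proof (rule nn_integral_cong)
      fix ys assume ys: "ys \<in> space qn"
      have "G xs ys powr p = (\<Prod>i<n. g (xs i) (ys i) powr p)"
        unfolding G_def by (rule prod_powr_distrib)
      then show "ennreal (G xs ys powr p) = (\<Prod>i<n. ennreal (g (xs i) (ys i) powr p))" by (simp add: prod_ennreal)
    qed
    also have "\<dots> = (\<Prod>i<n. ennreal (\<phi> (xs i)))" using Gint[OF xs, of "\<lambda>x. x powr p"] spx[OF xs] gp by simp
    also have "\<dots> = ennreal (\<Phi> xs)" unfolding \<Phi>_def using spx[OF xs] \<phi>0 by (intro prod_ennreal) (auto intro: less_imp_le)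
    finally show ?thesis .
  qed
  have \<Phi>0: "0 < \<Phi> xs" if "xs \<in> space \<mu>n" for xs unfolding \<Phi>_def using spx[OF that] \<phi>0 by (intro prod_pos) auto
  have cs: "(\<forall>xs\<in>space \<mu>n. L powr (1 - p) * \<Phi> xs \<le> \<tau>) \<or>
      (\<integral>\<^sup>+xs. ennreal (2 * L powr (1 / p - 1) * \<Phi> xs powr (1 / p)) \<partial>\<mu>n) \<le> ennreal \<tau>"
    using cases
  proof
    assume "\<exists>C. (\<forall>x\<in>space \<mu>. \<phi> x \<le> C) \<and> L powr (1 - p) * C ^ n \<le> \<tau>"
    then obtain C where C: "\<forall>x\<in>space \<mu>. \<phi> x \<le> C" "L powr (1 - p) * C ^ n \<le> \<tau>" by blast
    have "L powr (1 - p) * \<Phi> xs \<le> \<tau>" if xs: "xs \<in> space \<mu>n" for xs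
    proof -
      have "\<Phi> xs \<le> (\<Prod>i<n. C)" unfolding \<Phi>_def using spx[OF xs] \<phi>0 C(1) by (intro prod_mono) (auto intro: less_imp_le)
      then have "L powr (1 - p) * \<Phi> xs \<le> L powr (1 - p) * C ^ n" by (intro mult_left_mono) auto
      with C(2) show ?thesis by simp
    qed
    then show ?thesis by blast
  next
    assume "\<exists>m\<ge>0. (\<integral>\<^sup>+x. ennreal (\<phi> x powr (1 / p)) \<partial>\<mu>) \<le> ennreal m \<and> 2 * L powr (1 / p - 1) * m ^ n \<le> \<tau>"
    then obtain m where m: "m \<ge> 0" "(\<integral>\<^sup>+x. ennreal (\<phi> x powr (1 / p)) \<partial>\<mu>) \<le> ennreal m" "2 * L powr (1 / p - 1) * m ^ n \<le> \<tau>" by blast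
    \<comment> \<open>The integral over blocks is computed from the exact value \<open>m'\<close> of
      the letter integral; the bound \<open>m\<close> enters afterwards by monotonicity of the
      power.\<close>
    then obtain m' where m': "m' \<ge> 0" "m' \<le> m" "(\<integral>\<^sup>+x. ennreal (\<phi> x powr (1 / p)) \<partial>\<mu>) = ennreal m'"
      by (auto simp: le_ennreal_iff)
    have \<Phi>p: "ennreal (2 * L powr (1 / p - 1) * \<Phi> xs powr (1 / p)) = ennreal (2 * L powr (1 / p - 1)) * (\<Prod>i<n. ennreal (\<phi> (xs i) powr (1 / p)))"
      if xs: "xs \<in> space \<mu>n" for xs
    proof -
      have "\<Phi> xs powr (1 / p) = (\<Prod>i<n. \<phi> (xs i) powr (1 / p))"
        unfolding \<Phi>_def by (rule prod_powr_distrib)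
      then show ?thesis by (simp add: prod_ennreal ennreal_mult prod_nonneg)
    qed
    have "(\<integral>\<^sup>+xs. ennreal (2 * L powr (1 / p - 1) * \<Phi> xs powr (1 / p)) \<partial>\<mu>n)
       = ennreal (2 * L powr (1 / p - 1)) * (\<integral>\<^sup>+xs. (\<Prod>i<n. ennreal (\<phi> (xs i) powr (1 / p))) \<partial>\<mu>n)"
    proof (subst nn_integral_cmult[symmetric])
      show "(\<lambda>xs. \<Prod>i<n. ennreal (\<phi> (xs i) powr (1 / p))) \<in> borel_measurable \<mu>n"
        unfolding \<mu>n_def by (intro borel_measurable_prod_ennreal) measurable
    qed (intro nn_integral_cong \<Phi>p)
    also have "(\<integral>\<^sup>+xs. (\<Prod>i<n. ennreal (\<phi> (xs i) powr (1 / p))) \<partial>\<mu>n) = (\<Prod>i<n. \<integral>\<^sup>+x. ennreal (\<phi> x powr (1 / p)) \<partial>\<mu>)"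
      unfolding \<mu>n_def by (rule nn_integral_PiM_prod[OF \<mu>]) simp
    also have "\<dots> = ennreal (m' ^ n)" using m' by (simp add: ennreal_power)
    also have "ennreal (2 * L powr (1 / p - 1)) * ennreal (m' ^ n) = ennreal (2 * L powr (1 / p - 1) * m' ^ n)"
      using m' by (simp add: ennreal_mult)
    finally have eq: "(\<integral>\<^sup>+xs. ennreal (2 * L powr (1 / p - 1) * \<Phi> xs powr (1 / p)) \<partial>\<mu>n) = ennreal (2 * L powr (1 / p - 1) * m' ^ n)" .
    have "2 * L powr (1 / p - 1) * m' ^ n \<le> 2 * L powr (1 / p - 1) * m ^ n"
      using m' by (intro mult_left_mono power_mono) auto
    with m(3) show ?thesis unfolding eq by (intro disjI2 ennreal_leI) linarith
  qed
  from private_simulation[OF \<mu>n.prob_space_axioms qn.prob_space_axioms Gm G0 G1 p L M \<eta> exp_gt_zero[of \<epsilon>] d \<tau> Gp \<Phi>0 cs]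
  obtain N enc dec where cp: "code_pair (nidx n R) N \<mu>n qn enc dec"
    and ldp: "\<And>xs xs' S. xs \<in> space \<mu>n \<Longrightarrow> xs' \<in> space \<mu>n \<Longrightarrow> (\<integral>\<^sup>+ys. ennreal (G xs ys - exp \<epsilon> * G xs' ys) \<partial>qn) \<le> ennreal d \<Longrightarrow>
       S \<in> sets qn \<Longrightarrow> measure (code_kernel N enc dec xs) S - exp \<epsilon> * measure (code_kernel N enc dec xs') S
          \<le> d + (1 + exp \<epsilon>) * \<omega>"
    and tv: "\<And>E. E \<in> sets (\<mu>n \<Otimes>\<^sub>M qn) \<Longrightarrow> \<bar>(\<integral>xs. measure (code_kernel N enc dec xs) (Pair xs -` E) \<partial>\<mu>n)
       - (\<integral>xs. measure (density qn (\<lambda>ys. ennreal (G xs ys))) (Pair xs -` E) \<partial>\<mu>n)\<bar> \<le> \<omega>"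
    unfolding \<omega>_def by blast
  define R0 where "R0 = ln (real N) / real n"
  have N: "N \<ge> 1" using cp by (simp add: code_pair_def)
  have R0: "R0 \<ge> 0" "nidx n R0 = N" using N n nidx_log by (auto simp: R0_def)
  define K where "K = code_kernel N enc dec"
  have Kp: "K \<in> \<mu>n \<rightarrow>\<^sub>M prob_algebra qn" unfolding K_def by (rule code_kernel_measurable[OF cp])
  have cp': "code_pair (nidx n R) (nidx n R0) (PiM {..<n} (\<lambda>_. \<mu>)) (PiM {..<n} (\<lambda>_. q)) enc dec"
    using cp unfolding R0(2) \<mu>n_def qn_def .
  note rj = rdfc_joint_eq_kernel_joint[OF cp' MX MY R0(1), unfolded R0(2), folded \<mu>n_def qn_def]
  have eqP: "rdfc_joint n R0 MX MY \<mu> enc dec = kernel_joint \<mu>n qn K" using rj(2) by (simp add: K_def)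
  define W where "W xs = density qn (\<lambda>ys. ennreal (G xs ys))" for xs
  have Wp: "W \<in> \<mu>n \<rightarrow>\<^sub>M prob_algebra qn" unfolding W_def by (rule prob_algebra_density[OF qn.prob_space_axioms _ G1]) measurable
  have iid: "iid_joint n MX MY Q = density (\<mu>n \<Otimes>\<^sub>M qn) (\<lambda>(xs, ys). ennreal (G xs ys))"
    unfolding \<mu>n_def qn_def G_def by (rule iid_joint_density[OF \<mu> q gm g0 Qp Q MX MY])
  \<comment> \<open>The target law is also an average of slices, those of \<open>W\<close>, so total
    variation becomes a comparison of slice averages.\<close>
  have iid_e: "measure (iid_joint n MX MY Q) E = (\<integral>xs. measure (W xs) (Pair xs -` E) \<partial>\<mu>n)" if E: "E \<in> sets (\<mu>n \<Otimes>\<^sub>M qn)" for E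
  proof -
    have "emeasure (iid_joint n MX MY Q) E = (\<integral>\<^sup>+xs. \<integral>\<^sup>+ys. ennreal (G xs ys) * indicator E (xs, ys) \<partial>qn \<partial>\<mu>n)"
      unfolding iid using E by (subst emeasure_density) (auto simp: qn.nn_integral_fst[symmetric])
    also have "\<dots> = (\<integral>\<^sup>+xs. emeasure (W xs) (Pair xs -` E) \<partial>\<mu>n)"
    proof (rule nn_integral_cong)
      fix xs assume xs: "xs \<in> space \<mu>n"
      have [measurable]: "G xs \<in> borel_measurable qn" using xs Gm by measurable
      show "(\<integral>\<^sup>+ys. ennreal (G xs ys) * indicator E (xs, ys) \<partial>qn) = emeasure (W xs) (Pair xs -` E)"
        unfolding W_def using sets_Pair1[OF E] by (subst emeasure_density) (auto intro!: nn_integral_cong simp: indicator_def)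
    qed
    also have "\<dots> = emeasure (kernel_joint \<mu>n qn W) E" by (rule kernel_joint(2)[OF \<mu>n.prob_space_axioms Wp E, symmetric])
    finally show ?thesis using kernel_joint(3)[OF \<mu>n.prob_space_axioms Wp E] by (simp add: measure_def)
  qed
  have "tv_dist (rdfc_joint n R0 MX MY \<mu> enc dec) (iid_joint n MX MY Q) \<le> \<omega>"
    unfolding tv_dist_def eqP
  proof (rule cSUP_least)
    show "sets (kernel_joint \<mu>n qn K) \<noteq> {}" using sets.top by blast
    fix E assume "E \<in> sets (kernel_joint \<mu>n qn K)"
    then have E: "E \<in> sets (\<mu>n \<Otimes>\<^sub>M qn)" using kernel_joint(1)[OF \<mu>n.prob_space_axioms Kp] by (simp add: space_prob_algebra)
    show "\<bar>measure (kernel_joint \<mu>n qn K) E - measure (iid_joint n MX MY Q) E\<bar> \<le> \<omega>"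
      using tv[OF E] unfolding kernel_joint(3)[OF \<mu>n.prob_space_axioms Kp E] iid_e[OF E] unfolding K_def W_def .
  qed
  moreover have "synthesizes_ldp_n n MX MY (rdfc_joint n R0 MX MY \<mu> enc dec) \<epsilon> (d + (1 + exp \<epsilon>) * \<omega>)"
    unfolding synthesizes_ldp_n_def
  proof (intro allI impI)
    fix i assume i: "i < n"
    have "synthesizes_ldp \<mu> q (distr (kernel_joint \<mu>n qn K) (\<mu> \<Otimes>\<^sub>M q) (\<lambda>(xs, ys). (xs i, ys i))) \<epsilon> (d + (1 + exp \<epsilon>) * \<omega>)"
      unfolding \<mu>n_def qn_def
    proof (rule kernel_joint_letter_ldp[OF \<mu> q Kp[unfolded \<mu>n_def qn_def] i])
      fix xs x x' S
      assume xs: "xs \<in> space (PiM {..<n} (\<lambda>_. \<mu>))" and x: "x \<in> space \<mu>" "x' \<in> space \<mu>" and S: "S \<in> sets (PiM {..<n} (\<lambda>_. q))"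
      have upd: "xs(i := z) \<in> space \<mu>n" if "z \<in> space \<mu>" for z
        using xs that i by (auto simp: \<mu>n_def space_PiM PiE_iff extensional_def)
      show "measure (K (xs(i := x))) S - exp \<epsilon> * measure (K (xs(i := x'))) S \<le> d + (1 + exp \<epsilon>) * \<omega>"
        unfolding K_def
      proof (rule ldp[OF upd[OF x(1)] upd[OF x(2)]])
        show "(\<integral>\<^sup>+ys. ennreal (G (xs(i := x)) ys - exp \<epsilon> * G (xs(i := x')) ys) \<partial>qn) \<le> ennreal d"
          unfolding G_def qn_def by (rule neighbour_hockey_stick[OF q gx g0 g1 hs[OF x] x xs i])
        show "S \<in> sets qn" using S by (simp add: qn_def)
      qed
    qed
    then have "synthesizes_ldp MX MY (distr (kernel_joint \<mu>n qn K) (\<mu> \<Otimes>\<^sub>M q) (\<lambda>(xs, ys). (xs i, ys i))) \<epsilon> (d + (1 + exp \<epsilon>) * \<omega>)"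
      by (rule synthesizes_ldp_cong[OF MX MY])
    also have "distr (kernel_joint \<mu>n qn K) (\<mu> \<Otimes>\<^sub>M q) (\<lambda>(xs, ys). (xs i, ys i)) = distr (rdfc_joint n R0 MX MY \<mu> enc dec) (MX \<Otimes>\<^sub>M MY) (\<lambda>(xs, ys). (xs i, ys i))"
      unfolding eqP by (rule distr_cong[OF refl sets_pair_measure_cong[OF MX MY] refl])
    finally show "synthesizes_ldp MX MY (distr (rdfc_joint n R0 MX MY \<mu> enc dec) (MX \<Otimes>\<^sub>M MY) (\<lambda>(xs, ys). (xs i, ys i))) \<epsilon> (d + (1 + exp \<epsilon>) * \<omega>)" .
  qed
  ultimately show ?thesis using rj(1) by blast
qed

section \<open>The letter kernel\<close>

text \<open>Tangent line of the convex function \<open>t powr p\<close> at \<open>c\<close>, with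
  its case of equality. With \<open>c\<close> the \<open>p\<close>-th root of a mean, integration
  gives Jensen's inequality, and the equality case its strict form.\<close>

lemma young_tangent:
  fixes t c p :: real
  assumes "t \<ge> 0" "c > 0" "p > 1"
  shows "p * c powr (p - 1) * t \<le> t powr p + (p - 1) * c powr p"
    and "p * c powr (p - 1) * t = t powr p + (p - 1) * c powr p \<Longrightarrow> t = c"
proof -
  have "p * c powr (p - 1) * t \<le> t powr p + (p - 1) * c powr p \<and>
    (p * c powr (p - 1) * t = t powr p + (p - 1) * c powr p \<longrightarrow> t = c)"
  proof (cases "t = 0")
    case True
    have "(p - 1) * c powr p > 0" using assms by simp
    with True show ?thesis by auto
  next
    case False
    then have t: "t > 0" using assms by simp
    \<comment> \<open>Division by \<open>c powr p\<close> reduces the claim to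
      \<open>p * exp s \<le> exp (p * s) + (p - 1)\<close>. This is the inequality labelled
      \<open>1\<close> below plus \<open>p - 1\<close> times the one labelled
      \<open>2\<close>.\<close>
    define s where "s = ln (t / c)"
    have ts: "t = c * exp s" using t assms by (simp add: s_def)
    have tp: "t powr p = c powr p * exp (p * s)"
      using t assms by (simp add: ts powr_mult powr_def[of "exp s"])
    have ct: "c powr (p - 1) * t = c powr p * exp s" using assms by (simp add: ts powr_diff)
    have 1: "exp s * (1 + (p - 1) * s) \<le> exp (p * s)"
    proof -
      have "exp s * (1 + (p - 1) * s) \<le> exp s * exp ((p - 1) * s)" by (intro mult_left_mono exp_ge_add_one_self) auto
      also have "\<dots> = exp (p * s)" by (simp add: exp_add[symmetric] algebra_simps)
      finally show ?thesis .
    qed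
    have 2: "exp s * (1 - s) \<le> 1" using exp_ge_add_one_self[of "- s"] mult_left_mono[of "1 - s" "exp (- s)" "exp s"]
      by (simp add: exp_minus)
    have 3: "exp s * (1 - s) < 1" if "s \<noteq> 0"
    proof -
      have "1 - s < exp (- s)"
      proof (cases "s \<le> 2")
        case True
        \<comment> \<open>Squaring the linear bound at \<open>s / 2\<close> produces the extra
          \<open>s ^ 2 / 4\<close> that makes it strict; the base is nonnegative since
          \<open>s \<le> 2\<close>.\<close>
        have "(1 - s / 2) ^ 2 \<le> exp (- s / 2) ^ 2"
          using True exp_ge_add_one_self[of "- s / 2"] by (intro power_mono) auto
        also have "\<dots> = exp (- s)" by (simp flip: exp_of_nat_mult)
        finally have "1 - s + s ^ 2 / 4 \<le> exp (- s)" by (simp add: power2_eq_square algebra_simps)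
        moreover have "s ^ 2 > 0" using that by simp
        ultimately show ?thesis by linarith
      next
        case False
        then have "1 - s < 0" by simp
        also have "0 < exp (- s)" by simp
        finally show ?thesis .
      qed
      then have "exp s * (1 - s) < exp s * exp (- s)" by (intro mult_strict_left_mono) auto
      then show ?thesis by (simp add: exp_minus)
    qed
    have sum: "exp s * (1 + (p - 1) * s) + (p - 1) * (exp s * (1 - s)) = p * exp s" by (simp add: algebra_simps)
    have le: "p * exp s \<le> exp (p * s) + (p - 1)"
    proof -
      have "(p - 1) * (exp s * (1 - s)) \<le> p - 1" by (rule mult_left_le[OF 2]) (use assms in simp)
      with 1 show ?thesis unfolding sum[symmetric] by (rule add_mono)
    qed
    have lt: "p * exp s < exp (p * s) + (p - 1)" if "s \<noteq> 0"
    proof -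
      have "(p - 1) * (exp s * (1 - s)) < (p - 1) * 1" by (rule mult_strict_left_mono[OF 3[OF that]]) (use assms in simp)
      then have "(p - 1) * (exp s * (1 - s)) < p - 1" by (simp only: mult_1_right)
      with 1 show ?thesis unfolding sum[symmetric] by (rule add_le_less_mono)
    qed
    have cp: "c powr p > 0" using assms by simp
    have A: "p * c powr (p - 1) * t = c powr p * (p * exp s)" using ct by (simp add: mult.assoc mult.left_commute)
    have B: "t powr p + (p - 1) * c powr p = c powr p * (exp (p * s) + (p - 1))" unfolding tp by (simp add: algebra_simps)
    show ?thesis unfolding A B using le lt cp ts by (cases "s = 0") (auto simp: mult_le_cancel_left)
  qed
  then show "p * c powr (p - 1) * t \<le> t powr p + (p - 1) * c powr p"
    and "p * c powr (p - 1) * t = t powr p + (p - 1) * c powr p \<Longrightarrow> t = c" by auto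
qed

text \<open>A set of the product algebra is built from countably many rectangles, and the output
  sides of these generate all its sections, with one family \<open>C\<close> for every
  \<open>x\<close>.\<close>

lemma section_countably_generated:
  assumes "E \<in> sets (A \<Otimes>\<^sub>M B)"
  shows "\<exists>C. countable C \<and> C \<subseteq> sets B \<and> (\<forall>x\<in>space A. Pair x -` E \<in> sigma_sets (space B) C)"
  using assms unfolding sets_pair_measure
proof (induction rule: sigma_sets.induct)
  case (Basic E)
  then obtain a b where "E = a \<times> b" "a \<in> sets A" "b \<in> sets B" by auto
  then show ?case by (intro exI[of _ "{b}"]) (auto intro: sigma_sets.Empty)
next
  case Empty
  show ?case by (intro exI[of _ "{}"]) (auto intro: sigma_sets.Empty)
next
  case (Compl E)
  then obtain C where C: "countable C" "C \<subseteq> sets B" "\<forall>x\<in>space A. Pair x -` E \<in> sigma_sets (space B) C" by blast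
  have "Pair x -` (space A \<times> space B - E) = space B - Pair x -` E" if "x \<in> space A" for x using that by auto
  with C show ?case by (intro exI[of _ C]) (auto intro: sigma_sets.Compl)
next
  case (Union E)
  then obtain C where C: "\<And>i. countable (C i)" "\<And>i. C i \<subseteq> sets B"
    "\<And>i x. x \<in> space A \<Longrightarrow> Pair x -` E i \<in> sigma_sets (space B) (C i)" by metis
  have "Pair x -` (\<Union>i. E i) \<in> sigma_sets (space B) (\<Union>i. C i)" if x: "x \<in> space A" for x
  proof -
    have "Pair x -` E i \<in> sigma_sets (space B) (\<Union>i. C i)" for i
      using C(3)[OF x, of i] sigma_sets_mono'[of "C i" "\<Union>i. C i"] by blast
    then show ?thesis unfolding vimage_UN by (rule sigma_sets.Union)
  qed
  then show ?case using C by (intro exI[of _ "\<Union>i. C i"]) auto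
qed

text \<open>Superlevel sets at rational heights determine the function, so countably many generators
  serve all sections of \<open>f\<close> simultaneously.\<close>

lemma function_sections_countably_generated:
  fixes f :: "'a \<Rightarrow> 'b \<Rightarrow> real"
  assumes "(\<lambda>(x, y). f x y) \<in> borel_measurable (A \<Otimes>\<^sub>M B)"
  shows "\<exists>C. countable C \<and> C \<subseteq> sets B \<and> (\<forall>x\<in>space A. f x \<in> borel_measurable (sigma (space B) C))"
proof -
  define E where "E r = (\<lambda>(x, y). f x y) -` {r<..} \<inter> space (A \<Otimes>\<^sub>M B)" for r :: real
  have "E r \<in> sets (A \<Otimes>\<^sub>M B)" for r unfolding E_def by (rule measurable_sets[OF assms]) simp
  then have "\<forall>r. \<exists>C. countable C \<and> C \<subseteq> sets B \<and> (\<forall>x\<in>space A. Pair x -` E r \<in> sigma_sets (space B) C)"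
    by (intro allI section_countably_generated)
  then obtain C where C: "\<And>r. countable (C r)" "\<And>r. C r \<subseteq> sets B" "\<And>r x. x \<in> space A \<Longrightarrow> Pair x -` E r \<in> sigma_sets (space B) (C r)"
    by metis
  define D where "D = (\<Union>r\<in>\<rat>. C r)"
  have D: "countable D" "D \<subseteq> sets B" using C by (auto simp: D_def countable_rat)
  then have DP: "D \<subseteq> Pow (space B)" using sets.sets_into_space by blast
  have "f x \<in> borel_measurable (sigma (space B) D)" if x: "x \<in> space A" for x
  proof (rule borel_measurableI_greater)
    fix a :: real
    have "{y \<in> space B. a < f x y} = (\<Union>r\<in>{r\<in>\<rat>. a < r}. Pair x -` E r)"
    proof (intro set_eqI iffI)
      fix y assume y: "y \<in> {y \<in> space B. a < f x y}"
      then obtain r where "r \<in> \<rat>" "a < r" "r < f x y" using Rats_dense_in_real by auto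
      then show "y \<in> (\<Union>r\<in>{r\<in>\<rat>. a < r}. Pair x -` E r)" using y x by (auto simp: E_def space_pair_measure)
    qed (use x in \<open>auto simp: E_def space_pair_measure\<close>)
    also have "\<dots> \<in> sets (sigma (space B) D)"
    proof (rule sets.countable_UN'')
      show "countable {r\<in>\<rat>. a < r}" by (rule countable_subset[OF _ countable_rat]) auto
      fix r assume r: "r \<in> {r\<in>\<rat>. a < r}"
      then have "sigma_sets (space B) (C r) \<subseteq> sigma_sets (space B) D" by (intro sigma_sets_mono') (auto simp: D_def)
      then show "Pair x -` E r \<in> sets (sigma (space B) D)" using C(3)[OF x, of r] DP by auto
    qed
    finally show "{y \<in> space (sigma (space B) D). a < f x y} \<in> sets (sigma (space B) D)" using DP by (simp add: space_measure_of_conv)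
  qed
  with D show ?thesis by blast
qed

text \<open>As \<^term>\<open>\<nu>\<close> need not live on a countably generated algebra, the disintegration
  \<^term>\<open>W\<close> cannot be identified with the density, but it can be on the countably generated algebra
  that makes all sections of \<^term>\<open>f\<close> measurable.\<close>
lemma hockey_stick_of_disintegration:
  fixes f :: "'a \<Rightarrow> 'b \<Rightarrow> real"
  assumes \<mu>: "prob_space \<mu>" and \<nu>: "prob_space \<nu>" and fm[measurable]: "(\<lambda>(x, y). f x y) \<in> borel_measurable (\<mu> \<Otimes>\<^sub>M \<nu>)"
    and f0: "\<And>x y. 0 \<le> f x y"
    and W: "W \<in> \<mu> \<rightarrow>\<^sub>M prob_algebra \<nu>" and eq: "kernel_joint \<mu> \<nu> W = density (\<mu> \<Otimes>\<^sub>M \<nu>) (\<lambda>(x, y). ennreal (f x y))"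
    and ldp: "ldp_mechanism \<mu> \<nu> W \<epsilon> d" and d: "d \<ge> 0"
  shows "\<exists>X. (AE x in \<mu>. x \<in> X) \<and> (\<forall>x\<in>X. (\<integral>\<^sup>+y. ennreal (f x y) \<partial>\<nu>) = 1) \<and>
    (\<forall>x\<in>X. \<forall>x'\<in>X. (\<integral>\<^sup>+y. ennreal (f x y - exp \<epsilon> * f x' y) \<partial>\<nu>) \<le> ennreal d)"
proof -
  interpret \<mu>: prob_space \<mu> by fact
  interpret \<nu>: prob_space \<nu> by fact
  obtain C where C: "countable C" "C \<subseteq> sets \<nu>" and fC: "\<And>x. x \<in> space \<mu> \<Longrightarrow> f x \<in> borel_measurable (sigma (space \<nu>) C)"
    using function_sections_countably_generated[OF fm] by blast
  have CP: "C \<subseteq> Pow (space \<nu>)" using C(2) sets.sets_into_space by blast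
  \<comment> \<open>Closing \<open>C\<close> under finite intersections keeps it countable and
    yields a generator on which two measures can be compared.\<close>
  define D where "D = (\<lambda>F. \<Inter>F \<inter> space \<nu>) ` {F. finite F \<and> F \<subseteq> C}"
  have Dc: "countable D" unfolding D_def by (intro countable_image countable_Collect_finite_subset C)
  have Ds: "D \<subseteq> sets \<nu>"
  proof
    fix S assume "S \<in> D"
    then obtain F where F: "finite F" "F \<subseteq> C" "S = \<Inter>F \<inter> space \<nu>" by (auto simp: D_def)
    have "\<Inter>F \<inter> space \<nu> \<in> sets \<nu>" using F(1,2)
    proof (induction F)
      case (insert A F)
      then have "A \<in> sets \<nu>" "\<Inter>F \<inter> space \<nu> \<in> sets \<nu>" using C(2) by auto
      then have "A \<inter> (\<Inter>F \<inter> space \<nu>) \<in> sets \<nu>" by auto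
      then show ?case by (simp add: Int_assoc)
    qed simp
    with F show "S \<in> sets \<nu>" by simp
  qed
  have DP: "D \<subseteq> Pow (space \<nu>)" using Ds sets.sets_into_space by blast
  have Di: "Int_stable D"
  proof (rule Int_stableI)
    fix a b assume "a \<in> D" "b \<in> D"
    then obtain F G where "finite F" "F \<subseteq> C" "a = \<Inter>F \<inter> space \<nu>" "finite G" "G \<subseteq> C" "b = \<Inter>G \<inter> space \<nu>" by (auto simp: D_def)
    then show "a \<inter> b \<in> D" unfolding D_def by (intro image_eqI[of _ _ "F \<union> G"]) auto
  qed
  have CD: "C \<subseteq> D"
  proof
    fix S assume S: "S \<in> C"
    then have "S = \<Inter>{S} \<inter> space \<nu>" using CP by auto
    then show "S \<in> D" unfolding D_def using S by (intro image_eqI[of _ _ "{S}"]) auto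
  qed
  have Wp: "prob_space (W x)" and Ws: "sets (W x) = sets \<nu>" if "x \<in> space \<mu>" for x
    using measurable_space[OF W that] by (auto simp: space_prob_algebra)
  define V where "V x S = (\<integral>\<^sup>+y\<in>S. ennreal (f x y) \<partial>\<nu>)" for x S
  \<comment> \<open>For a fixed event the kernels agree almost everywhere, as both sides are
    densities of the same measure on inputs; the exceptional null set depends on
    \<open>S\<close>.\<close>
  have ae1: "AE x in \<mu>. emeasure (W x) S = V x S" if S[measurable]: "S \<in> sets \<nu>" for S
  proof (rule \<mu>.density_unique)
    show Wm: "(\<lambda>x. emeasure (W x) S) \<in> borel_measurable \<mu>"
      by (rule measurable_compose[OF measurable_prob_algebraD[OF W]]) measurable
    show Vm: "(\<lambda>x. V x S) \<in> borel_measurable \<mu>" unfolding V_def by measurable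
    show "density \<mu> (\<lambda>x. emeasure (W x) S) = density \<mu> (\<lambda>x. V x S)"
    proof (rule measure_eqI)
      fix A assume "A \<in> sets (density \<mu> (\<lambda>x. emeasure (W x) S))"
      then have A[measurable]: "A \<in> sets \<mu>" by simp
      have "emeasure (density \<mu> (\<lambda>x. emeasure (W x) S)) A = (\<integral>\<^sup>+x. emeasure (W x) S * indicator A x \<partial>\<mu>)"
        by (rule emeasure_density) (use Wm in auto)
      also have "\<dots> = (\<integral>\<^sup>+x. emeasure (W x) (Pair x -` (A \<times> S)) \<partial>\<mu>)"
        by (intro nn_integral_cong) (auto simp: indicator_def)
      also have "\<dots> = emeasure (kernel_joint \<mu> \<nu> W) (A \<times> S)" by (rule kernel_joint(2)[OF \<mu> W, symmetric]) simp
      also have "\<dots> = (\<integral>\<^sup>+x. \<integral>\<^sup>+y. ennreal (f x y) * indicator (A \<times> S) (x, y) \<partial>\<nu> \<partial>\<mu>)"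
        unfolding eq by (subst emeasure_density) (auto simp: \<nu>.nn_integral_fst[symmetric])
      also have "\<dots> = (\<integral>\<^sup>+x. V x S * indicator A x \<partial>\<mu>)"
        by (intro nn_integral_cong) (auto simp: V_def indicator_def)
      also have "\<dots> = emeasure (density \<mu> (\<lambda>x. V x S)) A" by (rule emeasure_density[symmetric]) (use Vm in auto)
      finally show "emeasure (density \<mu> (\<lambda>x. emeasure (W x) S)) A = emeasure (density \<mu> (\<lambda>x. V x S)) A" .
    qed simp
  qed
  \<comment> \<open>Countably many events share one null set, outside of which the agreement spreads
    from \<open>D\<close> to the whole algebra generated by \<open>C\<close>.\<close>
  have "AE x in \<mu>. \<forall>S\<in>insert (space \<nu>) D. emeasure (W x) S = V x S"
    using Dc Ds by (intro AE_ball_countable') (auto intro: ae1)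
  then have ae: "AE x in \<mu>. x \<in> space \<mu> \<and> (\<forall>S\<in>insert (space \<nu>) D. emeasure (W x) S = V x S)" by auto
  define X where "X = {x\<in>space \<mu>. \<forall>S\<in>insert (space \<nu>) D. emeasure (W x) S = V x S}"
  have X1: "(\<integral>\<^sup>+y. ennreal (f x y) \<partial>\<nu>) = 1" if "x \<in> X" for x
  proof -
    have x: "x \<in> space \<mu>" using that by (simp add: X_def)
    have "(\<integral>\<^sup>+y. ennreal (f x y) \<partial>\<nu>) = V x (space \<nu>)" unfolding V_def by (intro nn_integral_cong) (simp add: indicator_def)
    also have "\<dots> = emeasure (W x) (space \<nu>)" using that by (simp add: X_def)
    also have "\<dots> = 1" using prob_space.emeasure_space_1[OF Wp[OF x]] sets_eq_imp_space_eq[OF Ws[OF x]] by simp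
    finally show ?thesis .
  qed
  \<comment> \<open>Induction over the generated algebra; complements work because both sides have
    total mass one, by \<open>X1\<close>.\<close>
  have XC: "emeasure (W x) S = V x S" if x: "x \<in> X" and S: "S \<in> sigma_sets (space \<nu>) C" for x S
  proof -
    have xm: "x \<in> space \<mu>" using x by (simp add: X_def)
    interpret Wx: prob_space "W x" by (rule Wp[OF xm])
    have [measurable]: "f x \<in> borel_measurable \<nu>" using xm by measurable
    have sub: "sigma_sets (space \<nu>) D \<subseteq> sets \<nu>" using sets.sigma_sets_subset[OF Ds] .
    have "S \<in> sigma_sets (space \<nu>) D" using S sigma_sets_mono'[OF CD] by blast
    with Di DP show ?thesis
    proof (induction rule: sigma_sets_induct_disjoint)
      case (basic S) then show ?case using x by (simp add: X_def)
    next
      case empty show ?case by (simp add: V_def)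
    next
      case (compl S)
      then have [measurable]: "S \<in> sets \<nu>" using sub by auto
      have "V x S + V x (space \<nu> - S) = (\<integral>\<^sup>+y. ennreal (f x y) * indicator S y + ennreal (f x y) * indicator (space \<nu> - S) y \<partial>\<nu>)"
        unfolding V_def by (rule nn_integral_add[symmetric]) measurable
      also have "\<dots> = (\<integral>\<^sup>+y. ennreal (f x y) \<partial>\<nu>)" by (intro nn_integral_cong) (auto simp: indicator_def)
      finally have 1: "emeasure (W x) S + V x (space \<nu> - S) = 1" using X1[OF x] compl by simp
      have "emeasure (W x) S + emeasure (W x) (space \<nu> - S) = 1"
        using emeasure_Un_Int[of S "W x" "space \<nu> - S"] Wx.emeasure_space_1 sets_eq_imp_space_eq[OF Ws[OF xm]]
          sets.sets_into_space[of S \<nu>] by (auto simp: Ws[OF xm] Un_absorb1)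
      with 1 have "emeasure (W x) S + V x (space \<nu> - S) = emeasure (W x) S + emeasure (W x) (space \<nu> - S)" by simp
      then show ?case unfolding ennreal_add_left_cancel by auto
    next
      case (union A)
      then have A: "range A \<subseteq> sets \<nu>" using sub by auto
      then have [measurable]: "A i \<in> sets \<nu>" for i by auto
      have "emeasure (W x) (\<Union> (range A)) = (\<Sum>i. emeasure (W x) (A i))"
        using union A by (intro suminf_emeasure[symmetric]) (auto simp: Ws[OF xm])
      also have "\<dots> = (\<Sum>i. emeasure (density \<nu> (\<lambda>y. ennreal (f x y))) (A i))"
        using union by (simp add: V_def emeasure_density)
      also have "\<dots> = emeasure (density \<nu> (\<lambda>y. ennreal (f x y))) (\<Union> (range A))"
        using union A by (intro suminf_emeasure) auto
      also have "\<dots> = V x (\<Union> (range A))" unfolding V_def by (rule emeasure_density) auto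
      finally show ?case .
    qed
  qed
  have hs: "(\<integral>\<^sup>+y. ennreal (f x y - exp \<epsilon> * f x' y) \<partial>\<nu>) \<le> ennreal d" if x: "x \<in> X" "x' \<in> X" for x x'
  proof -
    have xm: "x \<in> space \<mu>" "x' \<in> space \<mu>" using x by (auto simp: X_def)
    have [measurable]: "f x \<in> borel_measurable \<nu>" "f x' \<in> borel_measurable \<nu>" using xm by measurable
    \<comment> \<open>The event on which the hockey-stick divergence is attained. Both sections are
      measurable for the generated algebra, so it lies there and the bound for \<open>W\<close>
      transfers to the densities.\<close>
    define S where "S = {y\<in>space \<nu>. exp \<epsilon> * f x' y < f x y}"
    have Sm[measurable]: "S \<in> sets \<nu>" unfolding S_def by measurable
    have "S \<in> sigma_sets (space \<nu>) C"
    proof -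
      have [measurable]: "f x \<in> borel_measurable (sigma (space \<nu>) C)" "f x' \<in> borel_measurable (sigma (space \<nu>) C)"
        using fC xm by auto
      have "{y\<in>space (sigma (space \<nu>) C). exp \<epsilon> * f x' y < f x y} \<in> sets (sigma (space \<nu>) C)" by measurable
      then show ?thesis using CP by (simp add: S_def space_measure_of_conv)
    qed
    note WV = XC[OF x(1) this] XC[OF x(2) this]
    interpret W1: prob_space "W x" by (rule Wp[OF xm(1)])
    interpret W2: prob_space "W x'" by (rule Wp[OF xm(2)])
    have le: "measure (W x) S \<le> d + exp \<epsilon> * measure (W x') S"
      using ldp xm Sm unfolding ldp_mechanism_def by (auto simp: algebra_simps)
    have "(\<integral>\<^sup>+y. ennreal (f x y - exp \<epsilon> * f x' y) \<partial>\<nu>) + ennreal (exp \<epsilon>) * V x' S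
      = (\<integral>\<^sup>+y. ennreal (f x y - exp \<epsilon> * f x' y) + ennreal (exp \<epsilon>) * (ennreal (f x' y) * indicator S y) \<partial>\<nu>)"
      unfolding V_def by (subst nn_integral_cmult[symmetric], measurable, rule nn_integral_add[symmetric]) measurable
    also have "\<dots> = V x S"
      unfolding V_def
    proof (rule nn_integral_cong)
      fix y assume y: "y \<in> space \<nu>"
      show "ennreal (f x y - exp \<epsilon> * f x' y) + ennreal (exp \<epsilon>) * (ennreal (f x' y) * indicator S y) = ennreal (f x y) * indicator S y"
      proof (cases "y \<in> S")
        case True
        have "ennreal (f x y - exp \<epsilon> * f x' y) + ennreal (exp \<epsilon> * f x' y) = ennreal (f x y)"
          using True f0[of x' y] by (subst ennreal_plus[symmetric]) (auto simp: S_def)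
        then show ?thesis using True f0[of x' y] by (simp add: ennreal_mult)
      qed (use y in \<open>auto simp: S_def ennreal_neg\<close>)
    qed
    also have "\<dots> = ennreal (measure (W x) S)" unfolding WV(1)[symmetric] by (rule W1.emeasure_eq_measure)
    also have "\<dots> \<le> ennreal (d + exp \<epsilon> * measure (W x') S)" by (rule ennreal_leI[OF le])
    also have "\<dots> = ennreal d + ennreal (exp \<epsilon>) * V x' S"
      unfolding WV(2)[symmetric] W2.emeasure_eq_measure using d by (simp add: ennreal_mult ennreal_plus)
    finally have "ennreal (exp \<epsilon>) * V x' S + (\<integral>\<^sup>+y. ennreal (f x y - exp \<epsilon> * f x' y) \<partial>\<nu>) \<le> ennreal (exp \<epsilon>) * V x' S + ennreal d"
      by (simp add: add.commute)
    moreover have "ennreal (exp \<epsilon>) * V x' S \<noteq> \<top>" unfolding WV(2)[symmetric] W2.emeasure_eq_measure by (simp add: ennreal_mult_eq_top_iff)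
    ultimately show ?thesis unfolding ennreal_add_left_cancel_le by auto
  qed
  show ?thesis by (rule exI[of _ X]) (use ae X1 hs in \<open>auto simp: X_def\<close>)
qed

text \<open>Sibson's minimiser: with the output law tilted by \<^term>\<open>w\<close>, the \<^term>\<open>p\<close>-th moment of the density
  is \<^term>\<open>Z powr p\<close>.\<close>
lemma tilted_kernel:
  fixes f :: "'a \<Rightarrow> 'b \<Rightarrow> real"
  defines "mom \<equiv> \<lambda>\<mu> p y. \<integral>\<^sup>+x. ennreal (f x y powr p) \<partial>\<mu>"
  assumes \<mu>: "prob_space \<mu>" and \<nu>: "prob_space \<nu>" and fm[measurable]: "(\<lambda>(x, y). f x y) \<in> borel_measurable (\<mu> \<Otimes>\<^sub>M \<nu>)"
    and f0: "\<And>x y. 0 \<le> f x y" and Qp: "prob_space Q" and Q: "Q = density (\<mu> \<Otimes>\<^sub>M \<nu>) (\<lambda>(x, y). ennreal (f x y))"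
    and marg: "distr Q \<nu> snd = \<nu>" and p: "p > 1"
    and outer: "(\<integral>\<^sup>+y. (if mom \<mu> p y = \<top> then \<top> else ennreal (enn2real (mom \<mu> p y) powr (1 / p))) \<partial>\<nu>) = ennreal Z" "Z \<ge> 0"
  shows "Z > 0 \<and> (\<exists>q g. prob_space q \<and> sets q = sets \<nu> \<and> (\<lambda>(x, y). g x y) \<in> borel_measurable (\<mu> \<Otimes>\<^sub>M q) \<and>
     (\<forall>x y. 0 \<le> g x y) \<and> Q = density (\<mu> \<Otimes>\<^sub>M q) (\<lambda>(x, y). ennreal (g x y)) \<and>
     (\<forall>x\<in>space \<mu>. (\<integral>\<^sup>+y. ennreal (g x y) \<partial>q) = (\<integral>\<^sup>+y. ennreal (f x y) \<partial>\<nu>)) \<and>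
     (\<forall>x\<in>space \<mu>. \<forall>x'\<in>space \<mu>. \<forall>c. (\<integral>\<^sup>+y. ennreal (g x y - c * g x' y) \<partial>q) = (\<integral>\<^sup>+y. ennreal (f x y - c * f x' y) \<partial>\<nu>)) \<and>
     (\<integral>\<^sup>+x. \<integral>\<^sup>+y. ennreal (g x y powr p) \<partial>q \<partial>\<mu>) = ennreal (Z powr p))"
proof -
  interpret \<mu>: prob_space \<mu> by fact
  interpret \<nu>: prob_space \<nu> by fact
  interpret Q: prob_space Q by fact
  interpret \<mu>\<nu>: pair_prob_space \<mu> \<nu> ..
  define i where "i y = mom \<mu> p y" for y
  \<comment> \<open>Up to normalisation, the density of Sibson's minimiser with respect to
    \<open>\<nu>\<close>. A point of infinite moment gets the junk value 0, and such points are
    negligible by \<open>fin\<close>.\<close>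
  define w where "w y = enn2real (i y) powr (1 / p)" for y
  have im[measurable]: "i \<in> borel_measurable \<nu>" unfolding i_def mom_def by measurable
  have wm[measurable]: "w \<in> borel_measurable \<nu>" unfolding w_def by measurable
  have outer': "(\<integral>\<^sup>+y. (if i y = \<top> then \<top> else ennreal (w y)) \<partial>\<nu>) = ennreal Z"
    unfolding w_def i_def by (rule outer(1))
  have "AE y in \<nu>. (if i y = \<top> then \<top> else ennreal (w y)) \<noteq> \<infinity>"
    by (rule nn_integral_PInf_AE) (use outer' in auto)
  then have fin: "AE y in \<nu>. i y \<noteq> \<top>" by (rule AE_mp) (auto split: if_splits)
  \<comment> \<open>A vanishing moment forces the joint density to vanish almost everywhere on that
    fibre, and \<open>\<nu>\<close>, being the output marginal of \<open>Q\<close>, gives such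
    fibres no mass.\<close>
  have pos: "AE y in \<nu>. i y \<noteq> 0"
  proof -
    define T where "T = {y\<in>space \<nu>. i y = 0}"
    have [measurable]: "T \<in> sets \<nu>" unfolding T_def by measurable
    have sQ: "sets Q = sets (\<mu> \<Otimes>\<^sub>M \<nu>)" by (simp add: Q)
    have "emeasure \<nu> T = emeasure (distr Q \<nu> snd) T" by (simp only: marg)
    also have "\<dots> = emeasure Q (snd -` T \<inter> space Q)" by (rule emeasure_distr) (auto simp: measurable_cong_sets[OF sQ refl])
    also have "snd -` T \<inter> space Q = space \<mu> \<times> T"
      unfolding sets_eq_imp_space_eq[OF sQ] by (auto simp: space_pair_measure T_def)
    also have "emeasure Q (space \<mu> \<times> T) = (\<integral>\<^sup>+z. (case z of (x, y) \<Rightarrow> ennreal (f x y)) * indicator (space \<mu> \<times> T) z \<partial>(\<mu> \<Otimes>\<^sub>M \<nu>))"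
      unfolding Q by (rule emeasure_density) auto
    also have "\<dots> = (\<integral>\<^sup>+y. \<integral>\<^sup>+x. ennreal (f x y) * indicator (space \<mu> \<times> T) (x, y) \<partial>\<mu> \<partial>\<nu>)"
      by (subst \<mu>\<nu>.nn_integral_snd[symmetric]) auto
    also have "\<dots> = (\<integral>\<^sup>+y. 0 \<partial>\<nu>)"
    proof (rule nn_integral_cong)
      fix y assume y: "y \<in> space \<nu>"
      have [measurable]: "(\<lambda>x. f x y) \<in> borel_measurable \<mu>" using y by measurable
      show "(\<integral>\<^sup>+x. ennreal (f x y) * indicator (space \<mu> \<times> T) (x, y) \<partial>\<mu>) = 0"
      proof (cases "y \<in> T")
        case True
        then have "(\<integral>\<^sup>+x. ennreal (f x y powr p) \<partial>\<mu>) = 0" by (simp add: T_def i_def mom_def)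
        then have "AE x in \<mu>. ennreal (f x y powr p) = 0" by (subst (asm) nn_integral_0_iff_AE) auto
        then have "AE x in \<mu>. ennreal (f x y) * indicator (space \<mu> \<times> T) (x, y) = 0"
          by (rule AE_mp) (auto simp: ennreal_eq_0_iff powr_nonneg_iff)
        then show ?thesis by (subst nn_integral_0_iff_AE) auto
      qed simp
    qed
    finally have "emeasure \<nu> T = 0" by simp
    then have "AE y in \<nu>. y \<notin> T" by (intro AE_not_in null_setsI) auto
    then show ?thesis by (rule AE_mp) (auto simp: T_def intro!: AE_I2)
  qed
  have good: "AE y in \<nu>. y \<in> space \<nu> \<and> 0 < w y \<and> i y = ennreal (w y powr p)"
    using fin pos AE_space
  proof eventually_elim
    case (elim y)
    then obtain r where r: "i y = ennreal r" "r > 0" by (cases "i y") auto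
    then show ?case using p elim(3) by (auto simp: w_def powr_powr)
  qed
  then have wpos: "AE y in \<nu>. 0 < w y" by (rule AE_mp) auto
  have wint: "(\<integral>\<^sup>+y. ennreal (w y) \<partial>\<nu>) = ennreal Z"
    unfolding outer'[symmetric] by (intro nn_integral_cong_AE) (use fin in eventually_elim, auto)
  have Z: "Z > 0"
  proof (rule ccontr)
    assume "\<not> Z > 0"
    then have "(\<integral>\<^sup>+y. ennreal (w y) \<partial>\<nu>) = 0" using wint outer(2) by simp
    then have "AE y in \<nu>. ennreal (w y) = 0" by (subst (asm) nn_integral_0_iff_AE) auto
    with wpos have "AE y in \<nu>. False" by eventually_elim (auto simp: ennreal_eq_0_iff)
    then show False by (simp add: \<nu>.AE_False)
  qed
  define q where "q = density \<nu> (\<lambda>y. ennreal (w y / Z))"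
  \<comment> \<open>The factor \<open>w / Z\<close> moves from the density to the output law. Where
    \<open>w\<close> vanishes this loses information, but \<open>wpos\<close> makes that a null set,
    so integrals of expressions homogeneous of degree one, such as the divergences, are
    unchanged.\<close>
  define g where "g x y = f x y * Z / w y" for x y
  have w0: "0 \<le> w y" for y by (simp add: w_def)
  have qs[measurable_cong]: "sets q = sets \<nu>" by (simp add: q_def)
  have qp: "prob_space q"
  proof (rule prob_spaceI)
    have "emeasure q (space q) = (\<integral>\<^sup>+y. ennreal (w y / Z) \<partial>\<nu>)" unfolding q_def by (simp add: emeasure_density cong: nn_integral_cong)
    also have "\<dots> = (\<integral>\<^sup>+y. ennreal (1 / Z) * ennreal (w y) \<partial>\<nu>)" using Z w0 by (intro nn_integral_cong) (simp add: ennreal_mult[symmetric])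
    also have "\<dots> = ennreal (1 / Z) * ennreal Z" by (subst nn_integral_cmult) (auto simp: wint)
    also have "\<dots> = 1" using Z by (simp add: ennreal_mult[symmetric])
    finally show "emeasure q (space q) = 1" .
  qed
  interpret q: prob_space q by (rule qp)
  have gm[measurable]: "(\<lambda>(x, y). g x y) \<in> borel_measurable (\<mu> \<Otimes>\<^sub>M \<nu>)" unfolding g_def by measurable
  have gm': "(\<lambda>(x, y). g x y) \<in> borel_measurable (\<mu> \<Otimes>\<^sub>M q)"
    using gm by (simp add: measurable_cong_sets[OF sets_pair_measure_cong[OF refl qs] refl])
  have g0: "0 \<le> g x y" for x y using f0 w0 Z by (simp add: g_def)
  have qint: "(\<integral>\<^sup>+y. h y \<partial>q) = (\<integral>\<^sup>+y. ennreal (w y / Z) * h y \<partial>\<nu>)" if "h \<in> borel_measurable \<nu>" for h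
    unfolding q_def by (rule nn_integral_density) (use that in auto)
  have fx[measurable]: "f x \<in> borel_measurable \<nu>" "g x \<in> borel_measurable \<nu>" if "x \<in> space \<mu>" for x using that by measurable
  have g1: "(\<integral>\<^sup>+y. ennreal (g x y) \<partial>q) = (\<integral>\<^sup>+y. ennreal (f x y) \<partial>\<nu>)" if x: "x \<in> space \<mu>" for x
  proof (subst qint)
    show "(\<integral>\<^sup>+y. ennreal (w y / Z) * ennreal (g x y) \<partial>\<nu>) = (\<integral>\<^sup>+y. ennreal (f x y) \<partial>\<nu>)"
      by (intro nn_integral_cong_AE) (use wpos in eventually_elim, use Z f0 in \<open>auto simp: g_def ennreal_mult[symmetric]\<close>)
  qed (use x in measurable)
  have ghs: "(\<integral>\<^sup>+y. ennreal (g x y - c * g x' y) \<partial>q) = (\<integral>\<^sup>+y. ennreal (f x y - c * f x' y) \<partial>\<nu>)"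
    if x: "x \<in> space \<mu>" "x' \<in> space \<mu>" for x x' c
  proof (subst qint)
    show "(\<lambda>y. ennreal (g x y - c * g x' y)) \<in> borel_measurable \<nu>" using x by measurable
    show "(\<integral>\<^sup>+y. ennreal (w y / Z) * ennreal (g x y - c * g x' y) \<partial>\<nu>) = (\<integral>\<^sup>+y. ennreal (f x y - c * f x' y) \<partial>\<nu>)"
    proof (intro nn_integral_cong_AE, use wpos in eventually_elim)
      fix y assume w: "0 < w y"
      have "ennreal (w y / Z) * ennreal (g x y - c * g x' y) = ennreal (w y / Z * (g x y - c * g x' y))"
        by (rule ennreal_mult'[symmetric]) (use w Z in simp)
      also have "w y / Z * (g x y - c * g x' y) = f x y - c * f x' y" using w Z by (simp add: g_def right_diff_distrib)
      finally show "ennreal (w y / Z) * ennreal (g x y - c * g x' y) = ennreal (f x y - c * f x' y)" .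
    qed
  qed
  have Qg: "Q = density (\<mu> \<Otimes>\<^sub>M q) (\<lambda>(x, y). ennreal (g x y))"
  proof (rule measure_eqI)
    have sQ: "sets Q = sets (\<mu> \<Otimes>\<^sub>M \<nu>)" by (simp add: Q)
    then show "sets Q = sets (density (\<mu> \<Otimes>\<^sub>M q) (\<lambda>(x, y). ennreal (g x y)))" by (simp add: sets_pair_measure_cong[OF refl qs])
    fix E assume "E \<in> sets Q"
    then have E[measurable]: "E \<in> sets (\<mu> \<Otimes>\<^sub>M \<nu>)" by (simp add: sQ)
    then have E': "E \<in> sets (\<mu> \<Otimes>\<^sub>M q)" by (simp add: sets_pair_measure_cong[OF refl qs])
    have "emeasure (density (\<mu> \<Otimes>\<^sub>M q) (\<lambda>(x, y). ennreal (g x y))) E = (\<integral>\<^sup>+z. (case z of (x, y) \<Rightarrow> ennreal (g x y)) * indicator E z \<partial>(\<mu> \<Otimes>\<^sub>M q))"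
      using gm' E' by (subst emeasure_density) auto
    also have "\<dots> = (\<integral>\<^sup>+x. \<integral>\<^sup>+y. ennreal (g x y) * indicator E (x, y) \<partial>q \<partial>\<mu>)"
      using gm' E' by (subst q.nn_integral_fst[symmetric]) auto
    also have "\<dots> = (\<integral>\<^sup>+x. \<integral>\<^sup>+y. ennreal (f x y) * indicator E (x, y) \<partial>\<nu> \<partial>\<mu>)"
    proof (rule nn_integral_cong)
      fix x assume x: "x \<in> space \<mu>"
      have [measurable]: "(\<lambda>y. indicator E (x, y) :: ennreal) \<in> borel_measurable \<nu>" using x by measurable
      show "(\<integral>\<^sup>+y. ennreal (g x y) * indicator E (x, y) \<partial>q) = (\<integral>\<^sup>+y. ennreal (f x y) * indicator E (x, y) \<partial>\<nu>)"
      proof (subst qint)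
        show "(\<lambda>y. ennreal (g x y) * indicator E (x, y)) \<in> borel_measurable \<nu>" using x by measurable
        show "(\<integral>\<^sup>+y. ennreal (w y / Z) * (ennreal (g x y) * indicator E (x, y)) \<partial>\<nu>) = (\<integral>\<^sup>+y. ennreal (f x y) * indicator E (x, y) \<partial>\<nu>)"
          by (intro nn_integral_cong_AE) (use wpos in eventually_elim, use Z f0 in \<open>auto simp: g_def indicator_def ennreal_mult[symmetric]\<close>)
      qed
    qed
    also have "\<dots> = emeasure Q E" unfolding Q by (subst emeasure_density) (auto simp: \<nu>.nn_integral_fst[symmetric])
    finally show "emeasure Q E = emeasure (density (\<mu> \<Otimes>\<^sub>M q) (\<lambda>(x, y). ennreal (g x y))) E" by simp
  qed
  have gp: "(\<integral>\<^sup>+x. \<integral>\<^sup>+y. ennreal (g x y powr p) \<partial>q \<partial>\<mu>) = ennreal (Z powr p)"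
  proof -
    have "(\<integral>\<^sup>+x. \<integral>\<^sup>+y. ennreal (g x y powr p) \<partial>q \<partial>\<mu>) = (\<integral>\<^sup>+x. \<integral>\<^sup>+y. ennreal (w y / Z) * ennreal (g x y powr p) \<partial>\<nu> \<partial>\<mu>)"
      by (intro nn_integral_cong qint) measurable
    also have "\<dots> = (\<integral>\<^sup>+y. \<integral>\<^sup>+x. ennreal (w y / Z) * ennreal (g x y powr p) \<partial>\<mu> \<partial>\<nu>)"
      by (rule \<mu>\<nu>.Fubini'[symmetric]) measurable
    \<comment> \<open>The powers of \<open>w\<close> collapse to \<open>w\<close> itself because
      \<open>w powr p\<close> is the moment \<open>i\<close>; this is the purpose of the choice of
      \<open>w\<close>.\<close>
    also have "\<dots> = (\<integral>\<^sup>+y. ennreal (Z powr (p - 1)) * ennreal (w y) \<partial>\<nu>)"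
    proof (intro nn_integral_cong_AE, use good in eventually_elim)
      fix y assume w: "y \<in> space \<nu> \<and> 0 < w y \<and> i y = ennreal (w y powr p)"
      have "(\<integral>\<^sup>+x. ennreal (w y / Z) * ennreal (g x y powr p) \<partial>\<mu>) = (\<integral>\<^sup>+x. ennreal (Z powr (p - 1) * w y powr (1 - p)) * ennreal (f x y powr p) \<partial>\<mu>)"
      proof (intro nn_integral_cong)
        fix x
        have "w y / Z * (f x y * Z / w y) powr p = Z powr (p - 1) * w y powr (1 - p) * f x y powr p"
          using w Z f0[of x y] by (simp add: powr_mult powr_divide powr_diff)
        then show "ennreal (w y / Z) * ennreal (g x y powr p) = ennreal (Z powr (p - 1) * w y powr (1 - p)) * ennreal (f x y powr p)"
          using w Z by (simp add: g_def ennreal_mult[symmetric])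
      qed
      also have "\<dots> = ennreal (Z powr (p - 1) * w y powr (1 - p)) * i y"
      proof -
        have "y \<in> space \<nu>" using w by simp
        then have [measurable]: "(\<lambda>x. f x y) \<in> borel_measurable \<mu>" by measurable
        show ?thesis unfolding i_def mom_def by (rule nn_integral_cmult) measurable
      qed
      also have "\<dots> = ennreal (Z powr (p - 1)) * ennreal (w y)"
      proof -
        have "w y powr (1 - p) * w y powr p = w y" using w by (simp add: powr_add[symmetric])
        then show ?thesis using w by (simp add: ennreal_mult[symmetric] mult.assoc)
      qed
      finally show "(\<integral>\<^sup>+x. ennreal (w y / Z) * ennreal (g x y powr p) \<partial>\<mu>) = ennreal (Z powr (p - 1)) * ennreal (w y)" .
    qed
    also have "\<dots> = ennreal (Z powr (p - 1)) * ennreal Z" by (subst nn_integral_cmult) (auto simp: wint)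
    also have "\<dots> = ennreal (Z powr p)" using Z by (simp add: ennreal_mult[symmetric] powr_diff)
    finally show ?thesis .
  qed
  show ?thesis using Z qp qs gm' g0 Qg g1 ghs gp by blast
qed

section \<open>Mutual information below the rate\<close>

text \<open>Dominates the difference quotients of \<open>exp (t * x)\<close> at zero by exponentials
  with parameters \<open>\<tau>\<close> and \<open>- \<tau>\<close>. The condition
  \<open>t \<le> \<tau> / 2\<close> keeps half of the exponent in reserve, and this half absorbs the
  factor \<open>\<bar>x\<bar>\<close>.\<close>

lemma exp_diff_quotient_bound:
  fixes x :: real
  assumes "\<tau> > 0" "t > 0" "t \<le> \<tau> / 2"
  shows "\<bar>(exp (t * x) - 1) / t\<bar> \<le> 2 / \<tau> * (exp (\<tau> * x) + exp (- \<tau> * x))"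
proof -
  have 1: "\<bar>exp u - 1\<bar> \<le> \<bar>u\<bar> * exp \<bar>u\<bar>" for u :: real
  proof (cases "u \<ge> 0")
    case True
    have "exp u * (1 - u) \<le> exp u * exp (- u)" using exp_ge_add_one_self[of "- u"] by (intro mult_left_mono) auto
    then have "exp u * (1 - u) \<le> 1" by (simp add: exp_minus)
    then have "exp u - 1 \<le> u * exp u" by (simp add: right_diff_distrib mult.commute)
    then show ?thesis using True by (simp add: abs_of_nonneg)
  next
    case False
    have "1 - exp u \<le> - u * 1" using exp_ge_add_one_self[of u] by linarith
    also have "\<dots> \<le> - u * exp (- u)" using False by (intro mult_left_mono) auto
    finally show ?thesis using False by simp
  qed
  have "\<bar>(exp (t * x) - 1) / t\<bar> = \<bar>exp (t * x) - 1\<bar> / t" using assms by simp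
  also have "\<dots> \<le> \<bar>t * x\<bar> * exp \<bar>t * x\<bar> / t" using assms 1 by (intro divide_right_mono) auto
  also have "\<dots> = \<bar>x\<bar> * exp (t * \<bar>x\<bar>)" using assms by (simp add: abs_mult)
  also have "\<dots> \<le> (2 / \<tau> * exp (\<tau> / 2 * \<bar>x\<bar>)) * exp (\<tau> / 2 * \<bar>x\<bar>)"
  proof (intro mult_mono)
    have "\<tau> / 2 * \<bar>x\<bar> \<le> exp (\<tau> / 2 * \<bar>x\<bar>)" using exp_ge_add_one_self[of "\<tau> / 2 * \<bar>x\<bar>"] by linarith
    then show "\<bar>x\<bar> \<le> 2 / \<tau> * exp (\<tau> / 2 * \<bar>x\<bar>)" using assms by (simp add: field_simps)
    show "exp (t * \<bar>x\<bar>) \<le> exp (\<tau> / 2 * \<bar>x\<bar>)" using assms mult_right_mono[OF assms(3), of "\<bar>x\<bar>"] by simp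
  qed (use assms in auto)
  also have "\<dots> = 2 / \<tau> * exp (\<tau> * \<bar>x\<bar>)" by (simp add: mult.assoc exp_add[symmetric])
  also have "\<dots> \<le> 2 / \<tau> * (exp (\<tau> * x) + exp (- \<tau> * x))"
    using assms by (intro mult_left_mono) (auto simp: abs_if)
  finally show ?thesis .
qed

lemma (in prob_space) expectation_exp_pos:
  fixes X :: "'a \<Rightarrow> real"
  assumes "integrable M (\<lambda>z. exp (X z))"
  shows "(\<integral>z. exp (X z) \<partial>M) > 0"
proof -
  have "(\<integral>z. 0 \<partial>M) < (\<integral>z. exp (X z) \<partial>M)"
    by (rule integral_less_AE_space) (use assms in \<open>auto simp: emeasure_space_1\<close>)
  then show ?thesis by simp
qed

text \<open>The logarithm of the moment generating function has the mean as its derivative at zero.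
  Only an upper bound is wanted, so \<open>ln u \<le> u - 1\<close> reduces it to the difference
  quotients of the function itself.\<close>

lemma mgf_derivative_below:
  fixes X :: "'z \<Rightarrow> real"
  assumes "prob_space M" "t0 > 0" and int: "\<And>t. \<bar>t\<bar> < t0 \<Longrightarrow> integrable M (\<lambda>z. exp (t * X z))"
    and [measurable]: "X \<in> borel_measurable M" and R: "(\<integral>z. X z \<partial>M) < R"
  shows "\<exists>t. 0 < t \<and> t \<le> 1 \<and> t < t0 \<and> ln (\<integral>z. exp (t * X z) \<partial>M) / t < R"
proof -
  interpret prob_space M by fact
  define \<tau> where "\<tau> = min (t0 / 2) 1"
  have \<tau>: "\<tau> > 0" "\<tau> < t0" "\<tau> \<le> 1" using assms(2) by (auto simp: \<tau>_def)
  define t where "t k = \<tau> / 2 / real (Suc k)" for k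
  have t: "0 < t k" "t k \<le> \<tau> / 2" for k
  proof -
    show "0 < t k" unfolding t_def using \<tau>(1) by (intro divide_pos_pos) auto
    have "\<tau> / 2 / real (Suc k) \<le> \<tau> / 2 / 1" by (intro divide_left_mono) (use \<tau> in auto)
    then show "t k \<le> \<tau> / 2" unfolding t_def by (simp only: div_by_1)
  qed
  have t_lim: "t \<longlonglongrightarrow> 0" unfolding t_def
    using tendsto_mult[OF tendsto_const LIMSEQ_inverse_real_of_nat, of "\<tau> / 2"] by (simp only: divide_inverse mult_zero_right)
  have "t k \<noteq> 0" for k using t(1)[of k] by simp
  then have t_at: "filterlim t (at 0) sequentially" using t_lim by (simp add: filterlim_at)
  have "(\<lambda>k. \<integral>z. (exp (t k * X z) - 1) / t k \<partial>M) \<longlonglongrightarrow> (\<integral>z. X z \<partial>M)"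
  proof (rule integral_dominated_convergence)
    show "integrable M (\<lambda>z. 2 / \<tau> * (exp (\<tau> * X z) + exp (- \<tau> * X z)))"
      using int[of \<tau>] int[of "- \<tau>"] \<tau> by (intro integrable_mult_right Bochner_Integration.integrable_add) auto
    show "AE z in M. (\<lambda>k. (exp (t k * X z) - 1) / t k) \<longlonglongrightarrow> X z"
    proof (rule AE_I2)
      fix z
      have "((\<lambda>u. exp (u * X z)) has_real_derivative X z) (at 0)" by (auto intro!: derivative_eq_intros)
      then have "((\<lambda>h. (exp (h * X z) - 1) / h) \<longlongrightarrow> X z) (at 0)" by (simp add: DERIV_def)
      then show "(\<lambda>k. (exp (t k * X z) - 1) / t k) \<longlonglongrightarrow> X z"
        by (rule filterlim_compose[OF _ t_at])
    qed
    show "AE z in M. norm ((exp (t k * X z) - 1) / t k) \<le> 2 / \<tau> * (exp (\<tau> * X z) + exp (- \<tau> * X z))" for k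
      using exp_diff_quotient_bound[OF \<tau>(1) t] by (intro AE_I2) simp
  qed auto
  then have "\<forall>\<^sub>F k in sequentially. (\<integral>z. (exp (t k * X z) - 1) / t k \<partial>M) < R" using R by (rule order_tendstoD)
  then obtain k where k: "(\<integral>z. (exp (t k * X z) - 1) / t k \<partial>M) < R" by (auto simp: eventually_sequentially)
  have tk: "t k < t0" "t k \<le> 1" using t[of k] \<tau> by auto
  have ik: "integrable M (\<lambda>z. exp (t k * X z))" using int[of "t k"] t[of k] tk by simp
  have E: "(\<integral>z. exp (t k * X z) \<partial>M) > 0" by (rule expectation_exp_pos[OF ik])
  have "(\<integral>z. (exp (t k * X z) - 1) / t k \<partial>M) = ((\<integral>z. exp (t k * X z) \<partial>M) - 1) / t k"
    using ik by (simp add: prob_space)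
  moreover have "ln (\<integral>z. exp (t k * X z) \<partial>M) / t k \<le> ((\<integral>z. exp (t k * X z) \<partial>M) - 1) / t k"
    using t[of k] ln_le_minus_one[OF E] by (intro divide_right_mono) auto
  ultimately show ?thesis using k t[of k] tk by (intro exI[of _ "t k"]) auto
qed

section \<open>The joint density and the information measures expressed by it\<close>

lemma joint_density:
  assumes "prob_space Q" and Qs: "sets Q = sets (MX \<Otimes>\<^sub>M MY)"
    and ac: "absolutely_continuous (distr Q MX fst \<Otimes>\<^sub>M distr Q MY snd) Q"
  shows "Q = density (distr Q MX fst \<Otimes>\<^sub>M distr Q MY snd)
    (\<lambda>(x, y). ennreal (enn2real (RN_deriv (distr Q MX fst \<Otimes>\<^sub>M distr Q MY snd) Q (x, y))))"
proof -
  interpret Q: prob_space Q by fact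
  have [measurable]: "fst \<in> Q \<rightarrow>\<^sub>M MX" "snd \<in> Q \<rightarrow>\<^sub>M MY" by (auto simp: measurable_cong_sets[OF Qs refl])
  interpret X: prob_space "distr Q MX fst" by (rule Q.prob_space_distr) simp
  interpret Y: prob_space "distr Q MY snd" by (rule Q.prob_space_distr) simp
  interpret P: pair_prob_space "distr Q MX fst" "distr Q MY snd" ..
  define N where "N = distr Q MX fst \<Otimes>\<^sub>M distr Q MY snd"
  have sQ: "sets Q = sets N" unfolding Qs N_def by (rule sets_pair_measure_cong) auto
  interpret N: prob_space N unfolding N_def by (rule P.prob_space_axioms)
  have ac': "absolutely_continuous N Q" using ac by (simp only: N_def)
  have "density N (RN_deriv N Q) = Q" by (rule N.density_RN_deriv[OF ac' sQ])
  moreover have "AE z in N. RN_deriv N Q z \<noteq> \<infinity>"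
    by (rule N.RN_deriv_finite[OF Q.sigma_finite_measure_axioms ac' sQ])
  then have "density N (RN_deriv N Q) = density N (\<lambda>z. ennreal (enn2real (RN_deriv N Q z)))"
    by (intro density_cong) (auto simp: top.not_eq_extremum)
  ultimately have "Q = density N (\<lambda>z. ennreal (enn2real (RN_deriv N Q z)))" by simp
  then show ?thesis by (simp add: N_def case_prod_beta')
qed

lemma mutual_info_eq_integral:
  assumes "prob_space Q" and Qs: "sets Q = sets (MX \<Otimes>\<^sub>M MY)"
  shows "mutual_info MX MY Q = (\<integral>z. info_density MX MY Q z \<partial>Q)"
proof -
  have "distr Q (MX \<Otimes>\<^sub>M MY) (\<lambda>x. (fst x, snd x)) = Q" using distr_id2[of "MX \<Otimes>\<^sub>M MY" Q] Qs by simp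
  then show ?thesis
    unfolding mutual_info_def prob_space.mutual_information_def[OF assms(1)] info_density_def KL_divergence_def by simp
qed

lemma renyi_mi_eq:
  fixes p :: real
  defines "f \<equiv> \<lambda>MX MY Q x y. enn2real (RN_deriv (distr Q MX fst \<Otimes>\<^sub>M distr Q MY snd) Q (x, y))"
  defines "mom \<equiv> \<lambda>MX MY Q y. \<integral>\<^sup>+x. ennreal (f MX MY Q x y powr p) \<partial>distr Q MX fst"
  defines "outer \<equiv> \<lambda>MX MY Q. \<integral>\<^sup>+y. (if mom MX MY Q y = \<top> then \<top> else ennreal (enn2real (mom MX MY Q y) powr (1 / p))) \<partial>distr Q MY snd"
  shows "renyi_mi p MX MY Q = (if outer MX MY Q = \<top> then \<infinity> else ereal (p / (p - 1) * ln (enn2real (outer MX MY Q))))"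
  unfolding renyi_mi_def Let_def outer_def mom_def f_def by (rule refl)

text \<open>Sibson's information of order \<open>1 + t\<close> is at most the Renyi divergence of
  \<open>Q\<close> from the product of its marginals, which is \<open>ln E / t\<close> with
  \<open>E\<close> the moment generating function of the information density at \<open>t\<close>.
  For suitable small \<open>t\<close> this lies below the rate, because its limit at zero is the
  mutual information. The corresponding \<open>\<rho>\<close> is \<open>t / (1 + t)\<close>.\<close>

lemma renyi_mi_below_rate:
  assumes Qp: "prob_space Q" and Qs: "sets Q = sets (MX \<Otimes>\<^sub>M MY)"
    and ac: "absolutely_continuous (distr Q MX fst \<Otimes>\<^sub>M distr Q MY snd) Q"
    and mi: "mutual_info MX MY Q > 0" "R > mutual_info MX MY Q"
    and mgf: "\<exists>t0>0. \<forall>t. \<bar>t\<bar> < t0 \<longrightarrow> integrable Q (\<lambda>z. exp (t * info_density MX MY Q z))"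
  shows "\<exists>\<rho>\<in>{0<..1/2}. \<exists>I. renyi_mi (1 / (1 - \<rho>)) MX MY Q = ereal I \<and> I < R"
proof -
  interpret Q: prob_space Q by fact
  define \<mu> where "\<mu> = distr Q MX fst"
  define \<nu> where "\<nu> = distr Q MY snd"
  have [measurable]: "fst \<in> Q \<rightarrow>\<^sub>M MX" "snd \<in> Q \<rightarrow>\<^sub>M MY" by (auto simp: measurable_cong_sets[OF Qs refl])
  interpret \<mu>: prob_space \<mu> unfolding \<mu>_def by (rule Q.prob_space_distr) simp
  interpret \<nu>: prob_space \<nu> unfolding \<nu>_def by (rule Q.prob_space_distr) simp
  interpret N: pair_prob_space \<mu> \<nu> ..
  define f where "f x y = enn2real (RN_deriv (\<mu> \<Otimes>\<^sub>M \<nu>) Q (x, y))" for x y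
  have fm[measurable]: "(\<lambda>(x, y). f x y) \<in> borel_measurable (\<mu> \<Otimes>\<^sub>M \<nu>)" unfolding f_def by measurable
  have Q: "Q = density (\<mu> \<Otimes>\<^sub>M \<nu>) (\<lambda>(x, y). ennreal (f x y))"
    using joint_density[OF Qp Qs ac] unfolding f_def \<mu>_def \<nu>_def .
  have f0: "0 \<le> f x y" for x y by (simp add: f_def)
  define X where "X = info_density MX MY Q"
  have Xf: "X (x, y) = ln (f x y)" for x y
    by (simp add: X_def info_density_def entropy_density_def f_def \<mu>_def \<nu>_def log_def)
  have Xm: "X \<in> borel_measurable Q"
  proof -
    have "(\<lambda>(x, y). ln (f x y)) \<in> borel_measurable (\<mu> \<Otimes>\<^sub>M \<nu>)" by measurable
    moreover have "X = (\<lambda>(x, y). ln (f x y))" using Xf by auto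
    ultimately show ?thesis by (subst Q) simp
  qed
  obtain t0 where t0: "t0 > 0" "\<And>t. \<bar>t\<bar> < t0 \<Longrightarrow> integrable Q (\<lambda>z. exp (t * X z))" using mgf unfolding X_def by blast
  have "(\<integral>z. X z \<partial>Q) < R" using mi(2) mutual_info_eq_integral[OF Qp Qs] by (simp add: X_def)
  from mgf_derivative_below[OF Qp t0 Xm this]
  obtain t where t: "0 < t" "t \<le> 1" "t < t0" "ln (\<integral>z. exp (t * X z) \<partial>Q) / t < R" by blast
  define E where "E = (\<integral>z. exp (t * X z) \<partial>Q)"
  have ie: "integrable Q (\<lambda>z. exp (t * X z))" using t0(2)[of t] t by simp
  have E0: "E > 0" unfolding E_def by (rule Q.expectation_exp_pos[OF ie])
  define p where "p = 1 + t"
  have p: "p > 1" using t by (simp add: p_def)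
  define mom where "mom y = (\<integral>\<^sup>+x. ennreal (f x y powr p) \<partial>\<mu>)" for y
  have [measurable]: "mom \<in> borel_measurable \<nu>" unfolding mom_def by measurable
  have momE: "(\<integral>\<^sup>+y. mom y \<partial>\<nu>) = ennreal E"
  proof -
    have "(\<integral>\<^sup>+y. mom y \<partial>\<nu>) = (\<integral>\<^sup>+z. (case z of (x, y) \<Rightarrow> ennreal (f x y powr p)) \<partial>(\<mu> \<Otimes>\<^sub>M \<nu>))"
      unfolding mom_def by (subst N.nn_integral_snd[symmetric]) auto
    \<comment> \<open>Where the density vanishes \<open>ln 0\<close> is a junk value, but both sides
      are zero there.\<close>
    also have "\<dots> = (\<integral>\<^sup>+z. (case z of (x, y) \<Rightarrow> ennreal (f x y)) * ennreal (exp (t * X z)) \<partial>(\<mu> \<Otimes>\<^sub>M \<nu>))"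
    proof (intro nn_integral_cong, clarify)
      fix x y
      show "ennreal (f x y powr p) = ennreal (f x y) * ennreal (exp (t * X (x, y)))"
        using f0[of x y] t by (cases "f x y = 0") (auto simp: Xf powr_def p_def distrib_right exp_add ennreal_mult)
    qed
    also have "\<dots> = (\<integral>\<^sup>+z. ennreal (exp (t * X z)) \<partial>Q)"
    proof -
      have "(\<lambda>z. ennreal (exp (t * X z))) \<in> borel_measurable (\<mu> \<Otimes>\<^sub>M \<nu>)"
        using Xm by (subst (asm) Q) simp
      then show ?thesis by (subst Q) (rule nn_integral_density[symmetric], auto)
    qed
    also have "\<dots> = ennreal E" unfolding E_def by (rule nn_integral_eq_integral[OF ie]) simp
    finally show ?thesis .
  qed
  define outer where "outer = (\<integral>\<^sup>+y. (if mom y = \<top> then \<top> else ennreal (enn2real (mom y) powr (1 / p))) \<partial>\<nu>)"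
  have fin: "AE y in \<nu>. mom y \<noteq> \<infinity>" by (rule nn_integral_PInf_AE) (use momE in auto)
  define w where "w y = enn2real (mom y) powr (1 / p)" for y
  have [measurable]: "w \<in> borel_measurable \<nu>" unfolding w_def by measurable
  have outer_w: "outer = (\<integral>\<^sup>+y. ennreal (w y) \<partial>\<nu>)"
    unfolding outer_def w_def by (intro nn_integral_cong_AE) (use fin in eventually_elim, auto)
  \<comment> \<open>Jensen's inequality for the \<open>p\<close>-th root, by way of the tangent at
    the root of the mean.\<close>
  define c where "c = E powr (1 / p)"
  have c: "c > 0" using E0 by (simp add: c_def)
  have cp: "c powr p = E" using E0 p by (simp add: c_def powr_powr)
  have "ennreal (p * c powr (p - 1)) * outer = (\<integral>\<^sup>+y. ennreal (p * c powr (p - 1)) * ennreal (w y) \<partial>\<nu>)"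
    unfolding outer_w by (rule nn_integral_cmult[symmetric]) measurable
  also have "\<dots> \<le> (\<integral>\<^sup>+y. mom y + ennreal ((p - 1) * E) \<partial>\<nu>)"
  proof (intro nn_integral_mono_AE, use fin in eventually_elim)
    fix y assume "mom y \<noteq> \<infinity>"
    then obtain r where r: "mom y = ennreal r" "r \<ge> 0" by (cases "mom y") auto
    have w: "w y \<ge> 0" "w y powr p = r" using r p by (auto simp: w_def powr_powr)
    have "p * c powr (p - 1) * w y \<le> r + (p - 1) * E" using young_tangent(1)[OF w(1) c p] w(2) cp by simp
    then have "ennreal (p * c powr (p - 1) * w y) \<le> ennreal (r + (p - 1) * E)" by (rule ennreal_leI)
    then show "ennreal (p * c powr (p - 1)) * ennreal (w y) \<le> mom y + ennreal ((p - 1) * E)"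
      using r p w E0 by (simp add: ennreal_mult ennreal_plus)
  qed
  also have "\<dots> = ennreal E + ennreal ((p - 1) * E)" by (subst nn_integral_add) (auto simp: momE \<nu>.emeasure_space_1)
  also have "\<dots> = ennreal (p * E)" using E0 p by (subst ennreal_plus[symmetric]) (auto simp: algebra_simps)
  also have "p * E = p * c powr (p - 1) * c" using c cp by (simp add: powr_diff)
  also have "ennreal \<dots> = ennreal (p * c powr (p - 1)) * ennreal c" using c p by (simp add: ennreal_mult)
  finally have outer_le: "outer \<le> ennreal c"
    using c p by (subst (asm) ennreal_mult_le_mult_iff) auto
  then have outer_fin: "outer \<noteq> \<top>" by (auto simp: top_unique)
  define I where "I = p / (p - 1) * ln (enn2real outer)"
  have "renyi_mi p MX MY Q = ereal I"
    using outer_fin unfolding renyi_mi_eq I_def outer_def mom_def f_def \<mu>_def \<nu>_def by simp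
  moreover have "I < R"
  proof (cases "enn2real outer > 0")
    case True
    have "enn2real outer \<le> c" using outer_le c by (intro enn2real_leI) auto
    then have "ln (enn2real outer) \<le> ln c" using True by simp
    also have "\<dots> = ln E / p" using E0 by (simp add: c_def ln_powr)
    finally have "I \<le> p / (p - 1) * (ln E / p)" unfolding I_def using p by (intro mult_left_mono) auto
    also have "\<dots> = ln E / t" using p by (simp add: p_def)
    also have "\<dots> < R" using t(4) by (simp add: E_def)
    finally show ?thesis .
  next
    \<comment> \<open>The totalised logarithm gives \<open>I = 0\<close> in this degenerate case,
      and the rate exceeds a positive mutual information.\<close>
    case False
    then have "enn2real outer = 0" using enn2real_nonneg[of outer] by linarith
    then show ?thesis using mi by (simp add: I_def)
  qed
  moreover have "1 / (1 - t / (1 + t)) = p" using t by (simp add: p_def field_simps)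
  moreover have "t / (1 + t) \<in> {0<..1/2}" using t by (auto simp: field_simps)
  ultimately show ?thesis by metis
qed

text \<open>The code construction quantifies over all inputs, whereas normalisation, privacy, finite
  moments and a constant norm are available only almost everywhere. Inputs outside a measurable set
  of full measure are redirected to one good letter \<open>x0\<close>; this leaves the joint law
  unchanged and makes every property hold throughout.\<close>

lemma letter_kernel:
  fixes MX :: "'a measure" and MY :: "'b measure"
  assumes Qp: "prob_space Q" and Qs: "sets Q = sets (MX \<Otimes>\<^sub>M MY)"
    and ac: "absolutely_continuous (distr Q MX fst \<Otimes>\<^sub>M distr Q MY snd) Q"
    and ldp: "synthesizes_ldp MX MY Q \<epsilon> \<delta>" and \<delta>: "\<delta> \<ge> 0"
    and p: "p > 1" and I: "renyi_mi p MX MY Q = ereal I"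
  defines "\<mu> \<equiv> distr Q MX fst" and "Z \<equiv> exp ((p - 1) / p * I)"
  shows "\<exists>q g \<phi>. prob_space q \<and> sets q = sets MY \<and> (\<lambda>(x, y). g x y) \<in> borel_measurable (\<mu> \<Otimes>\<^sub>M q) \<and>
     (\<forall>x y. 0 \<le> g x y) \<and> (\<forall>x\<in>space \<mu>. (\<integral>\<^sup>+y. ennreal (g x y) \<partial>q) = 1) \<and>
     Q = density (\<mu> \<Otimes>\<^sub>M q) (\<lambda>(x, y). ennreal (g x y)) \<and>
     (\<forall>x\<in>space \<mu>. \<forall>x'\<in>space \<mu>. (\<integral>\<^sup>+y. ennreal (g x y - exp \<epsilon> * g x' y) \<partial>q) \<le> ennreal \<delta>) \<and>
     \<phi> \<in> borel_measurable \<mu> \<and> (\<forall>x\<in>space \<mu>. (\<integral>\<^sup>+y. ennreal (g x y powr p) \<partial>q) = ennreal (\<phi> x) \<and> 0 < \<phi> x) \<and>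
     ((\<forall>x\<in>space \<mu>. \<phi> x \<le> Z powr p) \<or> (\<exists>m>0. m < Z \<and> (\<integral>\<^sup>+x. ennreal (\<phi> x powr (1 / p)) \<partial>\<mu>) \<le> ennreal m))"
proof -
  interpret Q: prob_space Q by fact
  define \<nu> where "\<nu> = distr Q MY snd"
  have [measurable]: "fst \<in> Q \<rightarrow>\<^sub>M MX" "snd \<in> Q \<rightarrow>\<^sub>M MY" by (auto simp: measurable_cong_sets[OF Qs refl])
  interpret \<mu>: prob_space \<mu> unfolding \<mu>_def by (rule Q.prob_space_distr) simp
  interpret \<nu>: prob_space \<nu> unfolding \<nu>_def by (rule Q.prob_space_distr) simp
  have s: "sets MX = sets \<mu>" "sets MY = sets \<nu>" by (auto simp: \<mu>_def \<nu>_def)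
  define f where "f x y = enn2real (RN_deriv (\<mu> \<Otimes>\<^sub>M \<nu>) Q (x, y))" for x y
  have fm[measurable]: "(\<lambda>(x, y). f x y) \<in> borel_measurable (\<mu> \<Otimes>\<^sub>M \<nu>)" unfolding f_def by measurable
  have Qf: "Q = density (\<mu> \<Otimes>\<^sub>M \<nu>) (\<lambda>(x, y). ennreal (f x y))"
    using joint_density[OF Qp Qs ac] unfolding f_def \<mu>_def \<nu>_def .
  have f0: "0 \<le> f x y" for x y by (simp add: f_def)
  have marg1: "distr Q \<mu> fst = \<mu>" unfolding \<mu>_def by (rule distr_cong) auto
  have marg2: "distr Q \<nu> snd = \<nu>" unfolding \<nu>_def by (rule distr_cong) auto
  from synthesizes_ldp_cong[OF s ldp] obtain W where W: "W \<in> \<mu> \<rightarrow>\<^sub>M prob_algebra \<nu>"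
    and QW: "Q = \<mu> \<bind> (\<lambda>x. W x \<bind> (\<lambda>y. return (\<mu> \<Otimes>\<^sub>M \<nu>) (x, y)))" and Wl: "ldp_mechanism \<mu> \<nu> W \<epsilon> \<delta>"
    unfolding synthesizes_ldp_def marg1 by blast
  have KW: "kernel_joint \<mu> \<nu> W = density (\<mu> \<Otimes>\<^sub>M \<nu>) (\<lambda>(x, y). ennreal (f x y))"
    unfolding kernel_joint_def QW[symmetric] by (rule Qf)
  obtain X where X: "AE x in \<mu>. x \<in> X" "\<And>x. x \<in> X \<Longrightarrow> (\<integral>\<^sup>+y. ennreal (f x y) \<partial>\<nu>) = 1"
    "\<And>x x'. x \<in> X \<Longrightarrow> x' \<in> X \<Longrightarrow> (\<integral>\<^sup>+y. ennreal (f x y - exp \<epsilon> * f x' y) \<partial>\<nu>) \<le> ennreal \<delta>"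
    using hockey_stick_of_disintegration[OF \<mu>.prob_space_axioms \<nu>.prob_space_axioms fm f0 W KW Wl \<delta>] by blast
  define mom where "mom y = (\<integral>\<^sup>+x. ennreal (f x y powr p) \<partial>\<mu>)" for y
  define out where "out = (\<integral>\<^sup>+y. (if mom y = \<top> then \<top> else ennreal (enn2real (mom y) powr (1 / p))) \<partial>\<nu>)"
  have ren: "renyi_mi p MX MY Q = (if out = \<top> then \<infinity> else ereal (p / (p - 1) * ln (enn2real out)))"
    unfolding renyi_mi_eq out_def mom_def f_def \<mu>_def \<nu>_def by (rule refl)
  have out_fin: "out \<noteq> \<top>" and I_eq: "I = p / (p - 1) * ln (enn2real out)" using ren I by (auto split: if_splits)
  define Z0 where "Z0 = enn2real out"
  have "out = ennreal Z0" using out_fin by (simp add: Z0_def less_top)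
  then have outer: "(\<integral>\<^sup>+y. (if (\<integral>\<^sup>+x. ennreal (f x y powr p) \<partial>\<mu>) = \<top> then \<top> else ennreal (enn2real (\<integral>\<^sup>+x. ennreal (f x y powr p) \<partial>\<mu>) powr (1 / p))) \<partial>\<nu>) = ennreal Z0"
    unfolding out_def mom_def .
  have "Z0 \<ge> 0" by (simp add: Z0_def)
  from tilted_kernel[OF \<mu>.prob_space_axioms \<nu>.prob_space_axioms fm f0 Qp Qf marg2 p outer this]
  obtain q g where Z0: "Z0 > 0" and q: "prob_space q" "sets q = sets \<nu>" and gm[measurable]: "(\<lambda>(x, y). g x y) \<in> borel_measurable (\<mu> \<Otimes>\<^sub>M q)"
    and g0: "\<And>x y. 0 \<le> g x y" and Qg: "Q = density (\<mu> \<Otimes>\<^sub>M q) (\<lambda>(x, y). ennreal (g x y))"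
    and g1: "\<And>x. x \<in> space \<mu> \<Longrightarrow> (\<integral>\<^sup>+y. ennreal (g x y) \<partial>q) = (\<integral>\<^sup>+y. ennreal (f x y) \<partial>\<nu>)"
    and gh: "\<And>x x' c. x \<in> space \<mu> \<Longrightarrow> x' \<in> space \<mu> \<Longrightarrow> (\<integral>\<^sup>+y. ennreal (g x y - c * g x' y) \<partial>q) = (\<integral>\<^sup>+y. ennreal (f x y - c * f x' y) \<partial>\<nu>)"
    and gp: "(\<integral>\<^sup>+x. \<integral>\<^sup>+y. ennreal (g x y powr p) \<partial>q \<partial>\<mu>) = ennreal (Z0 powr p)" by blast
  \<comment> \<open>The normalising constant of the tilt is the exponential of
    \<open>(p - 1) / p\<close> times Sibson's information, by the definition of the latter.\<close>
  have ZZ: "Z = Z0"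
  proof -
    have "(p - 1) / p * I = ln Z0" using p by (simp add: I_eq Z0_def)
    then show ?thesis using Z0 by (simp add: Z_def)
  qed
  interpret q: prob_space q by (rule q(1))
  define \<Phi> where "\<Phi> x = (\<integral>\<^sup>+y. ennreal (g x y powr p) \<partial>q)" for x
  have [measurable]: "\<Phi> \<in> borel_measurable \<mu>" unfolding \<Phi>_def by measurable
  have "AE x in \<mu>. \<Phi> x \<noteq> \<infinity>" by (rule nn_integral_PInf_AE) (use gp in \<open>auto simp: \<Phi>_def\<close>)
  define \<phi> where "\<phi> x = enn2real (\<Phi> x)" for x
  have \<phi>m[measurable]: "\<phi> \<in> borel_measurable \<mu>" unfolding \<phi>_def by measurable
  have \<phi>int: "(\<integral>\<^sup>+x. ennreal (\<phi> x) \<partial>\<mu>) = ennreal (Z0 powr p)"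
  proof -
    have "(\<integral>\<^sup>+x. ennreal (\<phi> x) \<partial>\<mu>) = (\<integral>\<^sup>+x. \<Phi> x \<partial>\<mu>)"
      by (intro nn_integral_cong_AE) (use \<open>AE x in \<mu>. \<Phi> x \<noteq> \<infinity>\<close> in eventually_elim, auto simp: \<phi>_def less_top)
    then show ?thesis using gp by (simp add: \<Phi>_def)
  qed
  define t where "t x = \<phi> x powr (1 / p)" for x
  have [measurable]: "t \<in> borel_measurable \<mu>" unfolding t_def by measurable
  have t: "t x \<ge> 0" "t x powr p = \<phi> x" for x using p by (auto simp: t_def powr_powr \<phi>_def)
  text \<open>Strict Jensen: unless \<^term>\<open>\<phi>\<close> is constant there is an exponential gain.\<close>
  have dich: "(AE x in \<mu>. \<phi> x = Z0 powr p) \<or> (\<exists>m>0. m < Z0 \<and> (\<integral>\<^sup>+x. ennreal (t x) \<partial>\<mu>) \<le> ennreal m)"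
  proof -
    define k where "k = p * Z0 powr (p - 1)"
    have k: "k > 0" using p Z0 by (simp add: k_def)
    \<comment> \<open>The gap in the tangent inequality at \<open>Z0\<close>. Its integral is
      \<open>k\<close> times the deficit of the mean norm below \<open>Z0\<close>, so without a
      deficit \<open>t = Z0\<close> almost everywhere.\<close>
    define D where "D x = t x powr p + (p - 1) * Z0 powr p - k * t x" for x
    have D0: "D x \<ge> 0" for x using young_tangent(1)[OF t(1) Z0 p, of x] by (simp add: D_def k_def)
    have [measurable]: "D \<in> borel_measurable \<mu>" unfolding D_def by measurable
    have kZ: "Z0 powr p + (p - 1) * Z0 powr p = k * Z0" using Z0 by (simp add: k_def powr_diff algebra_simps)
    have "(\<integral>\<^sup>+x. ennreal (D x) \<partial>\<mu>) + ennreal k * (\<integral>\<^sup>+x. ennreal (t x) \<partial>\<mu>) = (\<integral>\<^sup>+x. ennreal (D x) + ennreal k * ennreal (t x) \<partial>\<mu>)"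
      by (subst nn_integral_cmult[symmetric], measurable, rule nn_integral_add[symmetric]) measurable
    also have "\<dots> = (\<integral>\<^sup>+x. ennreal (\<phi> x) + ennreal ((p - 1) * Z0 powr p) \<partial>\<mu>)"
    proof (rule nn_integral_cong)
      fix x
      have "ennreal (D x) + ennreal k * ennreal (t x) = ennreal (D x + k * t x)"
        using D0[of x] k t(1)[of x] by (simp add: ennreal_mult ennreal_plus)
      also have "D x + k * t x = \<phi> x + (p - 1) * Z0 powr p" by (simp add: D_def t)
      also have "ennreal \<dots> = ennreal (\<phi> x) + ennreal ((p - 1) * Z0 powr p)"
        using p by (intro ennreal_plus) (auto simp: \<phi>_def)
      finally show "ennreal (D x) + ennreal k * ennreal (t x) = ennreal (\<phi> x) + ennreal ((p - 1) * Z0 powr p)" .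
    qed
    also have "\<dots> = ennreal (Z0 powr p) + ennreal ((p - 1) * Z0 powr p)"
      by (subst nn_integral_add) (auto simp: \<phi>int \<mu>.emeasure_space_1)
    also have "\<dots> = ennreal (k * Z0)" unfolding kZ[symmetric] using p by (intro ennreal_plus[symmetric]) auto
    also have "\<dots> = ennreal k * ennreal Z0" using k Z0 by (intro ennreal_mult) auto
    finally have eq: "(\<integral>\<^sup>+x. ennreal (D x) \<partial>\<mu>) + ennreal k * (\<integral>\<^sup>+x. ennreal (t x) \<partial>\<mu>) = ennreal k * ennreal Z0" .
    then have "ennreal k * (\<integral>\<^sup>+x. ennreal (t x) \<partial>\<mu>) \<le> ennreal k * ennreal Z0" by (metis add_increasing order_refl zero_le)
    then have le: "(\<integral>\<^sup>+x. ennreal (t x) \<partial>\<mu>) \<le> ennreal Z0" using k by (subst (asm) ennreal_mult_le_mult_iff) auto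
    then obtain m where m: "(\<integral>\<^sup>+x. ennreal (t x) \<partial>\<mu>) = ennreal m" "m \<ge> 0" "m \<le> Z0" using Z0 by (auto simp: le_ennreal_iff)
    show ?thesis
    proof (cases "m = Z0")
      case True
      have "ennreal k * ennreal Z0 + (\<integral>\<^sup>+x. ennreal (D x) \<partial>\<mu>) = ennreal k * ennreal Z0 + 0"
        using eq m True by (simp add: add.commute)
      then have "(\<integral>\<^sup>+x. ennreal (D x) \<partial>\<mu>) = 0" unfolding ennreal_add_left_cancel by (auto simp: ennreal_mult_eq_top_iff)
      then have "AE x in \<mu>. ennreal (D x) = 0" by (subst (asm) nn_integral_0_iff_AE) auto
      then have "AE x in \<mu>. \<phi> x = Z0 powr p"
      proof eventually_elim
        case (elim x)
        then have "D x = 0" using D0[of x] by (simp add: ennreal_eq_0_iff)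
        then have "t x = Z0" using young_tangent(2)[OF t(1) Z0 p, of x] by (simp add: D_def k_def)
        then show ?case using t(2)[of x] by simp
      qed
      then show ?thesis ..
    next
      case False
      \<comment> \<open>The midpoint is strictly between 0 and \<open>Z0\<close> even if the mean
        norm \<open>m\<close> were zero, as the logarithm of the bound is taken later.\<close>
      then have "(m + Z0) / 2 < Z0" "(m + Z0) / 2 > 0" "m \<le> (m + Z0) / 2" using m Z0 by auto
      then show ?thesis unfolding m(1) by (intro disjI2 exI[of _ "(m + Z0) / 2"]) (auto intro: ennreal_leI)
    qed
  qed
  \<comment> \<open>The last conjunct is an implication because a pointwise value of
    \<open>\<phi>\<close> is available only in the first branch of \<open>dich\<close>.\<close>
  define good where "good x \<longleftrightarrow> x \<in> X \<and> x \<in> space \<mu> \<and> \<Phi> x \<noteq> \<infinity> \<and> ((AE x in \<mu>. \<phi> x = Z0 powr p) \<longrightarrow> \<phi> x = Z0 powr p)" for x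
  have "AE x in \<mu>. (AE x in \<mu>. \<phi> x = Z0 powr p) \<longrightarrow> \<phi> x = Z0 powr p"
    by (cases "AE x in \<mu>. \<phi> x = Z0 powr p") auto
  with X(1) AE_space \<open>AE x in \<mu>. \<Phi> x \<noteq> \<infinity>\<close> have "AE x in \<mu>. good x"
    by eventually_elim (simp add: good_def)
  then obtain B where B: "{x\<in>space \<mu>. \<not> good x} \<subseteq> B" "B \<in> sets \<mu>" "emeasure \<mu> B = 0" by (rule AE_E)
  define G where "G = space \<mu> - B"
  have G: "G \<in> sets \<mu>" "\<And>x. x \<in> G \<Longrightarrow> good x" "\<And>x. x \<in> G \<Longrightarrow> x \<in> space \<mu>" using B by (auto simp: G_def)
  have aeG: "AE x in \<mu>. x \<in> G"
  proof -
    have "AE x in \<mu>. x \<notin> B" using B by (intro AE_not_in null_setsI) auto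
    with AE_space show ?thesis by eventually_elim (simp add: G_def)
  qed
  have "G \<noteq> {}"
  proof
    assume "G = {}"
    with aeG show False by (simp add: \<mu>.AE_False)
  qed
  then obtain x0 where x0: "x0 \<in> G" by blast
  define r where "r x = (if x \<in> G then x else x0)" for x
  have rG: "r x \<in> G" for x using x0 by (simp add: r_def)
  have rm[measurable]: "r \<in> \<mu> \<rightarrow>\<^sub>M \<mu>" unfolding r_def using G(1) G(3)[OF x0] by measurable
  have rs: "r x \<in> space \<mu>" "r x \<in> X" "\<Phi> (r x) \<noteq> \<infinity>" "(AE x in \<mu>. \<phi> x = Z0 powr p) \<Longrightarrow> \<phi> (r x) = Z0 powr p" for x
    using G(2)[OF rG, of x] by (auto simp: good_def)
  have g'm: "(\<lambda>(x, y). g (r x) y) \<in> borel_measurable (\<mu> \<Otimes>\<^sub>M q)"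
  proof -
    have "(\<lambda>z. (case (r (fst z), snd z) of (x, y) \<Rightarrow> g x y)) \<in> borel_measurable (\<mu> \<Otimes>\<^sub>M q)"
      by (rule measurable_compose[OF _ gm]) measurable
    then show ?thesis by (simp add: case_prod_beta')
  qed
  have "Q = density (\<mu> \<Otimes>\<^sub>M q) (\<lambda>(x, y). ennreal (g (r x) y))"
  proof (subst Qg, rule measure_eqI)
    fix E assume "E \<in> sets (density (\<mu> \<Otimes>\<^sub>M q) (\<lambda>(x, y). ennreal (g x y)))"
    then have E: "E \<in> sets (\<mu> \<Otimes>\<^sub>M q)" by simp
    have "emeasure (density (\<mu> \<Otimes>\<^sub>M q) (\<lambda>(x, y). ennreal (h x y))) E = (\<integral>\<^sup>+x. \<integral>\<^sup>+y. ennreal (h x y) * indicator E (x, y) \<partial>q \<partial>\<mu>)"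
      if "(\<lambda>(x, y). h x y) \<in> borel_measurable (\<mu> \<Otimes>\<^sub>M q)" for h
      using that E by (subst emeasure_density) (auto simp: q.nn_integral_fst[symmetric])
    note this[OF gm] this[OF g'm]
    moreover have "(\<integral>\<^sup>+x. \<integral>\<^sup>+y. ennreal (g x y) * indicator E (x, y) \<partial>q \<partial>\<mu>) = (\<integral>\<^sup>+x. \<integral>\<^sup>+y. ennreal (g (r x) y) * indicator E (x, y) \<partial>q \<partial>\<mu>)"
      by (intro nn_integral_cong_AE) (use aeG in eventually_elim, simp add: r_def)
    ultimately show "emeasure (density (\<mu> \<Otimes>\<^sub>M q) (\<lambda>(x, y). ennreal (g x y))) E = emeasure (density (\<mu> \<Otimes>\<^sub>M q) (\<lambda>(x, y). ennreal (g (r x) y))) E" by simp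
  qed simp
  moreover have g'1: "(\<integral>\<^sup>+y. ennreal (g (r x) y) \<partial>q) = 1" for x using g1[OF rs(1)] X(2)[OF rs(2)] by simp
  moreover have "(\<integral>\<^sup>+y. ennreal (g (r x) y - exp \<epsilon> * g (r x') y) \<partial>q) \<le> ennreal \<delta>" for x x'
    unfolding gh[OF rs(1) rs(1)] by (rule X(3)[OF rs(2) rs(2)])
  moreover have "(\<lambda>x. \<phi> (r x)) \<in> borel_measurable \<mu>" by measurable
  moreover have \<phi>r: "(\<integral>\<^sup>+y. ennreal (g (r x) y powr p) \<partial>q) = ennreal (\<phi> (r x))" for x
    using rs(3)[of x] by (simp add: \<phi>_def \<Phi>_def less_top)
  \<comment> \<open>A vanishing \<open>p\<close>-th moment would force the density to vanish,
    against its total mass one.\<close>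
  moreover have "0 < \<phi> (r x)" for x
  proof (rule ccontr)
    assume "\<not> 0 < \<phi> (r x)"
    then have "(\<integral>\<^sup>+y. ennreal (g (r x) y powr p) \<partial>q) = 0" unfolding \<phi>r by (simp add: ennreal_neg not_less)
    moreover have [measurable]: "g (r x) \<in> borel_measurable q" using rs(1)[of x] by measurable
    ultimately have "AE y in q. ennreal (g (r x) y powr p) = 0" by (subst (asm) nn_integral_0_iff_AE) auto
    then have "AE y in q. ennreal (g (r x) y) = 0"
      by eventually_elim (use g0 in \<open>auto simp: ennreal_eq_0_iff powr_nonneg_iff\<close>)
    then have "(\<integral>\<^sup>+y. ennreal (g (r x) y) \<partial>q) = 0" by (subst nn_integral_0_iff_AE) auto
    then show False using g'1[of x] by simp
  qed
  moreover have "(\<forall>x\<in>space \<mu>. \<phi> (r x) \<le> Z powr p) \<or> (\<exists>m>0. m < Z \<and> (\<integral>\<^sup>+x. ennreal (\<phi> (r x) powr (1 / p)) \<partial>\<mu>) \<le> ennreal m)"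
    using dich
  proof
    assume "AE x in \<mu>. \<phi> x = Z0 powr p"
    then show ?thesis using rs(4) by (auto simp: ZZ)
  next
    assume "\<exists>m>0. m < Z0 \<and> (\<integral>\<^sup>+x. ennreal (t x) \<partial>\<mu>) \<le> ennreal m"
    moreover have "(\<integral>\<^sup>+x. ennreal (\<phi> (r x) powr (1 / p)) \<partial>\<mu>) = (\<integral>\<^sup>+x. ennreal (t x) \<partial>\<mu>)"
      by (intro nn_integral_cong_AE) (use aeG in eventually_elim, simp add: r_def t_def)
    ultimately show ?thesis by (simp add: ZZ)
  qed
  ultimately show ?thesis using q g'm g0 s(2)
    by (intro exI[of _ q] exI[of _ "\<lambda>x y. g (r x) y"] exI[of _ "\<lambda>x. \<phi> (r x)"] conjI) auto
qed

section \<open>The exponent\<close>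

text \<open>From \<open>u \<le> exp u\<close> at \<open>u = c / a * x\<close>, raised to the power
  \<open>a\<close>. It makes any exponential gain absorb any power of the blocklength.\<close>

lemma powr_exp_bounded:
  fixes a c :: real
  assumes "a > 0" "c > 0" "x > 0"
  shows "x powr a * exp (- c * x) \<le> (a / c) powr a"
proof -
  have "c / a * x \<le> exp (c / a * x)" using exp_ge_add_one_self[of "c / a * x"] by linarith
  then have "(c / a * x) powr a \<le> exp (c / a * x) powr a" using assms by (intro powr_mono2) auto
  also have "\<dots> = exp (c * x)" using assms by (simp add: powr_def)
  finally have "(a / c) powr a * ((c / a * x) powr a * exp (- c * x)) \<le> (a / c) powr a * (exp (c * x) * exp (- c * x))"
    by (intro mult_left_mono mult_right_mono) auto
  moreover have "(a / c) powr a * (c / a * x) powr a = x powr a" using assms by (simp add: powr_mult[symmetric])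
  ultimately show ?thesis by (simp add: exp_minus mult.assoc[symmetric])
qed

lemma nidx_bounds:
  assumes "R > 0"
  shows "nidx n R \<ge> 1" and "real (nidx n R) \<ge> exp (real n * R) / 2"
proof -
  have "exp (real n * R) \<ge> 1" using assms by simp
  then have "\<lfloor>exp (real n * R)\<rfloor> \<ge> 1" by simp
  then show "nidx n R \<ge> 1" unfolding nidx_def by linarith
  \<comment> \<open>A number that is at least one loses at most half of itself in rounding
    down.\<close>
  have "real (nidx n R) = of_int \<lfloor>exp (real n * R)\<rfloor>" using \<open>\<lfloor>exp (real n * R)\<rfloor> \<ge> 1\<close> by (simp add: nidx_def)
  then show "real (nidx n R) \<ge> exp (real n * R) / 2" using \<open>\<lfloor>exp (real n * R)\<rfloor> \<ge> 1\<close> by linarith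
qed

text \<open>In the denominator of the truncation level, the factor 4 covers a loss of 2 from
  rounding the index count and a loss of 2 from \<open>L + 1 \<le> 2 * L\<close> when
  \<open>L \<ge> 1\<close>. When \<open>L < 1\<close>, the quadratic lower bound on the exponential
  limits \<open>n\<close> to \<open>8 * b / R\<^sup>2\<close>, and the prefactor then makes the
  right-hand side at least one.\<close>

lemma rejection_failure_bound:
  fixes b R :: real
  assumes R: "R > 0" and b: "b > 0" and n: "n \<ge> (1::nat)" and M: "M \<ge> exp (real n * R) / 2"
  shows "exp (- M / (exp (real n * R) / (4 * b * n) + 1)) \<le> exp (8 * b\<^sup>2 / R\<^sup>2) * exp (- b * n)"
proof -
  define x where "x = exp (real n * R)"
  have x: "x > 0" by (simp add: x_def)
  have bn: "b * n > 0" using b n by simp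
  define L where "L = x / (4 * b * n)"
  have L: "L > 0" using x bn by (simp add: L_def)
  show ?thesis
  proof (cases "L \<ge> 1")
    case True
    have "b * n * (L + 1) \<le> b * n * (2 * L)" using True bn by (intro mult_left_mono) auto
    also have "\<dots> = x / 2" using b n by (simp add: L_def)
    also have "\<dots> \<le> M" using M by (simp add: x_def)
    finally have "b * n \<le> M / (L + 1)" using L by (simp add: field_simps)
    then have "exp (- M / (L + 1)) \<le> exp (- b * n)" by simp
    also have "\<dots> \<le> exp (8 * b\<^sup>2 / R\<^sup>2) * exp (- b * n)" using mult_right_mono[of 1 "exp (8 * b\<^sup>2 / R\<^sup>2)" "exp (- b * n)"] by simp
    finally show ?thesis by (simp add: L_def x_def)
  next
    case False
    then have "x < 4 * b * n" using bn by (simp add: L_def field_simps)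
    moreover have "(real n * R)\<^sup>2 / 2 \<le> x"
    proof -
      have "real n * R \<ge> 0" using R by simp
      from exp_lower_Taylor_quadratic[OF this] show ?thesis using \<open>real n * R \<ge> 0\<close> by (simp add: x_def)
    qed
    ultimately have "(real n * R)\<^sup>2 < 8 * b * n" by simp
    then have "n * (real n * R\<^sup>2) < n * (8 * b)" by (simp add: power2_eq_square algebra_simps)
    then have "real n * R\<^sup>2 < 8 * b" using n by simp
    then have "b * n \<le> 8 * b\<^sup>2 / R\<^sup>2" using b R mult_strict_left_mono[of "real n * R\<^sup>2" "8 * b" b]
      by (simp add: field_simps power2_eq_square)
    then have ge1: "1 \<le> exp (8 * b\<^sup>2 / R\<^sup>2) * exp (- b * n)" by (simp flip: exp_add)
    have le1: "exp (- M / (L + 1)) \<le> 1"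
    proof -
      have "0 \<le> exp (real n * R) / 2" by simp
      then have "M \<ge> 0" using M by linarith
      then have "0 \<le> M / (L + 1)" using L by (intro divide_nonneg_nonneg) auto
      then show ?thesis by simp
    qed
    show ?thesis using order_trans[OF le1 ge1] by (simp add: L_def x_def)
  qed
qed

text \<open>Maximality of \<open>\<rho>s\<close> is exploited by comparison with one parameter of
  positive exponent, supplied by the moment generating function near zero. Hence the information of
  the order belonging to \<open>\<rho>s\<close> is finite and below the rate, and the letter kernel
  can be built for this order.\<close>

theorem theorem3:
  fixes MX :: "'a measure" and MY :: "'b measure" and Q :: "('a \<times> 'b) measure"
    and \<epsilon> \<delta> R \<rho>s :: real
  assumes Q_prob: "prob_space Q"
    and Q_sets: "sets Q = sets (MX \<Otimes>\<^sub>M MY)"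
    and eps: "\<epsilon> \<ge> 0" and delta: "0 \<le> \<delta>" "\<delta> \<le> 1"
    and Q_ldp: "synthesizes_ldp MX MY Q \<epsilon> \<delta>"
    and Q_ac: "absolutely_continuous (distr Q MX fst \<Otimes>\<^sub>M distr Q MY snd) Q"
    and MI_pos: "mutual_info MX MY Q > 0"
    and rate: "R > mutual_info MX MY Q"
    and mgf: "\<exists>t0>0. \<forall>t. \<bar>t\<bar> < t0 \<longrightarrow> integrable Q (\<lambda>z. exp (t * info_density MX MY Q z))"
    and rho_range: "0 < \<rho>s" "\<rho>s \<le> 1 / 2"
    and rho_max: "\<forall>\<rho>\<in>{0<..1/2}.
        ereal \<rho> * (ereal R - renyi_mi (1 / (1 - \<rho>)) MX MY Q)
          \<le> ereal \<rho>s * (ereal R - renyi_mi (1 / (1 - \<rho>s)) MX MY Q)"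
  shows "\<exists>K>0. \<forall>n\<ge>1. \<exists>R0 enc dec.
           rdfc_pair n R R0 MX MY enc dec \<and>
           (let P = rdfc_joint n R0 MX MY (distr Q MX fst) enc dec;
                \<Delta> = K * (if \<rho>s = 1 / 2
                          then exp (- (real n / 2) * (R - real_of_ereal (renyi_mi 2 MX MY Q)))
                          else real n powr (- (1 - \<rho>s) / 2)
                               * exp (- real n * \<rho>s * (R - real_of_ereal (renyi_mi (1 / (1 - \<rho>s)) MX MY Q))))
            in \<forall>a>1. tv_dist P (iid_joint n MX MY Q) \<le> a * \<Delta> \<and>
                     synthesizes_ldp_n n MX MY P \<epsilon> (\<delta> + 2 * (exp \<epsilon> + 1) * a * \<Delta>))"
proof -
  define p where "p = 1 / (1 - \<rho>s)"
  have p: "p > 1" and \<rho>p: "\<rho>s = (p - 1) / p" "1 / p = 1 - \<rho>s" using rho_range by (auto simp: p_def field_simps)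
  obtain \<rho>0 I0 where \<rho>0: "\<rho>0 \<in> {0<..1/2}" "renyi_mi (1 / (1 - \<rho>0)) MX MY Q = ereal I0" "I0 < R"
    using renyi_mi_below_rate[OF Q_prob Q_sets Q_ac MI_pos rate mgf] by blast
  have "0 < ereal (\<rho>0 * (R - I0))" using \<rho>0 by simp
  also have "\<dots> \<le> ereal \<rho>s * (ereal R - renyi_mi p MX MY Q)"
    using bspec[OF rho_max \<rho>0(1)] unfolding \<rho>0(2) by (simp add: p_def)
  finally have pos: "0 < ereal \<rho>s * (ereal R - renyi_mi p MX MY Q)" .
  obtain I where I: "renyi_mi p MX MY Q = ereal I" and IR: "I < R"
  proof (cases "renyi_mi p MX MY Q")
    case (real I)
    then have "0 < \<rho>s * (R - I)" using pos by simp
    then have "I < R" using rho_range by (simp add: zero_less_mult_iff)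
    with real show ?thesis using that by blast
  next
    case PInf
    then show ?thesis using pos rho_range by simp
  next
    case MInf
    then show ?thesis by (simp add: renyi_mi_eq split: if_splits)
  qed
  define \<mu> where "\<mu> = distr Q MX fst"
  interpret Q: prob_space Q by fact
  have [measurable]: "fst \<in> Q \<rightarrow>\<^sub>M MX" by (auto simp: measurable_cong_sets[OF Q_sets refl])
  interpret \<mu>: prob_space \<mu> unfolding \<mu>_def by (rule Q.prob_space_distr) simp
  define Z where "Z = exp (\<rho>s * I)"
  have Z_eq: "Z = exp ((p - 1) / p * I)" by (simp add: Z_def \<rho>p)
  obtain q g \<phi> where q: "prob_space q" "sets q = sets MY" and gm: "(\<lambda>(x, y). g x y) \<in> borel_measurable (\<mu> \<Otimes>\<^sub>M q)"
    and g0: "\<And>x y. 0 \<le> g x y" and g1: "\<And>x. x \<in> space \<mu> \<Longrightarrow> (\<integral>\<^sup>+y. ennreal (g x y) \<partial>q) = 1"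
    and Qg: "Q = density (\<mu> \<Otimes>\<^sub>M q) (\<lambda>(x, y). ennreal (g x y))"
    and hs: "\<And>x x'. x \<in> space \<mu> \<Longrightarrow> x' \<in> space \<mu> \<Longrightarrow> (\<integral>\<^sup>+y. ennreal (g x y - exp \<epsilon> * g x' y) \<partial>q) \<le> ennreal \<delta>"
    and \<phi>m: "\<phi> \<in> borel_measurable \<mu>" and gp: "\<And>x. x \<in> space \<mu> \<Longrightarrow> (\<integral>\<^sup>+y. ennreal (g x y powr p) \<partial>q) = ennreal (\<phi> x)"
    and \<phi>0: "\<And>x. x \<in> space \<mu> \<Longrightarrow> 0 < \<phi> x"
    and dich: "(\<forall>x\<in>space \<mu>. \<phi> x \<le> Z powr p) \<or> (\<exists>m>0. m < Z \<and> (\<integral>\<^sup>+x. ennreal (\<phi> x powr (1 / p)) \<partial>\<mu>) \<le> ennreal m)"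
    using letter_kernel[OF Q_prob Q_sets Q_ac Q_ldp delta(1) p I, folded \<mu>_def Z_eq] by blast
  have R: "R > 0" using MI_pos rate by simp
  \<comment> \<open>One more than the target exponent, so that errors of order
    \<open>exp (- b * n)\<close> leave room for polynomial factors.\<close>
  define b where "b = \<rho>s * (R - I) + 1"
  have b: "b > 0" using rho_range IR by (simp add: b_def add_pos_pos)
  define L where "L n = exp (real n * R) / (4 * b * n)" for n :: nat
  \<comment> \<open>The bound claimed for \<open>\<rho>s < 1 / 2\<close>, up to its constant. It is
    established in both cases; at \<open>\<rho>s = 1 / 2\<close> its polynomial factor is at most
    one, so the claimed bound follows.\<close>
  define shape where "shape n = real n powr (- (1 - \<rho>s) / 2) * exp (- real n * \<rho>s * (R - I))" for n :: nat
  have L: "L n > 0" if "n \<ge> 1" for n using that b by (simp add: L_def)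
  have L_powr: "L n powr (- a) = (4 * b) powr a * real n powr a * exp (- real n * a * R)" if "n \<ge> 1" for n a
  proof -
    have "L n powr (- a) = exp (real n * R) powr (- a) / (4 * b * n) powr (- a)"
      using that b by (simp add: L_def powr_divide)
    also have "exp (real n * R) powr (- a) = exp (- real n * a * R)" by (simp add: powr_def mult.commute mult.left_commute)
    also have "(4 * b * n) powr (- a) = inverse ((4 * b) powr a * real n powr a)"
      using that b by (simp add: powr_mult powr_minus)
    finally show ?thesis by (simp add: divide_inverse mult.commute)
  qed
  have shape_pos: "shape n > 0" if "n \<ge> 1" for n using that by (simp add: shape_def)
  have absorb: "\<exists>K>0. \<forall>n\<ge>1. real n powr a * exp (- c * real n) * exp (- real n * \<rho>s * (R - I)) \<le> K * shape n"
    if a: "a \<ge> 0" and c: "c > 0" for a c :: real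
  proof (intro exI conjI allI impI)
    \<comment> \<open>The additional power \<open>(1 - \<rho>s) / 2\<close> compensates the decaying
      prefactor of \<open>shape\<close>.\<close>
    define a' where "a' = a + (1 - \<rho>s) / 2"
    have a': "a' > 0" using a rho_range by (simp add: a'_def add_nonneg_pos)
    show "(a' / c) powr a' > 0" using a' c by simp
    fix n :: nat assume n: "n \<ge> 1"
    have "a = a' + - (1 - \<rho>s) / 2" by (simp add: a'_def field_simps)
    then have "real n powr a = real n powr a' * real n powr (- (1 - \<rho>s) / 2)" by (simp only: powr_add)
    then have "real n powr a * exp (- c * real n) * exp (- real n * \<rho>s * (R - I)) = (real n powr a' * exp (- c * real n)) * shape n"
      by (simp add: shape_def mult.commute mult.left_commute)
    also have "\<dots> \<le> (a' / c) powr a' * shape n"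
      using powr_exp_bounded[OF a' c, of "real n"] n shape_pos[OF n] by (intro mult_right_mono) auto
    finally show "real n powr a * exp (- c * real n) * exp (- real n * \<rho>s * (R - I)) \<le> (a' / c) powr a' * shape n" .
  qed
  have "\<exists>\<tau> K. K > 0 \<and> (\<forall>n\<ge>1. 0 \<le> \<tau> n \<and> \<tau> n \<le> K * shape n \<and>
     ((\<exists>C. (\<forall>x\<in>space \<mu>. \<phi> x \<le> C) \<and> L n powr (1 - p) * C ^ n \<le> \<tau> n) \<or>
      (\<exists>m\<ge>0. (\<integral>\<^sup>+x. ennreal (\<phi> x powr (1 / p)) \<partial>\<mu>) \<le> ennreal m \<and> 2 * L n powr (1 / p - 1) * m ^ n \<le> \<tau> n)))"
    using dich
  proof
    assume A: "\<forall>x\<in>space \<mu>. \<phi> x \<le> Z powr p"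
    \<comment> \<open>The cut-off loss decays with exponent \<open>(p - 1) * (R - I)\<close>, and
      \<open>p - 1\<close> exceeds \<open>\<rho>s\<close> by
      \<open>(p - 1)\<^sup>2 / p\<close>.\<close>
    define c where "c = (p - 1 - \<rho>s) * (R - I)"
    have "p - 1 - \<rho>s = (p - 1)\<^sup>2 / p" using p by (simp add: \<rho>p(1) power2_eq_square field_simps)
    then have "p - 1 - \<rho>s > 0" using p by simp
    then have c: "c > 0" using IR by (simp add: c_def)
    obtain K where K: "K > 0" "\<And>n. n \<ge> 1 \<Longrightarrow> real n powr (p - 1) * exp (- c * real n) * exp (- real n * \<rho>s * (R - I)) \<le> K * shape n"
      using absorb[of "p - 1" c] p c by auto
    define \<tau> where "\<tau> n = L n powr (1 - p) * (Z powr p) ^ n" for n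
    have "\<tau> n \<le> (4 * b) powr (p - 1) * K * shape n" if n: "n \<ge> 1" for n
    proof -
      have "(Z powr p) ^ n = exp (real n * (p - 1) * I)"
        using p by (simp add: Z_eq powr_def exp_of_nat_mult[symmetric] mult.assoc)
      then have "\<tau> n = (4 * b) powr (p - 1) * (real n powr (p - 1) * (exp (- real n * (p - 1) * R) * exp (real n * (p - 1) * I)))"
        using L_powr[OF n, of "p - 1"] by (simp add: \<tau>_def mult.assoc)
      also have "exp (- real n * (p - 1) * R) * exp (real n * (p - 1) * I) = exp (- c * real n) * exp (- real n * \<rho>s * (R - I))"
        unfolding exp_add[symmetric] by (rule arg_cong[where f=exp]) (simp add: c_def algebra_simps)
      finally show ?thesis using K(2)[OF n] by (simp add: mult.assoc mult_left_mono)
    qed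
    then show ?thesis using A K(1) b
      by (intro exI[of _ \<tau>] exI[of _ "(4 * b) powr (p - 1) * K"]) (auto simp: \<tau>_def)
  next
    assume "\<exists>m>0. m < Z \<and> (\<integral>\<^sup>+x. ennreal (\<phi> x powr (1 / p)) \<partial>\<mu>) \<le> ennreal m"
    then obtain m where m: "m > 0" "m < Z" "(\<integral>\<^sup>+x. ennreal (\<phi> x powr (1 / p)) \<partial>\<mu>) \<le> ennreal m" by blast
    \<comment> \<open>The logarithm of \<open>Z / m\<close>, that is, the gain of strict Jensen per
      letter.\<close>
    define c where "c = \<rho>s * I - ln m"
    have "ln m < ln Z" using m by simp
    then have c: "c > 0" by (simp add: c_def Z_def)
    obtain K where K: "K > 0" "\<And>n. n \<ge> 1 \<Longrightarrow> real n powr \<rho>s * exp (- c * real n) * exp (- real n * \<rho>s * (R - I)) \<le> K * shape n"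
      using absorb[of \<rho>s c] rho_range c by auto
    define \<tau> where "\<tau> n = 2 * L n powr (1 / p - 1) * m ^ n" for n
    have "\<tau> n \<le> 2 * (4 * b) powr \<rho>s * K * shape n" if n: "n \<ge> 1" for n
    proof -
      have "m ^ n = exp (real n * ln m)" using m by (simp add: exp_of_nat_mult)
      moreover have "1 / p - 1 = - \<rho>s" by (simp add: \<rho>p(2))
      ultimately have "\<tau> n = 2 * (4 * b) powr \<rho>s * (real n powr \<rho>s * (exp (- real n * \<rho>s * R) * exp (real n * ln m)))"
        using L_powr[OF n, of \<rho>s] by (simp add: \<tau>_def mult.assoc)
      also have "exp (- real n * \<rho>s * R) * exp (real n * ln m) = exp (- c * real n) * exp (- real n * \<rho>s * (R - I))"
        unfolding exp_add[symmetric] by (rule arg_cong[where f=exp]) (simp add: c_def algebra_simps)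
      finally show ?thesis using K(2)[OF n] by (simp add: mult.assoc mult_left_mono)
    qed
    moreover have "\<exists>m\<ge>0. (\<integral>\<^sup>+x. ennreal (\<phi> x powr (1 / p)) \<partial>\<mu>) \<le> ennreal m \<and> 2 * L n powr (1 / p - 1) * m ^ n \<le> \<tau> n" for n
      by (rule exI[of _ m]) (use m in \<open>auto simp: \<tau>_def\<close>)
    moreover have "0 \<le> \<tau> n" for n using m by (simp add: \<tau>_def)
    moreover have "2 * (4 * b) powr \<rho>s * K > 0" using K(1) b by simp
    ultimately show ?thesis by blast
  qed
  then obtain \<tau> K1 where K1: "K1 > 0" and \<tau>: "\<And>n. n \<ge> 1 \<Longrightarrow> 0 \<le> \<tau> n" "\<And>n. n \<ge> 1 \<Longrightarrow> \<tau> n \<le> K1 * shape n"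
    and cases: "\<And>n. n \<ge> 1 \<Longrightarrow> (\<exists>C. (\<forall>x\<in>space \<mu>. \<phi> x \<le> C) \<and> L n powr (1 - p) * C ^ n \<le> \<tau> n) \<or>
      (\<exists>m\<ge>0. (\<integral>\<^sup>+x. ennreal (\<phi> x powr (1 / p)) \<partial>\<mu>) \<le> ennreal m \<and> 2 * L n powr (1 / p - 1) * m ^ n \<le> \<tau> n)"
    by blast
  obtain K2 where K2: "K2 > 0" "\<And>n. n \<ge> 1 \<Longrightarrow> exp (- b * real n) \<le> K2 * shape n"
  proof -
    obtain K where K: "K > 0" "\<And>n. n \<ge> 1 \<Longrightarrow> real n powr 0 * exp (- 1 * real n) * exp (- real n * \<rho>s * (R - I)) \<le> K * shape n"
      using absorb[of 0 1] by auto
    have "exp (- b * real n) \<le> K * shape n" if n: "n \<ge> 1" for n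
    proof -
      have "exp (- b * real n) = exp (- 1 * real n) * exp (- real n * \<rho>s * (R - I))"
        unfolding exp_add[symmetric] by (rule arg_cong[where f=exp]) (simp add: b_def algebra_simps)
      then show ?thesis using K(2)[OF n] n by simp
    qed
    with K(1) show ?thesis using that by blast
  qed
  \<comment> \<open>The shares of the truncation loss, of failed rejection, and of the
    discretisation error \<open>3 * \<eta>\<close>.\<close>
  define K where "K = K1 + exp (8 * b\<^sup>2 / R\<^sup>2) * K2 + 3 * K2"
  have K: "K > 0" using K1 K2 by (simp add: K_def add_pos_pos)
  show ?thesis
  proof (rule exI[of _ K], rule conjI[OF K], intro allI impI)
    fix n :: nat assume n: "n \<ge> 1"
    \<comment> \<open>The discretisation may be as fine as desired, since it affects the amount of
      common randomness and not the communication rate.\<close>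
    define \<eta> where "\<eta> = exp (- b * real n)"
    define \<omega> where "\<omega> = \<tau> n + exp (- real (nidx n R) / (L n + 1)) + 3 * \<eta>"
    have "\<eta> > 0" by (simp add: \<eta>_def)
    from rdfc_code[OF \<mu>.prob_space_axioms q(1) gm g0 g1 Q_prob Qg _ q(2) hs delta(1) p gp \<phi>m \<phi>0 n nidx_bounds(1)[OF R] L[OF n] this \<tau>(1)[OF n] cases[OF n], of MX]
    obtain R0 enc dec where code: "rdfc_pair n R R0 MX MY enc dec"
      "tv_dist (rdfc_joint n R0 MX MY \<mu> enc dec) (iid_joint n MX MY Q) \<le> \<omega>"
      "synthesizes_ldp_n n MX MY (rdfc_joint n R0 MX MY \<mu> enc dec) \<epsilon> (\<delta> + (1 + exp \<epsilon>) * \<omega>)"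
      unfolding \<omega>_def by (auto simp: \<mu>_def)
    define \<Delta> where "\<Delta> = K * (if \<rho>s = 1 / 2
                          then exp (- (real n / 2) * (R - real_of_ereal (renyi_mi 2 MX MY Q)))
                          else real n powr (- (1 - \<rho>s) / 2)
                               * exp (- real n * \<rho>s * (R - real_of_ereal (renyi_mi (1 / (1 - \<rho>s)) MX MY Q))))"
    have "exp (- real (nidx n R) / (L n + 1)) \<le> exp (8 * b\<^sup>2 / R\<^sup>2) * \<eta>"
      unfolding L_def \<eta>_def by (rule rejection_failure_bound[OF R b n nidx_bounds(2)[OF R]])
    also have "\<dots> \<le> exp (8 * b\<^sup>2 / R\<^sup>2) * (K2 * shape n)" using K2(2)[OF n] by (intro mult_left_mono) (auto simp: \<eta>_def)
    finally have "\<omega> \<le> K1 * shape n + exp (8 * b\<^sup>2 / R\<^sup>2) * (K2 * shape n) + 3 * (K2 * shape n)"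
      unfolding \<omega>_def using \<tau>(2)[OF n] K2(2)[OF n] by (intro add_mono mult_left_mono) (auto simp: \<eta>_def)
    then have "\<omega> \<le> K * shape n" by (simp add: K_def algebra_simps)
    also have "\<dots> \<le> \<Delta>"
    proof (cases "\<rho>s = 1 / 2")
      case True
      have "p = 2" unfolding p_def True by simp
      have "shape n \<le> 1 * exp (- real n * \<rho>s * (R - I))"
        unfolding shape_def
      proof (rule mult_right_mono)
        have "real n powr (- (1 - \<rho>s) / 2) \<le> real n powr 0" by (rule powr_mono) (use n rho_range in auto)
        then show "real n powr (- (1 - \<rho>s) / 2) \<le> 1" using n by simp
      qed simp
      also have "\<dots> = exp (- (real n / 2) * (R - real_of_ereal (renyi_mi 2 MX MY Q)))"
        using I unfolding \<open>p = 2\<close> by (simp add: True)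
      finally show ?thesis using True K by (simp add: \<Delta>_def)
    next
      case False
      then show ?thesis using I by (simp add: \<Delta>_def shape_def p_def)
    qed
    finally have \<omega>\<Delta>: "\<omega> \<le> \<Delta>" .
    have \<omega>0: "\<omega> \<ge> 0" using \<tau>(1)[OF n] \<open>\<eta> > 0\<close> by (simp add: \<omega>_def add_nonneg_nonneg)
    have "\<forall>a>1. tv_dist (rdfc_joint n R0 MX MY \<mu> enc dec) (iid_joint n MX MY Q) \<le> a * \<Delta> \<and>
       synthesizes_ldp_n n MX MY (rdfc_joint n R0 MX MY \<mu> enc dec) \<epsilon> (\<delta> + 2 * (exp \<epsilon> + 1) * a * \<Delta>)"
    proof (intro allI impI)
      fix a :: real assume a: "a > 1"
      \<comment> \<open>One code serves every \<open>a\<close>, because its error is already at most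
        \<open>\<Delta>\<close>.\<close>
      have "1 * \<Delta> \<le> a * \<Delta>" using a \<omega>0 \<omega>\<Delta> by (intro mult_right_mono) auto
      then have \<omega>a: "\<omega> \<le> a * \<Delta>" using \<omega>\<Delta> by simp
      have "1 * ((1 + exp \<epsilon>) * \<omega>) \<le> 2 * ((1 + exp \<epsilon>) * (a * \<Delta>))"
        using \<omega>a \<omega>0 by (intro mult_mono) (auto intro: add_nonneg_nonneg)
      then have "\<delta> + (1 + exp \<epsilon>) * \<omega> \<le> \<delta> + 2 * (exp \<epsilon> + 1) * a * \<Delta>" by (simp add: algebra_simps)
      then have "synthesizes_ldp_n n MX MY (rdfc_joint n R0 MX MY \<mu> enc dec) \<epsilon> (\<delta> + 2 * (exp \<epsilon> + 1) * a * \<Delta>)"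
        using code(3) synthesizes_ldp_mono unfolding synthesizes_ldp_n_def by blast
      then show "tv_dist (rdfc_joint n R0 MX MY \<mu> enc dec) (iid_joint n MX MY Q) \<le> a * \<Delta> \<and>
       synthesizes_ldp_n n MX MY (rdfc_joint n R0 MX MY \<mu> enc dec) \<epsilon> (\<delta> + 2 * (exp \<epsilon> + 1) * a * \<Delta>)"
        using code(2) \<omega>a by simp
    qed
    then show "\<exists>R0 enc dec. rdfc_pair n R R0 MX MY enc dec \<and>
           (let P = rdfc_joint n R0 MX MY (distr Q MX fst) enc dec;
                \<Delta> = K * (if \<rho>s = 1 / 2
                          then exp (- (real n / 2) * (R - real_of_ereal (renyi_mi 2 MX MY Q)))
                          else real n powr (- (1 - \<rho>s) / 2)
                               * exp (- real n * \<rho>s * (R - real_of_ereal (renyi_mi (1 / (1 - \<rho>s)) MX MY Q))))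
            in \<forall>a>1. tv_dist P (iid_joint n MX MY Q) \<le> a * \<Delta> \<and>
                     synthesizes_ldp_n n MX MY P \<epsilon> (\<delta> + 2 * (exp \<epsilon> + 1) * a * \<Delta>))"
      using code(1) unfolding Let_def \<Delta>_def[symmetric] \<mu>_def[symmetric] by blast
  qed
qed

end
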